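(* Let $|\gamma|<1$ and assume that $\gamma\neq0$ or $\mu$ is not normalized Lebesgue measure. Let $\Phi_\gamma^*:L^2(\mu)\to\mathcal K_{\theta_\gamma}$ be the unitary operator with $\Phi_\gamma^*U_\gamma=\mathcal M_{\theta_\gamma}\Phi_\gamma^*$, $\Phi_\gamma^*b=c^\gamma$, $\Phi_\gamma^*b_1=c_1^\gamma$. Then for all $f\in L^2(\mu)$, $$(1-|\gamma|^2)^{1/2}\Phi_\gamma^*f=\begin{pmatrix}0\\ \big(\overline\gamma-(\overline\gamma-1)T_+\mathbf 1\big)\Delta_\gamma\end{pmatrix}f+\begin{pmatrix}(1+\overline\gamma\theta_\gamma)/T_+\mathbf 1\\ (\overline\gamma-1)\Delta_\gamma\end{pmatrix}T_+f$$ a.e. on $\mathbb T$, where in the first term $f$ stands for $f_{\mathrm a}=d(f\mu)_{\mathrm a}/d\mu_{\mathrm a}$ (well defined Lebesgue-a.e. where $\Delta_\gamma\ne0$) and the product is $0$ where $\Delta_\gamma=0$.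
   Context: $\mathbb T=\{|z|=1\}$, $\mathbb D$ the unit disc, Lebesgue measure on $\mathbb T$ normalized. Let $\mu$ be a Borel probability measure on $\mathbb T$, $\mu_{\mathrm a}$ its absolutely continuous part, $U=M_\xi$ on $L^2(\mu)$, $b=\mathbf 1$, $b_1(\xi)=\overline\xi$, and for $|\gamma|<1$, $U_\gamma=U+(\gamma-1)(\,\cdot\,,b_1)_{L^2(\mu)}b$. For $\lambda\in\mathbb D$, $R_2\mu(\lambda)=\int_{\mathbb T}\frac{1+\overline\xi\lambda}{1-\overline\xi\lambda}d\mu(\xi)$, $\theta_\gamma(\lambda)=\frac{(1-\gamma)R_2\mu(\lambda)-(1+\gamma)}{(1-\overline\gamma)R_2\mu(\lambda)+(1+\overline\gamma)}$; $\theta_\gamma$ also denotes its boundary values and $\Delta_\gamma=(1-|\theta_\gamma|^2)^{1/2}$ on $\mathbb T$. Model space $\mathcal K_\theta=(H^2\oplus\operatorname{clos}\Delta L^2)\ominus\{(\theta h,\Delta h):h\in H^2\}$ (with $\theta=\theta_\gamma,\Delta=\Delta_\gamma$), model operator $\mathcal M_\theta=P_{\mathcal K_\theta}M_z|_{\mathcal K_\theta}$. Defect vectors: $c^\gamma(z)=(1-|\theta_\gamma(0)|^2)^{-1/2}\big(1-\overline{\theta_\gamma(0)}\theta_\gamma(z),\ -\overline{\theta_\gamma(0)}\Delta_\gamma(z)\big)^T$, $c_1^\gamma(z)=(1-|\theta_\gamma(0)|^2)^{-1/2}\big(z^{-1}(\theta_\gamma(z)-\theta_\gamma(0)),\ z^{-1}\Delta_\gamma(z)\big)^T$.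 For $r\in[0,\infty)\setminus\{1\}$, $T_rf(z)=\int_{\mathbb T}\frac{f(\xi)d\mu(\xi)}{1-r\overline\xi z}$, and $T_+f(z)=\lim_{r\to1^-}T_rf(z)$, which exists for Lebesgue-a.e. $z\in\mathbb T$. *)

theory Defs
  imports "HOL-Analysis.Analysis" "HOL-Probability.Probability"
begin

definition mTb :: "complex measure" where
  "mTb = distr (restrict_space lborel {0..1::real}) borel (\<lambda>t. cis (2 * pi * t))"

definition mT :: "complex measure" where
  "mT = completion mTb"

definition L2 :: "'a measure \<Rightarrow> ('a \<Rightarrow> complex) \<Rightarrow> bool" where
  "L2 M f \<longleftrightarrow> f \<in> borel_measurable M \<and> integrable M (\<lambda>x. (cmod (f x))\<^sup>2)"

definition ip :: "'a measure \<Rightarrow> ('a \<Rightarrow> complex) \<Rightarrow> ('a \<Rightarrow> complex) \<Rightarrow> complex" where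
  "ip M f g = (\<integral>x. f x * cnj (g x) \<partial>M)"

definition nrm :: "'a measure \<Rightarrow> ('a \<Rightarrow> complex) \<Rightarrow> real" where
  "nrm M f = sqrt (\<integral>x. (cmod (f x))\<^sup>2 \<partial>M)"

type_synonym vfun = "(complex \<Rightarrow> complex) \<times> (complex \<Rightarrow> complex)"

definition ip2 :: "vfun \<Rightarrow> vfun \<Rightarrow> complex" where
  "ip2 u v = (\<integral>z. fst u z * cnj (fst v z) + snd u z * cnj (snd v z) \<partial>mT)"

definition vdiff :: "vfun \<Rightarrow> vfun \<Rightarrow> vfun" where
  "vdiff u v = ((\<lambda>z. fst u z - fst v z), (\<lambda>z. snd u z - snd v z))"

definition vlin :: "complex \<Rightarrow> vfun \<Rightarrow> complex \<Rightarrow> vfun \<Rightarrow> vfun" where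
  "vlin a u b v = ((\<lambda>z. a * fst u z + b * fst v z), (\<lambda>z. a * snd u z + b * snd v z))"

definition vae_eq :: "vfun \<Rightarrow> vfun \<Rightarrow> bool" where
  "vae_eq u v \<longleftrightarrow> (AE z in mT. fst u z = fst v z \<and> snd u z = snd v z)"

definition H2 :: "(complex \<Rightarrow> complex) set" where
  "H2 = {f. L2 mT f \<and> (\<forall>n::nat. n > 0 \<longrightarrow> (\<integral>z. f z * z ^ n \<partial>mT) = 0)}"

definition closDL2 :: "(complex \<Rightarrow> complex) \<Rightarrow> (complex \<Rightarrow> complex) set" where
  "closDL2 D = {g. L2 mT g \<and>
     (\<forall>e>0. \<exists>h. L2 mT h \<and> nrm mT (\<lambda>z. g z - D z * h z) < e)}"

definition model_space :: "(complex \<Rightarrow> complex) \<Rightarrow> (complex \<Rightarrow> complex) \<Rightarrow> vfun set" where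
  "model_space th D = {u. fst u \<in> H2 \<and> snd u \<in> closDL2 D \<and>
     (\<forall>h\<in>H2. ip2 u ((\<lambda>z. th z * h z), (\<lambda>z. D z * h z)) = 0)}"

definition is_proj :: "vfun set \<Rightarrow> vfun \<Rightarrow> vfun \<Rightarrow> bool" where
  "is_proj K x w \<longleftrightarrow> w \<in> K \<and> (\<forall>v\<in>K. ip2 (vdiff x w) v = 0)"

definition mult_z :: "vfun \<Rightarrow> vfun" where
  "mult_z u = ((\<lambda>z. z * fst u z), (\<lambda>z. z * snd u z))"

definition model_op :: "(complex \<Rightarrow> complex) \<Rightarrow> (complex \<Rightarrow> complex) \<Rightarrow> vfun \<Rightarrow> vfun \<Rightarrow> bool" where
  "model_op th D u w \<longleftrightarrow> is_proj (model_space th D) (mult_z u) w"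

definition R2 :: "complex measure \<Rightarrow> complex \<Rightarrow> complex" where
  "R2 \<mu> l = (\<integral>\<xi>. (1 + cnj \<xi> * l) / (1 - cnj \<xi> * l) \<partial>\<mu>)"

definition theta :: "complex \<Rightarrow> complex measure \<Rightarrow> complex \<Rightarrow> complex" where
  "theta \<gamma> \<mu> l = ((1 - \<gamma>) * R2 \<mu> l - (1 + \<gamma>)) / ((1 - cnj \<gamma>) * R2 \<mu> l + (1 + cnj \<gamma>))"

definition theta_b :: "complex \<Rightarrow> complex measure \<Rightarrow> complex \<Rightarrow> complex" where
  "theta_b \<gamma> \<mu> z = Lim (at_left (1::real)) (\<lambda>r. theta \<gamma> \<mu> (of_real r * z))"

definition Delta :: "complex \<Rightarrow> complex measure \<Rightarrow> complex \<Rightarrow> complex" where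
  "Delta \<gamma> \<mu> z = complex_of_real (sqrt (1 - (cmod (theta_b \<gamma> \<mu> z))\<^sup>2))"

definition Tr :: "complex measure \<Rightarrow> real \<Rightarrow> (complex \<Rightarrow> complex) \<Rightarrow> complex \<Rightarrow> complex" where
  "Tr \<mu> r f z = (\<integral>\<xi>. f \<xi> / (1 - of_real r * cnj \<xi> * z) \<partial>\<mu>)"

definition Tplus :: "complex measure \<Rightarrow> (complex \<Rightarrow> complex) \<Rightarrow> complex \<Rightarrow> complex" where
  "Tplus \<mu> f z = Lim (at_left (1::real)) (\<lambda>r. Tr \<mu> r f z)"

definition c_vec :: "complex \<Rightarrow> complex measure \<Rightarrow> vfun" where
  "c_vec \<gamma> \<mu> =
    (let t0 = theta \<gamma> \<mu> 0; k = complex_of_real (1 / sqrt (1 - (cmod t0)\<^sup>2)) in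
     ((\<lambda>z. k * (1 - cnj t0 * theta_b \<gamma> \<mu> z)), (\<lambda>z. k * (- cnj t0 * Delta \<gamma> \<mu> z))))"

definition c1_vec :: "complex \<Rightarrow> complex measure \<Rightarrow> vfun" where
  "c1_vec \<gamma> \<mu> =
    (let t0 = theta \<gamma> \<mu> 0; k = complex_of_real (1 / sqrt (1 - (cmod t0)\<^sup>2)) in
     ((\<lambda>z. k * (inverse z * (theta_b \<gamma> \<mu> z - t0))), (\<lambda>z. k * (inverse z * Delta \<gamma> \<mu> z))))"

definition U_gamma :: "complex \<Rightarrow> complex measure \<Rightarrow> (complex \<Rightarrow> complex) \<Rightarrow> (complex \<Rightarrow> complex)" where
  "U_gamma \<gamma> \<mu> f = (\<lambda>\<xi>. \<xi> * f \<xi> + (\<gamma> - 1) * ip \<mu> f (\<lambda>\<eta>. cnj \<eta>) * 1)"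

definition is_Phi_star :: "complex \<Rightarrow> complex measure \<Rightarrow> ((complex \<Rightarrow> complex) \<Rightarrow> vfun) \<Rightarrow> bool" where
  "is_Phi_star \<gamma> \<mu> Phi \<longleftrightarrow>
    (let K = model_space (theta_b \<gamma> \<mu>) (Delta \<gamma> \<mu>) in
      (\<forall>f. L2 \<mu> f \<longrightarrow> Phi f \<in> K) \<and>
      (\<forall>f g a b. L2 \<mu> f \<longrightarrow> L2 \<mu> g \<longrightarrow>
          vae_eq (Phi (\<lambda>\<xi>. a * f \<xi> + b * g \<xi>)) (vlin a (Phi f) b (Phi g))) \<and>
      (\<forall>f g. L2 \<mu> f \<longrightarrow> L2 \<mu> g \<longrightarrow> ip2 (Phi f) (Phi g) = ip \<mu> f g) \<and>
      (\<forall>v\<in>K. \<exists>f. L2 \<mu> f \<and> vae_eq (Phi f) v) \<and>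
      (\<forall>f. L2 \<mu> f \<longrightarrow> model_op (theta_b \<gamma> \<mu>) (Delta \<gamma> \<mu>) (Phi f) (Phi (U_gamma \<gamma> \<mu> f))) \<and>
      vae_eq (Phi (\<lambda>_. 1)) (c_vec \<gamma> \<mu>) \<and>
      vae_eq (Phi (\<lambda>\<xi>. cnj \<xi>)) (c1_vec \<gamma> \<mu>))"

text \<open>fa is a version of the Radon-Nikodym derivative d(f mu)_a/d mu_a: there is a
  Lebesgue-null Borel set N carrying the singular part of mu (mu restricted to the
  complement of N is absolutely continuous w.r.t. Lebesgue measure), and fa = f
  mu-a.e. off N (equivalently, fa = f mu_a-a.e.).\<close>
definition ac_version :: "complex measure \<Rightarrow> (complex \<Rightarrow> complex) \<Rightarrow> (complex \<Rightarrow> complex) \<Rightarrow> bool" where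
  "ac_version \<mu> f fa \<longleftrightarrow> fa \<in> borel_measurable borel \<and>
     (\<exists>N \<in> sets borel. emeasure mTb N = 0 \<and>
        (\<forall>A \<in> sets borel. emeasure mTb A = 0 \<longrightarrow> emeasure \<mu> (A - N) = 0) \<and>
        (AE \<xi> in \<mu>. \<xi> \<notin> N \<longrightarrow> fa \<xi> = f \<xi>))"

end

theory Submission
  imports Defs "HOL-Complex_Analysis.Complex_Analysis"
begin

text \<open>
  Let \<open>s\<^sup>2 = 1 - \<bar>\<gamma>\<bar>\<^sup>2\<close>, \<open>W = 1 - \<gamma> - (1 - cnj \<gamma>) \<theta>\<close> and \<open>m(f) = \<integral> \<xi> f d\<mu>\<close>. Writing out the model operator turns
  the intertwining relation into the rank-one identity
  \<open>s \<Phi>(\<xi> f) = z s \<Phi> f + m(f) (W, - (1 - cnj \<gamma>) \<Delta>)\<close>, which determines both components.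

  For the first one apply the identity to \<open>f / (\<xi> - \<lambda>)\<close> and take Cauchy integrals at \<open>\<lambda>\<close> in the disc:
  \<open>s C[\<Phi>\<^sub>1 f](\<lambda>) = C[f \<mu>](\<lambda>) C[W](\<lambda>)\<close>. By Fatou's theorem for \<open>H\<^sup>2\<close>, and since \<open>W \<noteq> 0\<close> almost everywhere,
  radial limits exist and \<open>T\<^sub>+ f = s \<Phi>\<^sub>1 f / W\<close>; the case \<open>f = 1\<close> gives \<open>W T\<^sub>+ 1 = 1 + cnj \<gamma> \<theta>\<close>.

  For the second one, \<open>\<Psi> f = W \<Phi>\<^sub>2 f + (1 - cnj \<gamma>) \<Delta> \<Phi>\<^sub>1 f\<close> annihilates the rank-one term, so it commutes
  with multiplication by \<open>\<xi>\<close>, hence by \<open>cnj \<xi>\<close>, by trigonometric polynomials and, by isometry of \<open>\<Phi>\<close>, by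
  bounded Borel functions. Therefore \<open>\<Psi> f = f \<Psi> 1 = s f \<Delta>\<close> for every Borel representative \<open>f\<close>, in particular
  for one that equals \<open>f\<^sub>a\<close> off a Lebesgue null set.

  No boundary behaviour of \<open>\<theta>\<close> is needed beforehand: \<open>\<Phi> b\<^sub>1 = c\<^sub>1\<close> puts \<open>\<theta>\<close> into \<open>H\<^sup>2\<close> and, by comparing norms,
  forces \<open>\<bar>\<theta>\<bar> \<le> 1\<close>.
\<close>

subsection \<open>Monotone classes of functions\<close>

text \<open>The measure \<mu> may be singular to Lebesgue measure, so a multiplier known only
  \<mu>-almost everywhere says nothing on the boundary side. Commutation with multiplication is
  therefore carried by genuine Borel functions, and multipliers are approximated at every point of
  the circle: polynomials, then continuous functions by Stone-Weierstrass, then bounded Borel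
  functions by a monotone class argument. The same monotone class argument serves Fatou's theorem.
  For H2 data the Cauchy and Poisson integrals agree in the disc, and a.e. radial convergence of
  Poisson integrals is shown for all integrable functions by a maximal inequality. That W is nonzero
  almost everywhere is not visible from its formula. W can vanish only where 1 / C[\<mu>] has radial
  limit 0. Since C[\<mu>] has real part at least 1/2 in the disc and value 1 at the origin, the mean
  value property of 1 / (\<epsilon> + 1 / C[\<mu>]) makes the set of such points null.\<close>

lemma functional_monotone_class:
  fixes H :: "('a::metric_space \<Rightarrow> real) \<Rightarrow> bool"
  assumes cont: "\<And>g. continuous_on UNIV g \<Longrightarrow> bounded (range g) \<Longrightarrow> H g"
    and lin: "\<And>f g a b. H f \<Longrightarrow> H g \<Longrightarrow> H (\<lambda>x. a * f x + b * g x)"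
    and lim: "\<And>f g C. (\<And>n. H (f n)) \<Longrightarrow> (\<And>n x. \<bar>f n x\<bar> \<le> C) \<Longrightarrow> (\<And>x. (\<lambda>n. f n x) \<longlonglongrightarrow> g x)
      \<Longrightarrow> g \<in> borel_measurable borel \<Longrightarrow> H g"
    and g: "g \<in> borel_measurable borel" "bounded (range g)"
  shows "H g"
proof -
  have H0: "H (\<lambda>x. c)" for c
    by (rule cont) auto
  have Hopen: "H (indicator U)" if "open U" for U :: "'a set"
  \<comment> \<open>\<open>setdist\<close> to the empty set is 0, so the distance functions used
    below would miss the whole space.\<close>
  proof (cases "U = UNIV")
    case True
    then show ?thesis using H0[of 1] by (simp add: indicator_def[abs_def])
  next
    case False
    then have ne: "- U \<noteq> {}" by auto
    show ?thesis
    proof (rule lim)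
      fix n :: nat
      have "continuous_on UNIV (\<lambda>x. min 1 (real n * setdist {x} (- U)))"
        by (intro continuous_intros continuous_on_setdist)
      moreover have le: "\<bar>min 1 (real n * setdist {x} (- U))\<bar> \<le> 1" for n x
        using mult_nonneg_nonneg[OF of_nat_0_le_iff[of n] setdist_pos_le[of "{x}" "- U"]] by linarith
      ultimately show "H (\<lambda>x. min 1 (real n * setdist {x} (- U)))"
        by (intro cont) (auto intro!: boundedI[of _ 1])
      show "\<bar>min 1 (real n * setdist {x} (- U))\<bar> \<le> 1" for x
        by (rule le)
    next
      fix x
      show "(\<lambda>n. min 1 (real n * setdist {x} (- U))) \<longlonglongrightarrow> indicator U x"
      proof (cases "x \<in> U")
        case True
        have pos: "setdist {x} (- U) > 0"
          using True ne \<open>open U\<close> setdist_eq_0_sing_1[of x "- U"] setdist_pos_le[of "{x}" "- U"]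
          by (metis ComplD closed_Compl closure_closed order_le_less)
        have "\<forall>\<^sub>F n in sequentially. real n \<ge> 1 / setdist {x} (- U)"
          using filterlim_real_sequentially unfolding filterlim_at_top by blast
        then have "\<forall>\<^sub>F n in sequentially. min 1 (real n * setdist {x} (- U)) = 1"
          by eventually_elim (use pos in \<open>simp add: field_simps\<close>)
        then show ?thesis using True by (simp add: tendsto_eventually)
      next
        case False
        then have "setdist {x} (- U) = 0" by (simp add: setdist_eq_0I)
        then show ?thesis using False by simp
      qed
    qed (use \<open>open U\<close> in auto)
  qed
  have Hset: "H (indicator A)" if "A \<in> sets borel" for A :: "'a set"
  proof -
    have gen: "Int_stable {S :: 'a set. open S}" "{S :: 'a set. open S} \<subseteq> Pow UNIV"
      by (auto simp: Int_stable_def)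
    have A: "A \<in> sigma_sets UNIV {S. open S}"
      using that by (simp add: borel_def)
    show ?thesis
      using gen A
    \<comment> \<open>Dynkin's theorem: the generator is stable under intersection, so only disjoint
      unions occur, and their finite parts are sums of indicators, to which \<open>lin\<close>
      applies.\<close>
    proof (induction rule: sigma_sets_induct_disjoint)
      case (basic A) then show ?case by (simp add: Hopen)
    next
      case empty show ?case using H0[of 0] by (simp add: indicator_def[abs_def])
    next
      case (compl A)
      have "H (\<lambda>x. 1 * 1 + (-1) * indicator A x)"
        by (rule lin[OF H0 compl.IH])
      moreover have "(\<lambda>x. 1 * 1 + (-1) * indicator A x) = (indicator (UNIV - A) :: 'a \<Rightarrow> real)"
        by (auto simp: indicator_def)
      ultimately show ?case by simp
    next
      case (union F)
      have m: "F i \<in> sets borel" for i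
        using union.hyps by (auto simp: borel_def image_subset_iff)
      have fin: "H (\<lambda>x. \<Sum>i<n. indicator (F i) x)" for n
      proof (induction n)
        case 0 then show ?case using H0[of 0] by simp
      next
        case (Suc n)
        from lin[OF Suc.IH union.IH[of n], of 1 1] show ?case by simp
      qed
      have eq: "(\<Sum>i<n. indicator (F i) x) = (indicator (\<Union>i<n. F i) x :: real)" for n x
        by (rule indicator_UN_disjoint[symmetric])
           (use union.hyps in \<open>auto simp: disjoint_family_on_def\<close>)
      show ?case
      proof (rule lim[where C=1])
        show "H (indicator (\<Union>i<n. F i))" for n
          using fin[of n] unfolding eq by simp
        show "\<bar>indicator (\<Union>i<n. F i) x\<bar> \<le> (1::real)" for n x
          by (simp add: indicator_def)
        show "(\<lambda>n. indicator (\<Union>i<n. F i) x) \<longlonglongrightarrow> (indicator (\<Union> (range F)) x :: real)" for x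
          by (rule LIMSEQ_indicator_UN)
        show "indicator (\<Union> (range F)) \<in> borel_measurable borel"
          using m by auto
      qed
    qed
  qed
  \<comment> \<open>Boundedness is a premise of the induction, so each case must return it to the
    parts: by nonnegativity for sums, by monotonicity for limits.\<close>
  have Hpos: "H u" if "u \<in> borel_measurable borel" "\<And>x. 0 \<le> u x" "bounded (range u)" for u :: "'a \<Rightarrow> real"
    using that
  proof (induction u rule: borel_measurable_induct_real)
    case (set A) then show ?case by (simp add: Hset)
  next
    case (mult u c)
    show ?case
    proof (cases "c = 0")
      case True then show ?thesis using H0[of 0] by simp
    next
      case False
      obtain B where B: "\<And>x. \<bar>c * u x\<bar> \<le> B" using mult.prems by (auto simp: bounded_iff)
      have "bounded (range u)"
        using B False by (intro boundedI[of _ "B / \<bar>c\<bar>"]) (auto simp: field_simps abs_mult)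
      from lin[OF mult.IH[OF this] H0, of c 0 0] show ?thesis by simp
    qed
  next
    case (add u v)
    obtain B where B: "\<And>x. \<bar>v x + u x\<bar> \<le> B" using add.prems by (auto simp: bounded_iff)
    have "\<bar>u x\<bar> \<le> B" "\<bar>v x\<bar> \<le> B" for x
      using B[of x] add.hyps(2,4)[of x] by auto
    then have "bounded (range u)" "bounded (range v)"
      by (auto intro!: boundedI)
    from lin[OF add.IH(2)[OF this(2)] add.IH(1)[OF this(1)], of 1 1] show ?case by simp
  next
    case (seq U)
    have inc: "U i x \<le> u x" for i x
      by (rule incseq_le) (use seq.hyps in \<open>auto simp: incseq_def le_fun_def\<close>)
    obtain B where B: "\<And>x. \<bar>u x\<bar> \<le> B" using seq.prems by (auto simp: bounded_iff)
    have UB: "\<bar>U i x\<bar> \<le> B" for i x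
      using seq.hyps(2)[of i x] inc[of i x] B[of x] by linarith
    show ?case
    proof (rule lim)
      show "H (U n)" for n
        using UB by (intro seq.IH) (auto intro!: boundedI)
      show "(\<lambda>n. U n x) \<longlonglongrightarrow> u x" for x using seq.hyps by simp
    qed (use UB that in \<open>auto intro: borel_measurable_LIMSEQ_real seq.hyps\<close>)
  qed
  obtain B where B: "\<And>x. \<bar>g x\<bar> \<le> B" using g by (auto simp: bounded_iff)
  have "bounded (range (\<lambda>x. max 0 (g x)))"
  proof (rule boundedI[of _ B])
    show "norm y \<le> B" if yr: "y \<in> range (\<lambda>x. max 0 (g x))" for y
    proof -
      obtain x where "y = max 0 (g x)" using yr by auto
      then show ?thesis using B[of x] by (simp add: max_def split: if_splits)
    qed
  qed
  moreover have "bounded (range (\<lambda>x. max 0 (- g x)))"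
  proof (rule boundedI[of _ B])
    show "norm y \<le> B" if yr: "y \<in> range (\<lambda>x. max 0 (- g x))" for y
    proof -
      obtain x where "y = max 0 (- g x)" using yr by auto
      then show ?thesis using B[of x] by (simp add: max_def split: if_splits)
    qed
  qed
  ultimately have "H (\<lambda>x. max 0 (g x))" "H (\<lambda>x. max 0 (- g x))"
    using g by (auto intro!: Hpos)
  from lin[OF this, of 1 "-1"] show ?thesis
    by (rule back_subst[of H]) (auto simp: max_def)
qed

subsection \<open>Normalized Lebesgue measure on the circle\<close>

lemma sets_mTb [simp, measurable_cong]: "sets mTb = sets borel"
  by (simp add: mTb_def)

lemma space_mTb [simp]: "space mTb = UNIV"
  by (simp add: mTb_def)

lemma space_mT [simp]: "space mT = UNIV"
  by (simp add: mT_def)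

lemma cis_measurable [measurable]: "(\<lambda>t. cis (2 * pi * t)) \<in> borel_measurable borel"
  by (intro borel_measurable_continuous_onI continuous_intros)

lemma cis_measurable' [measurable]:
  "(\<lambda>t. cis (2 * pi * t)) \<in> borel_measurable (restrict_space lborel {0..1})"
  by (intro measurable_restrict_space1) simp

lemma prob_space_mTb: "prob_space mTb"
proof -
  have "prob_space (restrict_space lborel {0..1::real})"
    by (rule prob_spaceI) (simp add: space_restrict_space emeasure_restrict_space)
  then show ?thesis
    unfolding mTb_def by (rule prob_space.prob_space_distr) measurable
qed

interpretation mTb: prob_space mTb
  by (rule prob_space_mTb)

lemma integral_mTb:
  fixes f :: "complex \<Rightarrow> 'b::{banach, second_countable_topology}"
  assumes "f \<in> borel_measurable borel"
  shows "integral\<^sup>L mTb f = (LINT t:{0..1}|lborel. f (cis (2 * pi * t)))"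
  using assms unfolding mTb_def set_lebesgue_integral_def
  by (subst integral_distr) (auto simp: integral_restrict_space)

lemma AE_mTb_norm: "AE z in mTb. cmod z = 1"
  unfolding mTb_def by (subst AE_distr_iff) auto

text \<open>Cauchy's formula at the centre: the derivative of the parametrized circle is 2 pi i
  times the point, which cancels the denominator.\<close>

lemma mTb_mean_value:
  assumes hol: "F holomorphic_on cball 0 r" and r: "0 < r" and m: "F \<in> borel_measurable borel"
  shows "(\<integral>z. F (of_real r * z) \<partial>mTb) = F 0"
proof -
  have "((\<lambda>u. F u / (u - 0)) has_contour_integral (2 * of_real pi * \<i> * F 0)) (circlepath 0 r)"
    by (rule Cauchy_integral_circlepath_simple[OF hol]) (use r in auto)
  then have "((\<lambda>x. F (circlepath 0 r x) / (circlepath 0 r x - 0) *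
      vector_derivative (circlepath 0 r) (at x within {0..1})) has_integral 2 * of_real pi * \<i> * F 0) {0..1}"
    by (simp add: has_contour_integral_def)
  then have "((\<lambda>x. (2 * of_real pi * \<i>) * F (of_real r * cis (2 * pi * x)))
      has_integral (2 * of_real pi * \<i>) * F 0) {0..1}"
  proof (rule has_integral_eq[rotated])
    fix x :: real assume "x \<in> {0..1}"
    then show "F (circlepath 0 r x) / (circlepath 0 r x - 0) *
      vector_derivative (circlepath 0 r) (at x within {0..1})
      = (2 * of_real pi * \<i>) * F (of_real r * cis (2 * pi * x))"
      using r vector_derivative_circlepath01[of x 0 r] \<open>x \<in> {0..1}\<close>
      unfolding circlepath by (simp add: cis_conv_exp mult_ac)
  qed
  then have 1: "((\<lambda>x. F (of_real r * cis (2 * pi * x))) has_integral F 0) {0..1}"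
    by (subst (asm) has_integral_mult_right_iff) auto
  have "continuous_on {0..1} (\<lambda>x. F (of_real r * cis (2 * pi * x)))"
    by (intro continuous_on_compose2[OF holomorphic_on_imp_continuous_on[OF hol]] continuous_intros)
       (use r in \<open>auto simp: norm_mult\<close>)
  then have "set_integrable lborel {0..1} (\<lambda>x. F (of_real r * cis (2 * pi * x)))"
    by (rule borel_integrable_atLeastAtMost')
  from set_borel_integral_eq_integral(2)[OF this] integral_unique[OF 1]
  show ?thesis
    using m by (subst integral_mTb) (auto simp: set_lebesgue_integral_def)
qed

lemma integral_mTb_power: "0 < n \<Longrightarrow> (\<integral>z. z ^ n \<partial>mTb) = 0"
  using mTb_mean_value[of "\<lambda>z. z ^ n" 1] by (simp add: holomorphic_on_power)

text \<open>Concavity puts the sine above its chord on [0, pi/2]. This converts chordal distance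
  into arc length.\<close>

lemma Jordan_sin: assumes "0 \<le> u" "u \<le> 1 / 2" shows "2 * u \<le> sin (pi * u)"
proof -
  have cx: "convex_on {0..pi / 2} (\<lambda>x. - sin x)"
  proof (rule f''_ge0_imp_convex)
    show "((\<lambda>x. - sin x) has_real_derivative - cos x) (at x)" for x :: real
      by (auto intro!: derivative_eq_intros)
    show "((\<lambda>x. - cos x) has_real_derivative sin x) (at x)" for x :: real
      by (auto intro!: derivative_eq_intros)
    show "0 \<le> sin x" if "x \<in> {0..pi / 2}" for x :: real
      using that by (intro sin_ge_zero) auto
  qed auto
  have "- sin ((1 - 2 * u) *\<^sub>R 0 + (2 * u) *\<^sub>R (pi / 2)) \<le> (1 - 2 * u) * - sin 0 + (2 * u) * - sin (pi / 2)"
    by (rule convex_onD[OF cx]) (use assms in auto)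
  then show ?thesis by (simp add: mult_ac)
qed

lemma dist_cis: "cmod (cis a - cis b) = 2 * \<bar>sin ((a - b) / 2)\<bar>"
proof -
  have "(cmod (cis a - cis b))\<^sup>2 = (cos a - cos b)\<^sup>2 + (sin a - sin b)\<^sup>2"
    by (simp add: cmod_power2)
  also have "\<dots> = 2 - 2 * cos (a - b)"
    unfolding cos_diff power2_diff
    using sin_cos_squared_add[of a] sin_cos_squared_add[of b] by argo
  also have "\<dots> = (2 * \<bar>sin ((a - b) / 2)\<bar>)\<^sup>2"
  proof -
    define c where "c = (a - b) / 2"
    have "a - b = 2 * c" unfolding c_def by simp
    then show ?thesis unfolding c_def[symmetric] by (simp add: cos_double_sin power_mult_distrib)
  qed
  finally show ?thesis
    by (rule power2_eq_imp_eq) auto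
qed

text \<open>A chord of length at most h forces the parameters to be within h/4 modulo 1. The three
  intervals of length h/2 account for the wrap-around at both ends of [0,1]; their total 3h/2 is
  rounded up.\<close>

lemma emeasure_mTb_cball_le:
  assumes z: "cmod z = 1" and h: "0 \<le> h"
  shows "emeasure mTb (cball z h) \<le> ennreal (2 * h)"
proof -
  obtain y where y: "z = cis (2 * pi * y)" "0 \<le> y" "y \<le> 1"
  proof
    show "z = cis (2 * pi * (Arg2pi z / (2 * pi)))"
      using z Arg2pi_eq[of z] by (simp add: cis_conv_exp)
    show "Arg2pi z / (2 * pi) \<le> 1" "0 \<le> Arg2pi z / (2 * pi)"
      using Arg2pi_lt_2pi[of z] Arg2pi_ge_0[of z] by (auto simp: field_simps)
  qed
  let ?A = "{y - h / 4..y + h / 4}" and ?B = "{y + 1 - h / 4..y + 1 + h / 4}"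
    and ?C = "{y - 1 - h / 4..y - 1 + h / 4}"
  have sub: "(\<lambda>t. cis (2 * pi * t)) -` cball z h \<inter> {0..1} \<subseteq> ?A \<union> ?B \<union> ?C"
  proof safe
    fix x :: real assume x: "cis (2 * pi * x) \<in> cball z h" "x \<in> {0..1}" "x \<notin> ?C" "x \<notin> ?B"
    have "(2 * pi * x - 2 * pi * y) / 2 = pi * (x - y)"
      by (simp add: field_simps)
    then have le: "2 * \<bar>sin (pi * (x - y))\<bar> \<le> h"
      using x(1) dist_cis[of "2 * pi * x" "2 * pi * y"]
      by (simp add: y(1) dist_norm norm_minus_commute)
    have abs: "\<bar>sin (pi * (x - y))\<bar> = \<bar>sin (pi * \<bar>x - y\<bar>)\<bar>"
      by (cases "x \<ge> y") (auto simp: abs_if algebra_simps sin_diff)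
    show "x \<in> ?A"
    proof (cases "\<bar>x - y\<bar> \<le> 1 / 2")
      case True
      from Jordan_sin[of "\<bar>x - y\<bar>"] True le abs show ?thesis by (auto simp: abs_if split: if_splits)
    next
      case False
      have "sin (pi * (1 - \<bar>x - y\<bar>)) = sin (pi * \<bar>x - y\<bar>)"
        by (simp add: right_diff_distrib)
      moreover have "2 * (1 - \<bar>x - y\<bar>) \<le> sin (pi * (1 - \<bar>x - y\<bar>))"
        by (rule Jordan_sin) (use False x(2) y in auto)
      ultimately have "4 * (1 - \<bar>x - y\<bar>) \<le> h"
        using le abs by linarith
      then have "x \<in> ?B \<union> ?C" using x(2) y by (cases "x \<ge> y") auto
      then show ?thesis using x by auto
    qed
  qed
  have "emeasure mTb (cball z h) = emeasure lborel ((\<lambda>t. cis (2 * pi * t)) -` cball z h \<inter> {0..1})"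
    unfolding mTb_def
    by (subst emeasure_distr) (auto simp: space_restrict_space emeasure_restrict_space Int_commute)
  also have "\<dots> \<le> emeasure lborel (?A \<union> ?B \<union> ?C)"
    by (intro emeasure_mono sub) auto
  also have "\<dots> \<le> emeasure lborel (?A \<union> ?B) + emeasure lborel ?C"
    by (intro emeasure_subadditive) auto
  also have "\<dots> \<le> emeasure lborel ?A + emeasure lborel ?B + emeasure lborel ?C"
    by (intro add_right_mono emeasure_subadditive) auto
  also have "\<dots> = ennreal (h / 2) + ennreal (h / 2) + ennreal (h / 2)"
    using h by simp
  also have "\<dots> = ennreal (3 / 2 * h)"
    using h by (simp flip: ennreal_plus)
  also have "\<dots> \<le> ennreal (2 * h)"
    using h by (intro ennreal_leI) simp
  finally show ?thesis .
qed

text \<open>A geometric series integrated term by term. The factor \<open>q\<close> is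
  \<open>cnj\<close> when a Cauchy transform is expanded in powers of l, and the identity when an
  integral is killed because all its moments vanish.\<close>

lemma cauchy_sums:
  fixes f q :: "'a \<Rightarrow> complex"
  assumes f: "integrable \<nu> f" and q[measurable]: "q \<in> borel_measurable \<nu>"
    and q1: "AE \<xi> in \<nu>. cmod (q \<xi>) \<le> 1" and l: "cmod l < 1"
  shows "(\<lambda>n. (\<integral>\<xi>. f \<xi> * q \<xi> ^ n \<partial>\<nu>) * l ^ n) sums (\<integral>\<xi>. f \<xi> / (1 - q \<xi> * l) \<partial>\<nu>)"
proof -
  note [measurable] = borel_measurable_integrable[OF f]
  have qn: "AE \<xi> in \<nu>. \<forall>n. cmod (q \<xi> ^ n) \<le> 1"
    using q1 by eventually_elim (auto simp: norm_power power_le_one)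
  have i1: "integrable \<nu> (\<lambda>\<xi>. f \<xi> * q \<xi> ^ n)" for n
    by (rule Bochner_Integration.integrable_bound[OF f])
       (use qn in \<open>auto simp: norm_mult elim!: eventually_mono intro!: mult_right_le_one_le\<close>)
  have "(\<lambda>n. \<integral>\<xi>. f \<xi> * q \<xi> ^ n * l ^ n \<partial>\<nu>) sums (\<integral>\<xi>. (\<Sum>n. f \<xi> * q \<xi> ^ n * l ^ n) \<partial>\<nu>)"
  proof (rule sums_integral)
    show "integrable \<nu> (\<lambda>\<xi>. f \<xi> * q \<xi> ^ n * l ^ n)" for n
      using i1 by simp
    show "AE \<xi> in \<nu>. summable (\<lambda>n. norm (f \<xi> * q \<xi> ^ n * l ^ n))"
      using qn
    proof eventually_elim
      case (elim \<xi>)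
      have "summable (\<lambda>n. cmod (f \<xi>) * cmod l ^ n)"
        using l by (intro summable_mult summable_geometric) simp
      then show ?case
        by (rule summable_comparison_test'[where N=0])
           (use elim in \<open>auto simp: norm_mult norm_power[of l] intro!: mult_right_mono mult_right_le_one_le\<close>)
    qed
    have "summable (\<lambda>n. (\<integral>\<xi>. cmod (f \<xi>) \<partial>\<nu>) * cmod l ^ n)"
      using l by (intro summable_mult summable_geometric) simp
    then show "summable (\<lambda>n. \<integral>\<xi>. norm (f \<xi> * q \<xi> ^ n * l ^ n) \<partial>\<nu>)"
    proof (rule summable_comparison_test'[where N=0])
      fix n
      have "(\<integral>\<xi>. cmod (f \<xi> * q \<xi> ^ n) \<partial>\<nu>) \<le> (\<integral>\<xi>. cmod (f \<xi>) \<partial>\<nu>)"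
        by (intro integral_mono_AE integrable_norm i1 f)
           (use qn in \<open>auto simp: norm_mult elim!: eventually_mono intro!: mult_right_le_one_le\<close>)
      then show "norm (\<integral>\<xi>. norm (f \<xi> * q \<xi> ^ n * l ^ n) \<partial>\<nu>) \<le> (\<integral>\<xi>. cmod (f \<xi>) \<partial>\<nu>) * cmod l ^ n"
        by (simp add: norm_mult[of _ "l ^ n"] norm_power[of l] mult_right_mono abs_mult)
    qed
  qed
  moreover have "(\<integral>\<xi>. (\<Sum>n. f \<xi> * q \<xi> ^ n * l ^ n) \<partial>\<nu>) = (\<integral>\<xi>. f \<xi> / (1 - q \<xi> * l) \<partial>\<nu>)"
  proof (rule integral_cong_AE)
    show "AE \<xi> in \<nu>. (\<Sum>n. f \<xi> * q \<xi> ^ n * l ^ n) = f \<xi> / (1 - q \<xi> * l)"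
      using q1
    proof eventually_elim
      case (elim \<xi>)
      have "cmod (q \<xi> * l) < 1"
        using elim l mult_left_le_one_le[of "cmod l" "cmod (q \<xi>)"] by (simp add: norm_mult)
      from sums_mult[OF geometric_sums[OF this], of "f \<xi>"]
      show ?case by (simp add: sums_unique[symmetric] power_mult_distrib mult_ac)
    qed
  qed measurable
  ultimately show ?thesis by simp
qed

subsection \<open>Radial limits of Poisson integrals\<close>

text \<open>On the circle this is the classical (1 - r^2) / |\<zeta> - r z|^2, written with the
  Cauchy denominator so that it splits into Cauchy kernels.\<close>

definition poisson_kernel :: "real \<Rightarrow> complex \<Rightarrow> complex \<Rightarrow> real" where
  "poisson_kernel r \<zeta> z = (1 - r\<^sup>2) / (cmod (1 - of_real r * cnj \<zeta> * z))\<^sup>2"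

definition poisson :: "real \<Rightarrow> (complex \<Rightarrow> real) \<Rightarrow> complex \<Rightarrow> real" where
  "poisson r f z = (\<integral>\<zeta>. f \<zeta> * poisson_kernel r \<zeta> z \<partial>mTb)"

lemma cnj_measurable [measurable]: "cnj \<in> borel_measurable borel"
  by (intro borel_measurable_continuous_onI continuous_intros)

section \<open>Kernel estimates and the maximal inequality\<close>

lemma emeasure_UN_countable_le:
  assumes I: "countable I" and X: "\<And>i. i \<in> I \<Longrightarrow> X i \<in> sets M"
  shows "emeasure M (\<Union>i\<in>I. X i) \<le> (\<integral>\<^sup>+i. emeasure M (X i) \<partial>count_space I)"
proof -
  have "emeasure M (\<Union>i\<in>I. X i) = (\<integral>\<^sup>+x. indicator (\<Union>i\<in>I. X i) x \<partial>M)"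
    using I X by (intro nn_integral_indicator[symmetric] sets.countable_UN') auto
  also have "\<dots> \<le> (\<integral>\<^sup>+x. (\<integral>\<^sup>+i. indicator (X i) x \<partial>count_space I) \<partial>M)"
  proof (rule nn_integral_mono)
    fix x
    show "indicator (\<Union>i\<in>I. X i) x \<le> (\<integral>\<^sup>+i. indicator (X i) x \<partial>count_space I)"
    proof (cases "x \<in> (\<Union>i\<in>I. X i)")
      case True
      then obtain i where "i \<in> I" "x \<in> X i" by blast
      then show ?thesis
        using nn_integral_ge_point[of i I "\<lambda>i. indicator (X i) x"] True by simp
    qed simp
  qed
  also have "\<dots> = (\<integral>\<^sup>+i. (\<integral>\<^sup>+x. indicator (X i) x \<partial>M) \<partial>count_space I)"
    using I X by (intro nn_integral_count_space_nn_integral) auto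
  also have "\<dots> = (\<integral>\<^sup>+i. emeasure M (X i) \<partial>count_space I)"
    using X by (intro nn_integral_cong) simp
  finally show ?thesis .
qed

lemma cball_borel [measurable]: "cball z h \<in> sets borel"
  by simp

lemma poisson_kernel_measurable [measurable]: "(\<lambda>\<zeta>. poisson_kernel r \<zeta> z) \<in> borel_measurable borel"
  unfolding poisson_kernel_def by measurable

lemma unit_cnj: "cmod z = 1 \<Longrightarrow> z * cnj z = 1" "cmod z = 1 \<Longrightarrow> cnj z * z = 1"
  using complex_norm_square[of z] by (auto simp: mult.commute)

lemma norm_one_minus_cnj:
  assumes "cmod \<zeta> = 1" shows "cmod (1 - of_real r * cnj \<zeta> * z) = cmod (\<zeta> - of_real r * z)"
proof -
  have "\<zeta> - of_real r * z = \<zeta> * (1 - of_real r * cnj \<zeta> * z)"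
    using unit_cnj(1)[OF assms] by (simp add: algebra_simps)
  then show ?thesis using assms by (simp add: norm_mult)
qed

text \<open>Everything comes from d = |\<zeta> - r z|: it is at least 1 - r, and since z and r z
  differ by 1 - r, also |z - \<zeta>| \<le> 2 d. The second conclusion serves near z, the third away
  from it.\<close>

lemma poisson_kernel_le:
  assumes z: "cmod z = 1" "cmod \<zeta> = 1" and r: "0 < r" "r < 1"
  shows "0 \<le> poisson_kernel r \<zeta> z" "poisson_kernel r \<zeta> z \<le> 2 / (1 - r)"
    "poisson_kernel r \<zeta> z * (dist z \<zeta>)\<^sup>2 \<le> 8 * (1 - r)"
proof -
  let ?d = "cmod (\<zeta> - of_real r * z)"
  have K: "poisson_kernel r \<zeta> z = (1 - r) * (1 + r) / ?d\<^sup>2"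
    unfolding poisson_kernel_def norm_one_minus_cnj[OF z(2)] by (simp add: power2_eq_square algebra_simps)
  have d1: "1 - r \<le> ?d"
    using norm_triangle_ineq2[of \<zeta> "of_real r * z"] z r by (simp add: norm_mult)
  have d2: "dist z \<zeta> \<le> 2 * ?d"
  proof -
    have "dist z \<zeta> = cmod ((\<zeta> - of_real r * z) - of_real (1 - r) * z)"
      by (simp add: dist_norm norm_minus_commute algebra_simps)
    also have "\<dots> \<le> ?d + cmod (of_real (1 - r) * z)"
      by (rule norm_triangle_ineq4)
    also have "cmod (of_real (1 - r) * z) = 1 - r"
      unfolding norm_mult norm_of_real using z r by simp
    finally show ?thesis using d1 by simp
  qed
  have pos: "0 < ?d" using d1 r by linarith
  show "0 \<le> poisson_kernel r \<zeta> z" unfolding K using r by simp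
  have "(1 - r) * (1 + r) * (1 - r) \<le> 2 * ?d\<^sup>2"
  proof -
    have "(1 - r)\<^sup>2 \<le> ?d\<^sup>2" using d1 r by (intro power_mono) auto
    then have "(1 + r) * (1 - r)\<^sup>2 \<le> 2 * ?d\<^sup>2" using r by (intro mult_mono) auto
    then show ?thesis by (simp add: power2_eq_square mult_ac)
  qed
  then show "poisson_kernel r \<zeta> z \<le> 2 / (1 - r)"
    unfolding K using pos r by (simp add: divide_simps mult_ac)
  have "(dist z \<zeta>)\<^sup>2 \<le> (2 * ?d)\<^sup>2" by (intro power_mono d2) auto
  then have "(1 + r) * (dist z \<zeta>)\<^sup>2 \<le> 2 * (4 * ?d\<^sup>2)"
    using r by (intro mult_mono) (auto simp: power_mult_distrib)
  then have "(1 - r) * ((1 + r) * (dist z \<zeta>)\<^sup>2) \<le> (1 - r) * (8 * ?d\<^sup>2)"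
    using r by (intro mult_left_mono) auto
  then have "(1 - r) * (1 + r) * (dist z \<zeta>)\<^sup>2 \<le> 8 * (1 - r) * ?d\<^sup>2"
    by (simp only: mult.assoc mult.left_commute)
  then show "poisson_kernel r \<zeta> z * (dist z \<zeta>)\<^sup>2 \<le> 8 * (1 - r)"
    unfolding K times_divide_eq_left using pos by (subst pos_divide_le_eq) auto
qed

text \<open>Balls of radius 2^k (1 - r). If the least k whose ball contains \<zeta> is positive, the
  distance exceeds half that radius, and the far bound with constant 8 gives 8 times 4 over 4^k (1 -
  r); hence 32.\<close>

lemma poisson_kernel_le_suminf:
  assumes z: "cmod z = 1" "cmod \<zeta> = 1" and r: "0 < r" "r < 1"
  shows "ennreal (poisson_kernel r \<zeta> z)
    \<le> (\<Sum>k. ennreal (32 / (4 ^ k * (1 - r))) * indicator (cball z (2 ^ k * (1 - r))) \<zeta>)"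
proof -
  obtain k where k: "dist z \<zeta> \<le> 2 ^ k * (1 - r)" "poisson_kernel r \<zeta> z \<le> 32 / (4 ^ k * (1 - r))"
  proof (cases "dist z \<zeta> \<le> 1 - r")
    case True
    have "poisson_kernel r \<zeta> z \<le> 32 / (1 - r)"
      using poisson_kernel_le(2)[OF z r] r by (simp add: divide_simps)
    with True show ?thesis using that[of 0] by simp
  next
    case False
    have "\<exists>k. dist z \<zeta> \<le> 2 ^ k * (1 - r)"
    proof -
      obtain k where "dist z \<zeta> / (1 - r) < 2 ^ k" using real_arch_pow[of 2] by auto
      then show ?thesis using r by (intro exI[of _ k]) (simp add: divide_simps)
    qed
    define k where "k = (LEAST k. dist z \<zeta> \<le> 2 ^ k * (1 - r))"
    have 1: "dist z \<zeta> \<le> 2 ^ k * (1 - r)"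
      unfolding k_def by (rule LeastI_ex) fact
    have "k \<noteq> 0" using 1 False by (intro notI) simp
    then obtain j where j: "k = Suc j" by (cases k) auto
    have "\<not> dist z \<zeta> \<le> 2 ^ j * (1 - r)"
      using not_less_Least[of j "\<lambda>k. dist z \<zeta> \<le> 2 ^ k * (1 - r)"] j unfolding k_def by simp
    then have "(2 ^ j * (1 - r))\<^sup>2 \<le> (dist z \<zeta>)\<^sup>2"
      using r by (intro power_mono) auto
    then have "poisson_kernel r \<zeta> z * (2 ^ j * (1 - r))\<^sup>2 \<le> poisson_kernel r \<zeta> z * (dist z \<zeta>)\<^sup>2"
      by (intro mult_left_mono poisson_kernel_le(1)[OF z r])
    also have "\<dots> \<le> 8 * (1 - r)"
      by (rule poisson_kernel_le(3)[OF z r])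
    finally have "(poisson_kernel r \<zeta> z * 4 ^ j * (1 - r)) * (1 - r) \<le> 8 * (1 - r)"
      by (simp add: power2_eq_square mult_ac flip: power_mult_distrib)
    then have "poisson_kernel r \<zeta> z * 4 ^ j * (1 - r) \<le> 8"
      using r by (subst (asm) mult_le_cancel_right) auto
    then have "poisson_kernel r \<zeta> z \<le> 32 / (4 ^ k * (1 - r))"
      using r unfolding j by (simp add: divide_simps mult_ac)
    with 1 show ?thesis by (rule that)
  qed
  let ?f = "\<lambda>k. ennreal (32 / (4 ^ k * (1 - r))) * indicator (cball z (2 ^ k * (1 - r))) \<zeta>"
  have "ennreal (poisson_kernel r \<zeta> z) \<le> ?f k"
    using k by (auto intro!: ennreal_leI)
  also have "\<dots> = sum ?f {k}" by (subst sum.insert) simp_all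
  also have "\<dots> \<le> suminf ?f" by (rule sum_le_suminf) auto
  finally show ?thesis .
qed

text \<open>The ball of radius 2^k (1 - r) has mass at most 2^k (1 - r) t, so the k-th term is at
  most 32 t / 2^k and the sum is 64 t. The maximal function thus controls Poisson integrals
  uniformly in r.\<close>

lemma nn_integral_poisson_kernel_le:
  assumes [measurable]: "v \<in> borel_measurable borel" and z: "cmod z = 1" and r: "0 < r" "r < 1" and t: "0 \<le> t"
    and max: "\<And>h. 0 < h \<Longrightarrow> (\<integral>\<^sup>+\<zeta>. ennreal \<bar>v \<zeta>\<bar> * indicator (cball z h) \<zeta> \<partial>mTb) \<le> ennreal (h * t)"
  shows "(\<integral>\<^sup>+\<zeta>. ennreal (norm (v \<zeta> * poisson_kernel r \<zeta> z)) \<partial>mTb) \<le> ennreal (64 * t)"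
proof -
  let ?c = "\<lambda>k. 32 / (4 ^ k * (1 - r))" and ?h = "\<lambda>k. 2 ^ k * (1 - r)"
  have "(\<integral>\<^sup>+\<zeta>. ennreal (norm (v \<zeta> * poisson_kernel r \<zeta> z)) \<partial>mTb)
      \<le> (\<integral>\<^sup>+\<zeta>. (\<Sum>k. ennreal (?c k) * (ennreal \<bar>v \<zeta>\<bar> * indicator (cball z (?h k)) \<zeta>)) \<partial>mTb)"
  proof (rule nn_integral_mono_AE, use AE_mTb_norm in eventually_elim)
    case (elim \<zeta>)
    have "ennreal (norm (v \<zeta> * poisson_kernel r \<zeta> z)) = ennreal \<bar>v \<zeta>\<bar> * ennreal (poisson_kernel r \<zeta> z)"
      using poisson_kernel_le(1)[OF z elim r] by (simp add: abs_mult ennreal_mult)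
    also have "\<dots> \<le> ennreal \<bar>v \<zeta>\<bar> * (\<Sum>k. ennreal (?c k) * indicator (cball z (?h k)) \<zeta>)"
      by (intro mult_left_mono poisson_kernel_le_suminf z elim r) auto
    also have "\<dots> = (\<Sum>k. ennreal (?c k) * (ennreal \<bar>v \<zeta>\<bar> * indicator (cball z (?h k)) \<zeta>))"
      by (subst ennreal_suminf_cmult[symmetric]) (simp add: mult_ac)
    finally show ?case .
  qed
  also have "\<dots> = (\<Sum>k. ennreal (?c k) * (\<integral>\<^sup>+\<zeta>. ennreal \<bar>v \<zeta>\<bar> * indicator (cball z (?h k)) \<zeta> \<partial>mTb))"
  proof -
    have [measurable]: "(\<lambda>\<zeta>. ennreal \<bar>v \<zeta>\<bar> * indicator (cball z (?h k)) \<zeta>) \<in> borel_measurable mTb" for k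
      by measurable
    show ?thesis by (subst nn_integral_suminf) (simp_all add: nn_integral_cmult)
  qed
  also have "\<dots> \<le> (\<Sum>k. ennreal (?c k) * ennreal (?h k * t))"
    using r by (intro suminf_le mult_left_mono max) auto
  also have "\<dots> = (\<Sum>k. ennreal (32 * t * (1 / 2) ^ k))"
  proof (rule arg_cong[of _ _ suminf], rule ext)
    fix k
    have "?c k * (?h k * t) = 32 * t * (1 / 2) ^ k"
    proof -
      have "(4::real) ^ k = 2 ^ k * 2 ^ k" by (simp flip: power_mult_distrib)
      then show ?thesis using r by (simp add: divide_simps power_one_over)
    qed
    then show "ennreal (?c k) * ennreal (?h k * t) = ennreal (32 * t * (1 / 2) ^ k)"
      using r t by (simp flip: ennreal_mult)
  qed
  also have "\<dots> = ennreal (64 * t)"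
    using sums_mult[OF geometric_sums[of "1 / 2 :: real"], of "32 * t"] t
    by (intro suminf_ennreal_eq) auto
  finally show ?thesis .
qed

text \<open>Hardy-Littlewood by Vitali: each bad point gets a ball whose mass exceeds its radius
  times t, and a countable disjoint subfamily is kept whose fivefold enlargements still cover. With
  the measure bound 2h this gives the constant 10. \<open>B\<close> is the union of the enlarged
  balls rather than the set \<open>S\<close> of bad points, hence Borel.\<close>

lemma maximal_weak_type:
  assumes v: "integrable mTb v" and t: "0 < t"
  obtains B where "B \<in> sets borel" "emeasure mTb B \<le> ennreal (10 / t * (\<integral>\<zeta>. \<bar>v \<zeta>\<bar> \<partial>mTb))"
    "\<And>z h. cmod z = 1 \<Longrightarrow> z \<notin> B \<Longrightarrow> 0 < h \<Longrightarrow>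
      (\<integral>\<^sup>+\<zeta>. ennreal \<bar>v \<zeta>\<bar> * indicator (cball z h) \<zeta> \<partial>mTb) \<le> ennreal (h * t)"
proof -
  let ?I = "\<integral>\<zeta>. \<bar>v \<zeta>\<bar> \<partial>mTb"
  let ?m = "\<lambda>A. \<integral>\<^sup>+\<zeta>. ennreal \<bar>v \<zeta>\<bar> * indicator A \<zeta> \<partial>mTb"
  have vm[measurable]: "v \<in> borel_measurable borel"
    using borel_measurable_integrable[OF v] by (simp cong: measurable_cong_sets)
  have I: "(\<integral>\<^sup>+\<zeta>. ennreal \<bar>v \<zeta>\<bar> \<partial>mTb) = ennreal ?I"
    using v by (intro nn_integral_eq_integral) auto
  have mI: "?m A \<le> ennreal ?I" for A
    unfolding I[symmetric] by (intro nn_integral_mono) (auto simp: indicator_def)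
  define S where "S = {z. cmod z = 1 \<and> (\<exists>h>0. ennreal (h * t) < ?m (cball z h))}"
  define \<rho> where "\<rho> z = (SOME h. 0 < h \<and> ennreal (h * t) < ?m (cball z h))" for z
  have \<rho>: "0 < \<rho> z" "ennreal (\<rho> z * t) < ?m (cball z (\<rho> z))" if "z \<in> S" for z
    using someI_ex[of "\<lambda>h. 0 < h \<and> ennreal (h * t) < ?m (cball z h)"] that
    unfolding S_def \<rho>_def by auto
  \<comment> \<open>The covering lemma asks for bounded radii; the total mass of v supplies the
    bound.\<close>
  have bd: "0 < \<rho> z \<and> \<rho> z \<le> ?I / t" if "z \<in> S" for z
  proof -
    have "ennreal (\<rho> z * t) < ennreal ?I" using \<rho>(2)[OF that] mI by (rule order_less_le_trans)
    then have "\<rho> z * t < ?I" using \<rho>(1)[OF that] t by (subst (asm) ennreal_less_iff) auto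
    then show ?thesis using \<rho>(1)[OF that] t by (simp add: field_simps)
  qed
  have "S \<subseteq> (\<Union>i\<in>S. cball i (\<rho> i))" using \<rho>(1) by (auto intro!: bexI simp: less_imp_le)
  then obtain C where C: "countable C" "C \<subseteq> S"
      "pairwise (\<lambda>i j. disjnt (cball i (\<rho> i)) (cball j (\<rho> j))) C"
      "S \<subseteq> (\<Union>i\<in>C. cball i (5 * \<rho> i))"
    by (rule Vitali_covering_lemma_cballs[where S=S and K=S and a="\<lambda>i. i" and r=\<rho> and B="?I / t", OF _ bd])
  define B where "B = (\<Union>i\<in>C. cball i (5 * \<rho> i))"
  have B[measurable]: "B \<in> sets borel"
    unfolding B_def using C(1) by (intro sets.countable_UN') auto
  have "emeasure mTb B \<le> (\<integral>\<^sup>+i. emeasure mTb (cball i (5 * \<rho> i)) \<partial>count_space C)"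
    unfolding B_def using C(1) by (intro emeasure_UN_countable_le) auto
  also have "\<dots> \<le> (\<integral>\<^sup>+i. ennreal (10 / t) * ?m (cball i (\<rho> i)) \<partial>count_space C)"
  proof (rule nn_integral_mono)
    fix i assume "i \<in> space (count_space C)"
    then have i: "i \<in> S" using C by auto
    then have "emeasure mTb (cball i (5 * \<rho> i)) \<le> ennreal (2 * (5 * \<rho> i))"
      using \<rho>(1)[OF i] by (intro emeasure_mTb_cball_le) (auto simp: S_def)
    also have "\<dots> = ennreal (10 / t) * ennreal (\<rho> i * t)"
      using t \<rho>(1)[OF i] by (simp flip: ennreal_mult)
    also have "\<dots> \<le> ennreal (10 / t) * ?m (cball i (\<rho> i))"
      using \<rho>(2)[OF i] by (intro mult_left_mono) auto
    finally show "emeasure mTb (cball i (5 * \<rho> i)) \<le> \<dots>" .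
  qed
  also have "\<dots> = ennreal (10 / t) * (\<integral>\<^sup>+i. emeasure (density mTb (\<lambda>\<zeta>. ennreal \<bar>v \<zeta>\<bar>)) (cball i (\<rho> i)) \<partial>count_space C)"
    by (subst nn_integral_cmult) (auto simp: emeasure_density)
  also have "(\<integral>\<^sup>+i. emeasure (density mTb (\<lambda>\<zeta>. ennreal \<bar>v \<zeta>\<bar>)) (cball i (\<rho> i)) \<partial>count_space C)
      = emeasure (density mTb (\<lambda>\<zeta>. ennreal \<bar>v \<zeta>\<bar>)) (\<Union>i\<in>C. cball i (\<rho> i))"
    using C(1,3) by (intro emeasure_UN_countable[symmetric])
      (auto simp: disjoint_family_on_def pairwise_def disjnt_def)
  also have "\<dots> = ?m (\<Union>i\<in>C. cball i (\<rho> i))"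
    using C(1) by (subst emeasure_density) (auto intro!: sets.countable_UN')
  also have "ennreal (10 / t) * \<dots> \<le> ennreal (10 / t) * ennreal ?I"
    by (intro mult_left_mono mI) auto
  also have "\<dots> = ennreal (10 / t * ?I)"
    using t by (simp flip: ennreal_mult)
  finally have "emeasure mTb B \<le> ennreal (10 / t * ?I)" .
  moreover have "?m (cball z h) \<le> ennreal (h * t)" if "cmod z = 1" "z \<notin> B" "0 < h" for z h
  proof -
    have "z \<notin> S" using that(2) C(4) unfolding B_def by (rule contra_subsetD[rotated])
    then have "\<not> ennreal (h * t) < ?m (cball z h)" using that(1,3) unfolding S_def by blast
    then show ?thesis by (simp only: not_less)
  qed
  ultimately show ?thesis using B by (intro that) auto
qed

text \<open>A point outside the intersection of the \<open>B n\<close> lies outside one of them,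
  where \<open>P\<close> holds almost everywhere; and the intersection is null.\<close>

lemma AE_from_small_exceptional_sets:
  assumes B: "\<And>n::nat. B n \<in> sets M" and le: "\<And>n. emeasure M (B n) \<le> ennreal (b n)" and lim: "b \<longlonglongrightarrow> 0"
    and P: "\<And>n. AE z in M. z \<notin> B n \<longrightarrow> P z"
  shows "AE z in M. P z"
proof -
  have I: "(\<Inter>n. B n) \<in> sets M" using B by (intro sets.countable_INT') auto
  have "emeasure M (\<Inter>n. B n) \<le> 0"
  proof (rule LIMSEQ_le_const)
    show "(\<lambda>n. ennreal (b n)) \<longlonglongrightarrow> 0" using tendsto_ennrealI[OF lim] by simp
    show "\<exists>N. \<forall>n\<ge>N. emeasure M (\<Inter>n. B n) \<le> ennreal (b n)"
      using B by (intro exI allI impI order_trans[OF emeasure_mono le]) auto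
  qed
  then have "(\<Inter>n. B n) \<in> null_sets M" using I by auto
  then have "AE z in M. z \<notin> (\<Inter>n. B n)" by (rule AE_not_in)
  moreover have "AE z in M. \<forall>n. z \<notin> B n \<longrightarrow> P z" using P by (subst AE_all_countable) auto
  ultimately show ?thesis by eventually_elim auto
qed

section \<open>Almost everywhere convergence of Poisson integrals\<close>

lemma at_left_1_bounds: "\<forall>\<^sub>F r in at_left (1::real). 0 < r \<and> r < 1"
  using eventually_at_left_real[of 0 1] by (auto elim: eventually_mono)

lemma integrable_mTb_measurable: "integrable mTb f \<Longrightarrow> f \<in> borel_measurable borel"
  using borel_measurable_integrable[of mTb f] by (simp cong: measurable_cong_sets)

lemma integrable_times_poisson_kernel:
  fixes f :: "complex \<Rightarrow> real"
  assumes f: "integrable mTb f" and z: "cmod z = 1" and r: "0 < r" "r < 1"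
  shows "integrable mTb (\<lambda>\<zeta>. f \<zeta> * poisson_kernel r \<zeta> z)"
proof (rule Bochner_Integration.integrable_bound)
  note [measurable] = integrable_mTb_measurable[OF f]
  show "integrable mTb (\<lambda>\<zeta>. 2 / (1 - r) * f \<zeta>)" using f by simp
  show "(\<lambda>\<zeta>. f \<zeta> * poisson_kernel r \<zeta> z) \<in> borel_measurable mTb" by measurable
  show "AE \<zeta> in mTb. norm (f \<zeta> * poisson_kernel r \<zeta> z) \<le> norm (2 / (1 - r) * f \<zeta>)"
    using AE_mTb_norm
  proof eventually_elim
    case (elim \<zeta>)
    have "\<bar>f \<zeta>\<bar> * poisson_kernel r \<zeta> z \<le> \<bar>f \<zeta>\<bar> * (2 / (1 - r))"
      by (intro mult_left_mono poisson_kernel_le z elim r) auto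
    then show ?case using poisson_kernel_le(1)[OF z elim r] r by (simp add: abs_mult mult_ac)
  qed
qed

lemma poisson_diff:
  assumes "integrable mTb f" "integrable mTb g" "cmod z = 1" "0 < r" "r < 1"
  shows "poisson r (\<lambda>\<zeta>. f \<zeta> - g \<zeta>) z = poisson r f z - poisson r g z"
  unfolding poisson_def left_diff_distrib
  by (intro Bochner_Integration.integral_diff integrable_times_poisson_kernel assms)

lemma poisson_lin:
  assumes "integrable mTb f" "integrable mTb g" "cmod z = 1" "0 < r" "r < 1"
  shows "poisson r (\<lambda>\<zeta>. a * f \<zeta> + b * g \<zeta>) z = a * poisson r f z + b * poisson r g z"
proof -
  have "poisson r (\<lambda>\<zeta>. a * f \<zeta> + b * g \<zeta>) z
      = (\<integral>\<zeta>. a * (f \<zeta> * poisson_kernel r \<zeta> z) + b * (g \<zeta> * poisson_kernel r \<zeta> z) \<partial>mTb)"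
    unfolding poisson_def by (simp add: algebra_simps)
  also have "\<dots> = a * poisson r f z + b * poisson r g z"
    unfolding poisson_def
    by (subst Bochner_Integration.integral_add)
       (auto intro!: integrable_mult_right integrable_times_poisson_kernel assms)
  finally show ?thesis .
qed

lemma poisson_abs_le:
  assumes v: "integrable mTb v" and z: "cmod z = 1" and r: "0 < r" "r < 1" and t: "0 \<le> t"
    and max: "\<And>h. 0 < h \<Longrightarrow> (\<integral>\<^sup>+\<zeta>. ennreal \<bar>v \<zeta>\<bar> * indicator (cball z h) \<zeta> \<partial>mTb) \<le> ennreal (h * t)"
  shows "\<bar>poisson r v z\<bar> \<le> 64 * t"
proof -
  have "ennreal (norm (poisson r v z)) \<le> (\<integral>\<^sup>+\<zeta>. ennreal (norm (v \<zeta> * poisson_kernel r \<zeta> z)) \<partial>mTb)"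
    unfolding poisson_def
    by (intro integral_norm_bound_ennreal integrable_times_poisson_kernel v z r)
  also have "\<dots> \<le> ennreal (64 * t)"
    by (intro nn_integral_poisson_kernel_le integrable_mTb_measurable v z r t max)
  finally show ?thesis using t by simp
qed

definition poisson_converges :: "(complex \<Rightarrow> real) \<Rightarrow> bool" where
  "poisson_converges f \<longleftrightarrow> (AE z in mTb. ((\<lambda>r. poisson r f z) \<longlongrightarrow> f z) (at_left 1))"

text \<open>The maximal inequality makes the set of boundary functions with a.e. convergent Poisson
  integrals closed under \<open>L\<^sup>1\<close> limits.\<close>

lemma poisson_converges_L1_limit:
  assumes f: "\<And>n::nat. integrable mTb (f n)" "\<And>n. poisson_converges (f n)" and g: "integrable mTb g"
    and lim: "(\<lambda>n. \<integral>\<zeta>. \<bar>g \<zeta> - f n \<zeta>\<bar> \<partial>mTb) \<longlonglongrightarrow> 0"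
  shows "poisson_converges g"
proof -
  note [measurable] = integrable_mTb_measurable[OF f(1)] integrable_mTb_measurable[OF g]
  let ?I = "\<lambda>n. \<integral>\<zeta>. \<bar>g \<zeta> - f n \<zeta>\<bar> \<partial>mTb"
  \<comment> \<open>Three errors of size \<open>e\<close>: the Poisson integral of
    \<open>g - f n\<close>, the convergence for \<open>f n\<close>, and the pointwise gap between
    \<open>f n\<close> and \<open>g\<close>.\<close>
  have key: "AE z in mTb. \<forall>\<^sub>F r in at_left 1. \<bar>poisson r g z - g z\<bar> \<le> 3 * e" if e: "0 < e" for e
  proof -
    \<comment> \<open>Chosen so that the bound 64 t on Poisson integrals becomes
      \<open>e\<close>.\<close>
    define t where "t = e / 64"
    have t: "0 < t" using e by (simp add: t_def)
    define Q where "Q n B \<longleftrightarrow> B \<in> sets borel \<and> emeasure mTb B \<le> ennreal (10 / t * ?I n) \<and>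
      (\<forall>z h. cmod z = 1 \<longrightarrow> z \<notin> B \<longrightarrow> 0 < h \<longrightarrow>
        (\<integral>\<^sup>+\<zeta>. ennreal \<bar>g \<zeta> - f n \<zeta>\<bar> * indicator (cball z h) \<zeta> \<partial>mTb) \<le> ennreal (h * t))" for n B
    have "\<exists>B. Q n B" for n
    proof (rule maximal_weak_type[OF Bochner_Integration.integrable_diff[OF g f(1)[of n]] t])
      fix B assume "B \<in> sets borel" "emeasure mTb B \<le> ennreal (10 / t * ?I n)"
        "\<And>z h. cmod z = 1 \<Longrightarrow> z \<notin> B \<Longrightarrow> 0 < h \<Longrightarrow>
          (\<integral>\<^sup>+\<zeta>. ennreal \<bar>g \<zeta> - f n \<zeta>\<bar> * indicator (cball z h) \<zeta> \<partial>mTb) \<le> ennreal (h * t)"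
      then have "Q n B" unfolding Q_def by (intro conjI allI impI)
      then show "\<exists>B. Q n B" ..
    qed
    then obtain B where BQ: "\<And>n. Q n (B n)"
      using choice[of Q] by auto
    have B[measurable]: "\<And>n. B n \<in> sets borel"
      and Bm: "\<And>n. emeasure mTb (B n) \<le> ennreal (10 / t * ?I n)"
      and Bmax: "\<And>n z h. cmod z = 1 \<Longrightarrow> z \<notin> B n \<Longrightarrow> 0 < h \<Longrightarrow>
        (\<integral>\<^sup>+\<zeta>. ennreal \<bar>g \<zeta> - f n \<zeta>\<bar> * indicator (cball z h) \<zeta> \<partial>mTb) \<le> ennreal (h * t)"
      using BQ unfolding Q_def by (blast, blast, blast)
    \<comment> \<open>Besides \<open>B n\<close>, where the maximal function of
      \<open>g - f n\<close> is large, the points where \<open>g - f n\<close> itself is large are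
      discarded; Markov's inequality bounds them by the same L1 distance.\<close>
    let ?D = "\<lambda>n. {\<zeta> \<in> space mTb. e \<le> \<bar>g \<zeta> - f n \<zeta>\<bar>}"
    show ?thesis
    proof (rule AE_from_small_exceptional_sets[where B="\<lambda>n. B n \<union> ?D n"])
      show "B n \<union> ?D n \<in> sets mTb" for n by measurable
      have Dm: "emeasure mTb (?D n) \<le> ennreal (?I n / e)" for n
      proof -
        have "measure mTb (?D n) \<le> ?I n / e"
          using e by (intro integral_Markov_inequality_measure[where A="{}"])
            (auto intro!: integrable_abs Bochner_Integration.integrable_diff g f)
        then show ?thesis by (simp add: mTb.emeasure_eq_measure ennreal_leI)
      qed
      show "emeasure mTb (B n \<union> ?D n) \<le> ennreal (10 / t * ?I n + ?I n / e)" for n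
      proof -
        have "emeasure mTb (B n \<union> ?D n) \<le> emeasure mTb (B n) + emeasure mTb (?D n)"
          by (intro emeasure_subadditive) auto
        also have "\<dots> \<le> ennreal (10 / t * ?I n) + ennreal (?I n / e)"
          by (intro add_mono Bm Dm)
        also have "\<dots> = ennreal (10 / t * ?I n + ?I n / e)"
          using e t by (intro ennreal_plus[symmetric]) auto
        finally show ?thesis .
      qed
      show "(\<lambda>n. 10 / t * ?I n + ?I n / e) \<longlonglongrightarrow> 0"
        using tendsto_add[OF tendsto_mult_right_zero[OF lim, of "10 / t"] tendsto_divide_zero[OF lim, of e]]
        by simp
      show "AE z in mTb. z \<notin> B n \<union> ?D n \<longrightarrow> (\<forall>\<^sub>F r in at_left 1. \<bar>poisson r g z - g z\<bar> \<le> 3 * e)" for n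
        using AE_mTb_norm f(2)[of n, unfolded poisson_converges_def]
      proof eventually_elim
        case (elim z)
        show ?case
        proof
          assume z: "z \<notin> B n \<union> ?D n"
          have "\<forall>\<^sub>F r in at_left 1. \<bar>poisson r (f n) z - f n z\<bar> < e"
            using tendstoD[OF elim(2) e] by (simp add: dist_real_def)
          then show "\<forall>\<^sub>F r in at_left 1. \<bar>poisson r g z - g z\<bar> \<le> 3 * e"
            using at_left_1_bounds
          proof eventually_elim
            case (elim r)
            have "\<bar>poisson r (\<lambda>\<zeta>. g \<zeta> - f n \<zeta>) z\<bar> \<le> 64 * t"
              using z t elim(2) \<open>cmod z = 1\<close>
              by (intro poisson_abs_le Bmax Bochner_Integration.integrable_diff g f) auto
            then have "\<bar>poisson r g z - poisson r (f n) z\<bar> \<le> e"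
              using elim(2) \<open>cmod z = 1\<close> by (subst (asm) poisson_diff) (auto intro: g f simp: t_def)
            then show ?case using elim(1) z by auto
          qed
        qed
      qed
    qed
  qed
  have "AE z in mTb. \<forall>k. \<forall>\<^sub>F r in at_left 1. \<bar>poisson r g z - g z\<bar> \<le> 3 * inverse (real (Suc k))"
    by (subst AE_all_countable) (auto intro!: key)
  then show ?thesis
    unfolding poisson_converges_def
  proof eventually_elim
    case (elim z)
    show ?case
    proof (rule tendstoI)
      fix e :: real assume "0 < e"
      then obtain k where k: "inverse (real (Suc k)) < e / 3"
        using reals_Archimedean[of "e / 3"] by auto
      from elim[rule_format, of k] show "\<forall>\<^sub>F r in at_left 1. dist (poisson r g z) (g z) < e"
        by eventually_elim (use k in \<open>simp add: dist_real_def\<close>)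
    qed
  qed
qed

lemma Re_Cayley: "Re ((1 + w) / (1 - w)) = (1 - (cmod w)\<^sup>2) / (cmod (1 - w))\<^sup>2"
proof -
  have "Re ((1 + w) / (1 - w)) = ((1 + Re w) * (1 - Re w) - Im w * Im w) / ((1 - Re w)\<^sup>2 + (Im w)\<^sup>2)"
    by (simp add: Re_divide)
  also have "(1 + Re w) * (1 - Re w) - Im w * Im w = 1 - (cmod w)\<^sup>2"
    unfolding cmod_power2 by (simp add: power2_eq_square algebra_simps)
  also have "(1 - Re w)\<^sup>2 + (Im w)\<^sup>2 = (cmod (1 - w))\<^sup>2"
    unfolding cmod_power2 by simp
  finally show ?thesis .
qed

text \<open>For \<zeta> on the circle the kernel is the real part of (1 + w cnj z) / (1 - w cnj z)
  at w = r \<zeta>, a holomorphic function of w with value 1 at the origin.\<close>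

lemma poisson_one:
  assumes z: "cmod z = 1" and r: "0 < r" "r < 1"
  shows "poisson r (\<lambda>_. 1) z = 1"
proof -
  let ?F = "\<lambda>w. (1 + w * cnj z) / (1 - w * cnj z)"
  have ne: "1 - w * cnj z \<noteq> 0" if "cmod w < 1" for w
    using that z by (metis eq_iff_diff_eq_0 complex_mod_cnj less_irrefl mult.right_neutral norm_mult norm_one)
  have K: "poisson_kernel r \<zeta> z = Re (?F (of_real r * \<zeta>))" if "cmod \<zeta> = 1" for \<zeta>
  proof -
    let ?w = "of_real r * \<zeta> * cnj z"
    have "1 - of_real r * cnj \<zeta> * z = cnj (1 - ?w)" by simp
    then have "poisson_kernel r \<zeta> z = (1 - (cmod ?w)\<^sup>2) / (cmod (1 - ?w))\<^sup>2"
      unfolding poisson_kernel_def using that z r by (simp only: complex_mod_cnj) (simp add: norm_mult power2_eq_square)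
    also have "\<dots> = Re ((1 + ?w) / (1 - ?w))"
      by (rule Re_Cayley[symmetric])
    finally show ?thesis .
  qed
  have "integrable mTb (\<lambda>\<zeta>. ?F (of_real r * \<zeta>))"
  proof (rule mTb.integrable_const_bound)
    show "AE \<zeta> in mTb. norm (?F (of_real r * \<zeta>)) \<le> 2 / (1 - r)"
      using AE_mTb_norm
    proof eventually_elim
      case (elim \<zeta>)
      let ?w = "of_real r * \<zeta> * cnj z"
      have w: "cmod ?w = r" using elim z r by (simp add: norm_mult)
      have "cmod (1 + ?w) \<le> 2" using norm_triangle_ineq[of 1 ?w] w r by simp
      moreover have "1 - r \<le> cmod (1 - ?w)" using norm_triangle_ineq2[of 1 ?w] w by simp
      ultimately show ?case unfolding norm_divide using r by (intro frac_le) auto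
    qed
  qed measurable
  then have "(\<integral>\<zeta>. Re (?F (of_real r * \<zeta>)) \<partial>mTb) = Re (\<integral>\<zeta>. ?F (of_real r * \<zeta>) \<partial>mTb)"
    by (rule integral_Re)
  also have "(\<integral>\<zeta>. ?F (of_real r * \<zeta>) \<partial>mTb) = ?F 0"
  proof (rule mTb_mean_value)
    show "?F holomorphic_on cball 0 r" using ne r by (intro holomorphic_intros) auto
  qed (use r in measurable)
  finally have "(\<integral>\<zeta>. Re (?F (of_real r * \<zeta>)) \<partial>mTb) = 1" by simp
  moreover have "poisson r (\<lambda>_. 1) z = (\<integral>\<zeta>. Re (?F (of_real r * \<zeta>)) \<partial>mTb)"
    unfolding poisson_def using AE_mTb_norm K by (intro integral_cong_AE) (auto elim: eventually_mono)
  ultimately show ?thesis by simp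
qed

text \<open>Approximate identity: within \<eta> of z continuity leaves e/2 times a kernel of mass 1;
  outside, the oscillation 2 C meets the far bound 8 (1 - r) / \<eta>^2, which tends to 0.\<close>

lemma poisson_continuous:
  assumes f: "continuous_on UNIV f" "bounded (range f)"
  shows "poisson_converges f"
  unfolding poisson_converges_def
  using AE_mTb_norm
proof eventually_elim
  case (elim z)
  have [measurable]: "f \<in> borel_measurable borel" by (rule borel_measurable_continuous_onI[OF f(1)])
  obtain C where C: "\<And>x. \<bar>f x\<bar> \<le> C" using f(2) by (auto simp: bounded_iff)
  have C0: "0 \<le> C" using C[of 0] by linarith
  have fi: "integrable mTb f" by (rule mTb.integrable_const_bound[of _ C]) (use C in auto)
  show ?case
  proof (rule tendstoI)
    fix e :: real assume e: "0 < e"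
    obtain \<eta> where \<eta>: "0 < \<eta>" "\<And>\<zeta>. dist \<zeta> z < \<eta> \<Longrightarrow> dist (f \<zeta>) (f z) < e / 2"
      using f(1) e unfolding continuous_on_iff by (metis UNIV_I half_gt_zero)
    have "((\<lambda>r::real. 16 * C * (1 - r) / \<eta>\<^sup>2) \<longlongrightarrow> 16 * C * (1 - 1) / \<eta>\<^sup>2) (at_left 1)"
      using \<eta>(1) by (intro tendsto_intros) auto
    from order_tendstoD(2)[OF this, of "e / 2"] e
    have "\<forall>\<^sub>F r in at_left 1. 16 * C * (1 - r) / \<eta>\<^sup>2 < e / 2" by simp
    then show "\<forall>\<^sub>F r in at_left 1. dist (poisson r f z) (f z) < e"
      using at_left_1_bounds
    proof eventually_elim
      case (elim r)
      then have r: "0 < r" "r < 1" by auto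
      note z = \<open>cmod z = 1\<close>
      let ?K = "\<lambda>\<zeta>. poisson_kernel r \<zeta> z"
      have i1: "integrable mTb ?K"
        using integrable_times_poisson_kernel[OF _ z r, of "\<lambda>_. 1"] by simp
      have "poisson r f z - f z = poisson r f z - poisson r (\<lambda>_. f z) z"
        using poisson_one[OF z r] by (simp add: poisson_def)
      also have "\<dots> = poisson r (\<lambda>\<zeta>. f \<zeta> - f z) z"
        by (rule poisson_diff[symmetric]) (use fi z r in auto)
      finally have "\<bar>poisson r f z - f z\<bar> = \<bar>poisson r (\<lambda>\<zeta>. f \<zeta> - f z) z\<bar>" by simp
      also have "\<dots> \<le> (\<integral>\<zeta>. \<bar>(f \<zeta> - f z) * ?K \<zeta>\<bar> \<partial>mTb)"
        unfolding poisson_def by (rule integral_abs_bound)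
      also have "\<dots> \<le> (\<integral>\<zeta>. e / 2 * ?K \<zeta> + 16 * C * (1 - r) / \<eta>\<^sup>2 \<partial>mTb)"
      proof (rule integral_mono_AE)
        show "integrable mTb (\<lambda>\<zeta>. \<bar>(f \<zeta> - f z) * ?K \<zeta>\<bar>)"
          by (intro integrable_abs integrable_times_poisson_kernel) (use fi z r in auto)
        show "integrable mTb (\<lambda>\<zeta>. e / 2 * ?K \<zeta> + 16 * C * (1 - r) / \<eta>\<^sup>2)" using i1 by simp
        show "AE \<zeta> in mTb. \<bar>(f \<zeta> - f z) * ?K \<zeta>\<bar> \<le> e / 2 * ?K \<zeta> + 16 * C * (1 - r) / \<eta>\<^sup>2"
          using AE_mTb_norm
        proof eventually_elim
          case (elim \<zeta>)
          note K = poisson_kernel_le[OF z elim r]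
          show ?case
          proof (cases "dist \<zeta> z < \<eta>")
            case True
            have "\<bar>f \<zeta> - f z\<bar> * ?K \<zeta> \<le> e / 2 * ?K \<zeta>"
              using \<eta>(2)[OF True] K(1) by (intro mult_right_mono) (auto simp: dist_real_def)
            moreover have "0 \<le> 16 * C * (1 - r) / \<eta>\<^sup>2" using C0 r by simp
            ultimately show ?thesis using K(1) by (simp add: abs_mult)
          next
            case False
            have "?K \<zeta> * \<eta>\<^sup>2 \<le> ?K \<zeta> * (dist z \<zeta>)\<^sup>2"
              using False K(1) \<eta>(1) by (intro mult_left_mono power_mono) (auto simp: dist_commute)
            then have "?K \<zeta> \<le> 8 * (1 - r) / \<eta>\<^sup>2"
              using K(3) \<eta>(1) by (simp add: pos_le_divide_eq)
            moreover have "\<bar>f \<zeta> - f z\<bar> \<le> 2 * C"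
              using C[of \<zeta>] C[of z] by linarith
            ultimately have "\<bar>f \<zeta> - f z\<bar> * ?K \<zeta> \<le> (2 * C) * (8 * (1 - r) / \<eta>\<^sup>2)"
              using K(1) C0 by (intro mult_mono) auto
            moreover have "0 \<le> e / 2 * ?K \<zeta>" using e K(1) by simp
            moreover have "(2 * C) * (8 * (1 - r) / \<eta>\<^sup>2) = 16 * C * (1 - r) / \<eta>\<^sup>2" by simp
            ultimately show ?thesis unfolding abs_mult abs_of_nonneg[OF K(1)] by linarith
          qed
        qed
      qed
      also have "\<dots> = e / 2 * poisson r (\<lambda>_. 1) z + 16 * C * (1 - r) / \<eta>\<^sup>2"
        using i1 by (subst Bochner_Integration.integral_add) (auto simp: poisson_def mTb.prob_space[unfolded space_mTb])
      also have "\<dots> < e" using elim poisson_one[OF z r] by simp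
      finally show ?case by (simp add: dist_real_def)
    qed
  qed
qed

text \<open>Bounded Borel functions come from the monotone class theorem, where bounded pointwise
  limits are L1 limits by dominated convergence; truncation at height n then reaches every
  integrable function. Integrability is built into \<open>?H\<close> because linearity and L1 limits
  of Poisson integrals use it.\<close>

theorem poisson_converges_L1:
  assumes g: "integrable mTb g"
  shows "poisson_converges g"
proof -
  note gm[measurable] = integrable_mTb_measurable[OF g]
  let ?H = "\<lambda>f :: complex \<Rightarrow> real. integrable mTb f \<and> poisson_converges f"
  have bdd: "?H f" if "f \<in> borel_measurable borel" "bounded (range f)" for f
  proof (rule functional_monotone_class[of ?H, OF _ _ _ that])
    fix f :: "complex \<Rightarrow> real" assume f: "continuous_on UNIV f" "bounded (range f)"
    have [measurable]: "f \<in> borel_measurable borel" by (rule borel_measurable_continuous_onI[OF f(1)])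
    obtain C where C: "\<And>x. \<bar>f x\<bar> \<le> C" using f(2) by (auto simp: bounded_iff)
    have fi: "integrable mTb f" by (rule mTb.integrable_const_bound[of _ C]) (use C in auto)
    with poisson_continuous[OF f] show "?H f" by simp
  next
    fix f g a b assume fg: "?H f" "?H g"
    have "poisson_converges (\<lambda>x. a * f x + b * g x)"
      unfolding poisson_converges_def
      using AE_mTb_norm conjunct2[OF fg(1), unfolded poisson_converges_def]
        conjunct2[OF fg(2), unfolded poisson_converges_def]
    proof eventually_elim
      case (elim z)
      have "((\<lambda>r. a * poisson r f z + b * poisson r g z) \<longlongrightarrow> a * f z + b * g z) (at_left 1)"
        using elim by (intro tendsto_intros)
      then show ?case
        by (rule Lim_transform_eventually)
           (use at_left_1_bounds in eventually_elim, use elim fg in \<open>simp add: poisson_lin\<close>)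
    qed
    then show "?H (\<lambda>x. a * f x + b * g x)" using fg by simp
  next
    fix f :: "nat \<Rightarrow> complex \<Rightarrow> real" and g C
    assume fH: "\<And>n. ?H (f n)" and C: "\<And>n x. \<bar>f n x\<bar> \<le> C" and lim: "\<And>x. (\<lambda>n. f n x) \<longlonglongrightarrow> g x"
      and gm[measurable]: "g \<in> borel_measurable borel"
    note [measurable] = integrable_mTb_measurable[OF conjunct1[OF fH]]
    have gC: "\<bar>g x\<bar> \<le> C" for x
      by (rule LIMSEQ_le_const2[OF tendsto_rabs[OF lim]]) (use C in auto)
    have gi: "integrable mTb g" by (rule mTb.integrable_const_bound[of _ C]) (use gC in auto)
    have "(\<lambda>n. \<integral>\<zeta>. \<bar>g \<zeta> - f n \<zeta>\<bar> \<partial>mTb) \<longlonglongrightarrow> (\<integral>\<zeta>. 0 \<partial>mTb)"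
    proof (rule integral_dominated_convergence[where w="\<lambda>_. 2 * C"])
      show "AE x in mTb. (\<lambda>n. \<bar>g x - f n x\<bar>) \<longlonglongrightarrow> 0"
      proof (rule AE_I2)
        fix x
        show "(\<lambda>n. \<bar>g x - f n x\<bar>) \<longlonglongrightarrow> 0"
          using tendsto_rabs_zero[OF tendsto_diff[OF tendsto_const[of "g x"] lim[of x], unfolded diff_self]] .
      qed
      show "AE x in mTb. norm \<bar>g x - f n x\<bar> \<le> 2 * C" for n
      proof (rule AE_I2)
        fix x
        show "norm \<bar>g x - f n x\<bar> \<le> 2 * C" using gC[of x] C[of n x] by simp
      qed
    qed simp_all
    then have "poisson_converges g"
      using fH by (intro poisson_converges_L1_limit[OF _ _ gi, of f]) simp_all
    then show "?H g" using gi by simp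
  qed
  define f where "f n x = max (- real n) (min (real n) (g x))" for n x
  have fm[measurable]: "f n \<in> borel_measurable borel" for n unfolding f_def by measurable
  have fH: "?H (f n)" for n
    by (rule bdd) (auto intro!: boundedI[of _ "real n"] simp: f_def)
  have "(\<lambda>n. \<integral>\<zeta>. \<bar>g \<zeta> - f n \<zeta>\<bar> \<partial>mTb) \<longlonglongrightarrow> (\<integral>\<zeta>. 0 \<partial>mTb)"
  proof (rule integral_dominated_convergence[where w="\<lambda>x. \<bar>g x\<bar>"])
    show "AE x in mTb. (\<lambda>n. \<bar>g x - f n x\<bar>) \<longlonglongrightarrow> 0"
    proof (rule AE_I2)
      fix x
      obtain N where N: "\<bar>g x\<bar> \<le> real N" using real_arch_simple by blast
      have "\<forall>\<^sub>F n in sequentially. \<bar>g x - f n x\<bar> = 0"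
        using eventually_ge_at_top[of N]
        by eventually_elim (use N in \<open>auto simp: f_def\<close>)
      then show "(\<lambda>n. \<bar>g x - f n x\<bar>) \<longlonglongrightarrow> 0" by (rule tendsto_eventually)
    qed
    show "AE x in mTb. norm \<bar>g x - f n x\<bar> \<le> \<bar>g x\<bar>" for n
      by (rule AE_I2) (auto simp: f_def)
  qed (use g in simp_all)
  then show ?thesis
    using fH by (intro poisson_converges_L1_limit[OF _ _ g, of f]) simp_all
qed

subsection \<open>Fatou's theorem for the Hardy space\<close>

lemma measurable_mT: "f \<in> measurable borel N \<Longrightarrow> f \<in> measurable mT N"
  unfolding mT_def by (rule measurable_completion) (simp cong: measurable_cong_sets)

lemma prob_space_mT: "prob_space mT"
  by (rule prob_spaceI) (simp add: mT_def mTb.emeasure_space_1[unfolded space_mTb])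

interpretation mT: prob_space mT
  by (rule prob_space_mT)

lemma AE_mT_iff: "(AE z in mT. P z) \<longleftrightarrow> (AE z in mTb. P z)"
  unfolding mT_def by (rule AE_completion_iff)

lemma AE_mT_norm: "AE z in mT. cmod z = 1"
  unfolding AE_mT_iff by (rule AE_mTb_norm)

text \<open>Completeness of \<open>mT\<close> at work. Measurability of the boundary function
  \<open>theta_b\<close>, which is given by a bare \<open>Lim\<close>, is later obtained from an
  a.e. identity in this way.\<close>

lemma measurable_mT_AE:
  fixes f g :: "complex \<Rightarrow> 'b::topological_space"
  assumes f: "f \<in> borel_measurable mT" and eq: "AE z in mT. f z = g z"
  shows "g \<in> borel_measurable mT"
proof (rule measurableI)
  fix A :: "'b set" assume A: "A \<in> sets borel"
  have "g -` A \<in> sets (completion mTb)"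
  proof (rule completion.in_sets_AE)
    show "AE x in completion mTb. (x \<in> f -` A) = (x \<in> g -` A)"
      using eq unfolding mT_def by eventually_elim simp
    show "f -` A \<in> sets (completion mTb)"
      using measurable_sets[OF f A] by (simp add: mT_def)
  qed simp
  then show "g -` A \<inter> space mT \<in> sets mT"
    by (simp add: mT_def)
qed simp

text \<open>Leads from the completion back to \<open>mTb\<close>, where the Poisson integrals
  live.\<close>

lemma borel_representative_mT:
  fixes u :: "complex \<Rightarrow> complex"
  assumes "u \<in> borel_measurable mT"
  obtains v where "v \<in> borel_measurable borel" "AE z in mT. u z = v z"
proof -
  have "(\<lambda>z. Re (u z)) \<in> borel_measurable (completion mTb)" "(\<lambda>z. Im (u z)) \<in> borel_measurable (completion mTb)"
    using assms unfolding mT_def by measurable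
  then obtain a b where a: "a \<in> borel_measurable mTb" "AE z in mTb. Re (u z) = a z"
    and b: "b \<in> borel_measurable mTb" "AE z in mTb. Im (u z) = b z"
    using completion_ex_borel_measurable_real by metis
  show ?thesis
  proof
    note [measurable] = a(1)[simplified] b(1)[simplified]
    have "a \<in> borel_measurable borel" "b \<in> borel_measurable borel"
      using a(1) b(1) by (simp_all cong: measurable_cong_sets)
    then show "(\<lambda>z. Complex (a z) (b z)) \<in> borel_measurable borel"
      by (subst borel_measurable_complex_iff) simp
    show "AE z in mT. u z = Complex (a z) (b z)"
      unfolding AE_mT_iff using a(2) b(2) by eventually_elim (simp add: complex_eq_iff)
  qed
qed

lemma L2_measurable: "L2 M f \<Longrightarrow> f \<in> borel_measurable M"
  by (simp add: L2_def)

lemma L2_scale_bounded: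
  assumes f: "L2 M f" and h[measurable]: "h \<in> borel_measurable M" and C: "AE x in M. cmod (h x) \<le> C"
  shows "L2 M (\<lambda>x. h x * f x)"
proof -
  note [measurable] = L2_measurable[OF f]
  have "integrable M (\<lambda>x. (cmod (h x * f x))\<^sup>2)"
  proof (rule Bochner_Integration.integrable_bound)
    show "integrable M (\<lambda>x. C\<^sup>2 * (cmod (f x))\<^sup>2)" using f by (simp add: L2_def)
    show "AE x in M. norm ((cmod (h x * f x))\<^sup>2) \<le> norm (C\<^sup>2 * (cmod (f x))\<^sup>2)"
      using C by eventually_elim (auto simp: norm_mult power_mult_distrib intro!: mult_right_mono power_mono)
  qed measurable
  then show ?thesis by (simp add: L2_def)
qed

lemma L2_cmult: "L2 M f \<Longrightarrow> L2 M (\<lambda>x. a * f x)"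
  by (rule L2_scale_bounded[where C="cmod a"]) auto

lemma L2_add:
  assumes f: "L2 M f" and g: "L2 M g"
  shows "L2 M (\<lambda>x. f x + g x)"
proof -
  note [measurable] = L2_measurable[OF f] L2_measurable[OF g]
  have "integrable M (\<lambda>x. (cmod (f x + g x))\<^sup>2)"
  proof (rule Bochner_Integration.integrable_bound)
    show "integrable M (\<lambda>x. 2 * (cmod (f x))\<^sup>2 + 2 * (cmod (g x))\<^sup>2)" using f g by (simp add: L2_def)
    show "AE x in M. norm ((cmod (f x + g x))\<^sup>2) \<le> norm (2 * (cmod (f x))\<^sup>2 + 2 * (cmod (g x))\<^sup>2)"
    proof (rule AE_I2)
      fix x
      have "(cmod (f x + g x))\<^sup>2 \<le> (cmod (f x) + cmod (g x))\<^sup>2"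
        by (intro power_mono norm_triangle_ineq) simp
      also have "\<dots> \<le> 2 * (cmod (f x))\<^sup>2 + 2 * (cmod (g x))\<^sup>2"
        using sum_squares_bound[of "cmod (f x)" "cmod (g x)"] by (simp add: power2_sum)
      finally show "norm ((cmod (f x + g x))\<^sup>2) \<le> norm (2 * (cmod (f x))\<^sup>2 + 2 * (cmod (g x))\<^sup>2)" by simp
    qed
  qed measurable
  then show ?thesis by (simp add: L2_def)
qed

lemma L2_lin: "L2 M f \<Longrightarrow> L2 M g \<Longrightarrow> L2 M (\<lambda>x. a * f x + b * g x)"
  by (intro L2_add L2_cmult)

lemma L2_diff: "L2 M f \<Longrightarrow> L2 M g \<Longrightarrow> L2 M (\<lambda>x. f x - g x)"
  using L2_lin[of M f g 1 "-1"] by simp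

lemma L2_cnj: "L2 M f \<Longrightarrow> L2 M (\<lambda>x. cnj (f x))"
  by (auto simp: L2_def intro: measurable_compose[OF _ cnj_measurable])

lemma L2_mult_integrable:
  assumes f: "L2 M f" and g: "L2 M g"
  shows "integrable M (\<lambda>x. f x * g x)"
proof (rule Bochner_Integration.integrable_bound)
  note [measurable] = L2_measurable[OF f] L2_measurable[OF g]
  show "integrable M (\<lambda>x. (cmod (f x))\<^sup>2 + (cmod (g x))\<^sup>2)" using f g by (simp add: L2_def)
  show "AE x in M. norm (f x * g x) \<le> norm ((cmod (f x))\<^sup>2 + (cmod (g x))\<^sup>2)"
  proof (rule AE_I2)
    fix x
    have "2 * (cmod (f x) * cmod (g x)) \<le> (cmod (f x))\<^sup>2 + (cmod (g x))\<^sup>2"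
      using sum_squares_bound[of "cmod (f x)" "cmod (g x)"] by simp
    moreover have "0 \<le> cmod (f x) * cmod (g x)" by simp
    ultimately have "cmod (f x) * cmod (g x) \<le> (cmod (f x))\<^sup>2 + (cmod (g x))\<^sup>2" by linarith
    then show "norm (f x * g x) \<le> norm ((cmod (f x))\<^sup>2 + (cmod (g x))\<^sup>2)" by (simp add: norm_mult)
  qed
  show "(\<lambda>x. f x * g x) \<in> borel_measurable M" by measurable
qed

lemma (in finite_measure) L2_bounded:
  assumes [measurable]: "f \<in> borel_measurable M" and "AE x in M. cmod (f x) \<le> C"
  shows "L2 M f"
proof -
  have "integrable M (\<lambda>x. (cmod (f x))\<^sup>2)"
    using assms(2) by (intro integrable_const_bound[of _ "C\<^sup>2"]) (auto elim!: eventually_mono intro!: power_mono)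
  then show ?thesis by (simp add: L2_def)
qed

lemma (in finite_measure) L2_integrable: "L2 M f \<Longrightarrow> integrable M f"
  using L2_mult_integrable[of M f "\<lambda>_. 1"] L2_bounded[of "\<lambda>_. 1" 1] by simp

lemma L2_mT_AE:
  assumes f: "L2 mT f" and eq: "AE z in mT. f z = g z"
  shows "L2 mT g"
proof -
  have g[measurable]: "g \<in> borel_measurable mT"
    by (rule measurable_mT_AE[OF L2_measurable[OF f] eq])
  note [measurable] = L2_measurable[OF f]
  have "integrable mT (\<lambda>x. (cmod (f x))\<^sup>2) \<longleftrightarrow> integrable mT (\<lambda>x. (cmod (g x))\<^sup>2)"
    by (rule integrable_cong_AE) (use eq in \<open>auto elim!: eventually_mono\<close>)
  then show ?thesis using f g by (simp add: L2_def)
qed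

lemma L2_mT_monom:
  assumes f: "L2 mT f" shows "L2 mT (\<lambda>z. z * f z)" "L2 mT (\<lambda>z. cnj z * f z)" "L2 mT (\<lambda>z. z ^ n * f z)"
proof -
  have m: "(\<lambda>z. z) \<in> borel_measurable mT" "cnj \<in> borel_measurable mT" "(\<lambda>z. z ^ n) \<in> borel_measurable mT"
    by (rule measurable_mT; measurable)+
  show "L2 mT (\<lambda>z. z * f z)" "L2 mT (\<lambda>z. cnj z * f z)" "L2 mT (\<lambda>z. z ^ n * f z)"
    using AE_mT_norm by (auto intro!: L2_scale_bounded[OF f, where C=1] m simp: norm_power elim!: eventually_mono)
qed

text \<open>For \<nu> = \<mu> this is the operator T_r at interior points; for \<nu> =
  \<open>mT\<close> it is the holomorphic extension of an H2 function.\<close>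

definition cauchy :: "complex measure \<Rightarrow> (complex \<Rightarrow> complex) \<Rightarrow> complex \<Rightarrow> complex" where
  "cauchy \<nu> f l = (\<integral>\<xi>. f \<xi> / (1 - cnj \<xi> * l) \<partial>\<nu>)"

lemma Tr_eq_cauchy: "Tr \<mu> r f z = cauchy \<mu> f (of_real r * z)"
  by (simp add: Tr_def cauchy_def mult_ac)

text \<open>In the disc the Cauchy integral of u equals its Poisson integral: the kernels differ by
  an antianalytic term that sees only the moments of u against z^n with n > 0, and these vanish. The
  L1 theorem then applies to real and imaginary parts.\<close>

theorem fatou_H2:
  assumes u: "u \<in> H2"
  shows "AE z in mT. ((\<lambda>r. cauchy mT u (of_real r * z)) \<longlongrightarrow> u z) (at_left 1)"
proof -
  have uL: "L2 mT u" and u0: "\<And>n. 0 < n \<Longrightarrow> (\<integral>z. u z * z ^ n \<partial>mT) = 0"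
    using u by (auto simp: H2_def)
  obtain v where v[measurable]: "v \<in> borel_measurable borel" and uv: "AE z in mT. u z = v z"
    using borel_representative_mT[OF L2_measurable[OF uL]] by blast
  note [measurable] = L2_measurable[OF uL]
  have to_mTb: "(\<integral>z. F z (u z) \<partial>mT) = (\<integral>z. F z (v z) \<partial>mTb)"
    if F: "(\<lambda>z. F z (v z)) \<in> borel_measurable borel" for F :: "complex \<Rightarrow> complex \<Rightarrow> complex"
  proof -
    have "(\<integral>z. F z (u z) \<partial>mT) = (\<integral>z. F z (v z) \<partial>mT)"
    proof (rule integral_cong_AE)
      show "AE z in mT. F z (u z) = F z (v z)" using uv by eventually_elim simp
      show *: "(\<lambda>z. F z (v z)) \<in> borel_measurable mT" by (rule measurable_mT[OF F])
      show "(\<lambda>z. F z (u z)) \<in> borel_measurable mT"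
        by (rule measurable_mT_AE[OF *]) (use uv in eventually_elim, simp)
    qed
    also have "\<dots> = (\<integral>z. F z (v z) \<partial>mTb)"
      unfolding mT_def by (rule integral_completion) (use F in \<open>simp cong: measurable_cong_sets\<close>)
    finally show ?thesis .
  qed
  have vi: "integrable mTb v"
  proof -
    have "integrable mT v"
      using mT.L2_integrable[OF L2_mT_AE[OF uL uv]] .
    then show ?thesis unfolding mT_def by (subst (asm) integrable_completion) (simp_all cong: measurable_cong_sets)
  qed
  have v0: "(\<integral>z. v z * z ^ n \<partial>mTb) = 0" if "0 < n" for n
    using u0[OF that] by (subst (asm) to_mTb[of "\<lambda>z w. w * z ^ n"]) simp_all
  have eq: "cauchy mT u (of_real r * z) = Complex (poisson r (\<lambda>z. Re (v z)) z) (poisson r (\<lambda>z. Im (v z)) z)"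
    if z: "cmod z = 1" and r: "0 < r" "r < 1" for r z
  proof -
    let ?l = "of_real r * z"
    have l: "cmod ?l < 1" "cmod (cnj ?l) < 1" using z r by (simp_all add: norm_mult)
    have inv_bound: "cmod (inverse (1 - w * x)) \<le> 1 / (1 - r)" if "cmod w = 1" "cmod x = r" for w x
    proof -
      have "1 - r \<le> cmod (1 - w * x)"
        using norm_triangle_ineq2[of 1 "w * x"] that by (simp add: norm_mult)
      then have "inverse (cmod (1 - w * x)) \<le> inverse (1 - r)"
        using r by (intro le_imp_inverse_le) auto
      then show ?thesis unfolding norm_inverse by (simp only: inverse_eq_divide)
    qed
    have i1: "integrable mTb (\<lambda>\<zeta>. v \<zeta> / (1 - cnj \<zeta> * ?l))"
    proof (rule Bochner_Integration.integrable_bound)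
      show "integrable mTb (\<lambda>\<zeta>. v \<zeta> * of_real (1 / (1 - r)))" using vi by simp
      show "AE \<zeta> in mTb. norm (v \<zeta> / (1 - cnj \<zeta> * ?l)) \<le> norm (v \<zeta> * of_real (1 / (1 - r)))"
        using AE_mTb_norm
      proof eventually_elim
        case (elim \<zeta>)
        have "cmod (inverse (1 - cnj \<zeta> * ?l)) \<le> 1 / (1 - r)"
          by (rule inv_bound) (use elim z r in \<open>auto simp: norm_mult\<close>)
        from mult_left_mono[OF this norm_ge_zero[of "v \<zeta>"]] show ?case
          using r by (simp add: divide_inverse norm_mult del: of_real_inverse)
      qed
    qed measurable
    have i2: "integrable mTb (\<lambda>\<zeta>. (v \<zeta> * \<zeta>) / (1 - \<zeta> * cnj ?l))"
    proof (rule Bochner_Integration.integrable_bound)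
      show "integrable mTb (\<lambda>\<zeta>. v \<zeta> * of_real (1 / (1 - r)))" using vi by simp
      show "AE \<zeta> in mTb. norm ((v \<zeta> * \<zeta>) / (1 - \<zeta> * cnj ?l)) \<le> norm (v \<zeta> * of_real (1 / (1 - r)))"
        using AE_mTb_norm
      proof eventually_elim
        case (elim \<zeta>)
        have "cmod (inverse (1 - \<zeta> * cnj ?l)) \<le> 1 / (1 - r)"
          by (rule inv_bound) (use elim z r in \<open>auto simp: norm_mult\<close>)
        from mult_left_mono[OF this norm_ge_zero[of "v \<zeta>"]] show ?case
          using r elim by (simp add: divide_inverse norm_mult del: of_real_inverse)
      qed
    qed measurable
    have i3: "integrable mTb (\<lambda>\<zeta>. v \<zeta> * \<zeta>)"
      by (rule Bochner_Integration.integrable_bound[OF vi])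
         (use AE_mTb_norm in \<open>auto simp: norm_mult elim!: eventually_mono\<close>)
    have "(\<lambda>n. (\<integral>\<xi>. (v \<xi> * \<xi>) * \<xi> ^ n \<partial>mTb) * cnj ?l ^ n) sums (\<integral>\<xi>. (v \<xi> * \<xi>) / (1 - \<xi> * cnj ?l) \<partial>mTb)"
      by (rule cauchy_sums[OF i3]) (use AE_mTb_norm l in \<open>auto elim!: eventually_mono\<close>)
    moreover have "(\<integral>\<xi>. (v \<xi> * \<xi>) * \<xi> ^ n \<partial>mTb) = 0" for n
      using v0[of "Suc n"] by (simp add: mult_ac)
    ultimately have zero: "(\<integral>\<xi>. (v \<xi> * \<xi>) / (1 - \<xi> * cnj ?l) \<partial>mTb) = 0"
      by (simp add: sums_iff)
    have "cauchy mT u ?l = (\<integral>\<zeta>. v \<zeta> / (1 - cnj \<zeta> * ?l) \<partial>mTb)"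
      unfolding cauchy_def by (rule to_mTb[of "\<lambda>z w. w / (1 - cnj z * ?l)"]) measurable
    also have "\<dots> = (\<integral>\<zeta>. v \<zeta> / (1 - cnj \<zeta> * ?l) \<partial>mTb) + cnj ?l * (\<integral>\<xi>. (v \<xi> * \<xi>) / (1 - \<xi> * cnj ?l) \<partial>mTb)"
      unfolding zero by simp
    also have "\<dots> = (\<integral>\<zeta>. v \<zeta> / (1 - cnj \<zeta> * ?l) + cnj ?l * ((v \<zeta> * \<zeta>) / (1 - \<zeta> * cnj ?l)) \<partial>mTb)"
      by (subst Bochner_Integration.integral_add[OF i1 integrable_mult_right[OF i2]])
         (simp only: integral_mult_right_zero)
    also have "\<dots> = (\<integral>\<zeta>. v \<zeta> * of_real (poisson_kernel r \<zeta> z) \<partial>mTb)"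
    proof (rule integral_cong_AE)
      show "AE \<zeta> in mTb. v \<zeta> / (1 - cnj \<zeta> * ?l) + cnj ?l * ((v \<zeta> * \<zeta>) / (1 - \<zeta> * cnj ?l))
          = v \<zeta> * of_real (poisson_kernel r \<zeta> z)"
        using AE_mTb_norm
      proof eventually_elim
        case (elim \<zeta>)
        let ?x = "cnj \<zeta> * ?l"
        have x: "cmod ?x = r" using elim z r by (simp add: norm_mult)
        have nz: "1 - ?x \<noteq> 0" "1 - cnj ?x \<noteq> 0"
        proof -
          show "1 - ?x \<noteq> 0" using x r by (metis less_irrefl norm_one eq_iff_diff_eq_0)
          then show "1 - cnj ?x \<noteq> 0" by (metis complex_cnj_cancel_iff complex_cnj_diff complex_cnj_one complex_cnj_zero)
        qed
        have K: "poisson_kernel r \<zeta> z = (1 - (cmod ?x)\<^sup>2) / (cmod (1 - ?x))\<^sup>2"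
          unfolding poisson_kernel_def x by (simp add: mult_ac)
        have "of_real (poisson_kernel r \<zeta> z) = (1 - ?x * cnj ?x) / ((1 - ?x) * cnj (1 - ?x))"
          unfolding K complex_norm_square[symmetric] of_real_divide of_real_diff of_real_1
          by (simp only: complex_norm_square)
        also have "\<dots> = 1 / (1 - ?x) + cnj ?x / (1 - cnj ?x)"
          using nz by (simp add: divide_simps) (simp add: algebra_simps)
        finally have "v \<zeta> * of_real (poisson_kernel r \<zeta> z) = v \<zeta> * (1 / (1 - ?x) + cnj ?x / (1 - cnj ?x))"
          by simp
        then show ?case by (simp add: algebra_simps)
      qed
    qed measurable
    also have "\<dots> = Complex (poisson r (\<lambda>z. Re (v z)) z) (poisson r (\<lambda>z. Im (v z)) z)"
    proof -
      have i: "integrable mTb (\<lambda>\<zeta>. v \<zeta> * of_real (poisson_kernel r \<zeta> z))"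
      proof -
        have "integrable mTb (\<lambda>\<zeta>. of_real (Re (v \<zeta>) * poisson_kernel r \<zeta> z)
            + \<i> * of_real (Im (v \<zeta>) * poisson_kernel r \<zeta> z))"
          by (intro Bochner_Integration.integrable_add integrable_mult_right integrable_of_real
              integrable_times_poisson_kernel integrable_Re integrable_Im vi z r)
        then show ?thesis
          by (rule back_subst[of "integrable mTb"]) (auto simp: complex_eq_iff)
      qed
      show ?thesis
        using integral_Re[OF i] integral_Im[OF i] by (simp add: complex_eq_iff poisson_def)
    qed
    finally show ?thesis .
  qed
  have "poisson_converges (\<lambda>z. Re (v z))" "poisson_converges (\<lambda>z. Im (v z))"
    using vi by (auto intro!: poisson_converges_L1)
  then have "AE z in mT. ((\<lambda>r. poisson r (\<lambda>z. Re (v z)) z) \<longlongrightarrow> Re (v z)) (at_left 1)"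
    "AE z in mT. ((\<lambda>r. poisson r (\<lambda>z. Im (v z)) z) \<longlongrightarrow> Im (v z)) (at_left 1)"
    unfolding poisson_converges_def AE_mT_iff .
  then show ?thesis
    using AE_mT_norm uv
  proof eventually_elim
    case (elim z)
    have "((\<lambda>r. Complex (poisson r (\<lambda>z. Re (v z)) z) (poisson r (\<lambda>z. Im (v z)) z)) \<longlongrightarrow> Complex (Re (v z)) (Im (v z))) (at_left 1)"
      using elim by (intro tendsto_Complex)
    then show ?case
      by (rule Lim_transform_eventually[THEN back_subst[of "\<lambda>x. (_ \<longlongrightarrow> x) _"]])
         (use at_left_1_bounds in eventually_elim, use elim eq in auto)
  qed
qed

subsection \<open>The Cauchy transform of a probability measure on the circle\<close>

text \<open>1 / (1 - w) is the average of 1 and the Cayley transform of w, whose real part is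
  nonnegative.\<close>

lemma Re_inverse_one_minus:
  assumes "cmod w < 1" shows "1 / 2 \<le> Re (1 / (1 - w))"
proof -
  have ne: "1 - w \<noteq> 0" using assms by auto
  have "2 * (1 / (1 - w)) = 1 + (1 + w) / (1 - w)" using ne by (simp add: divide_simps)
  then have "2 * Re (1 / (1 - w)) = 1 + Re ((1 + w) / (1 - w))"
    by (metis Re_complex_of_real complex_Re_numeral mult_2 plus_complex.sel(1) one_complex.sel(1))
  moreover have "0 \<le> Re ((1 + w) / (1 - w))"
    unfolding Re_Cayley using assms by (intro divide_nonneg_nonneg) (auto simp: power_le_one)
  ultimately show ?thesis by simp
qed

locale circle_prob = prob_space \<mu> for \<mu> :: "complex measure" +
  assumes sets_mu [simp, measurable_cong]: "sets \<mu> = sets borel"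
    and circle: "emeasure \<mu> (- sphere 0 1) = 0"
begin

lemma space_mu [simp]: "space \<mu> = UNIV"
  using sets_eq_imp_space_eq[OF sets_mu] by simp

lemma AE_norm: "AE \<xi> in \<mu>. cmod \<xi> = 1"
proof (rule AE_I')
  show "- sphere 0 1 \<in> null_sets \<mu>" using circle by (simp add: null_sets_def)
qed (auto simp: dist_norm)

lemma one_minus_bound:
  assumes "cmod \<xi> = 1" "cmod l < 1" shows "1 - cmod l \<le> cmod (1 - cnj \<xi> * l)"
  using norm_triangle_ineq2[of 1 "cnj \<xi> * l"] assms by (simp add: norm_mult)

lemma integrable_cauchy:
  assumes f: "integrable \<mu> f" and l: "cmod l < 1"
  shows "integrable \<mu> (\<lambda>\<xi>. f \<xi> / (1 - cnj \<xi> * l))"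
proof (rule Bochner_Integration.integrable_bound)
  have [measurable]: "f \<in> borel_measurable borel"
    using borel_measurable_integrable[OF f] by (simp cong: measurable_cong_sets)
  show "integrable \<mu> (\<lambda>\<xi>. f \<xi> * of_real (1 / (1 - cmod l)))" using f by simp
  show "AE \<xi> in \<mu>. norm (f \<xi> / (1 - cnj \<xi> * l)) \<le> norm (f \<xi> * of_real (1 / (1 - cmod l)))"
    using AE_norm
  proof eventually_elim
    case (elim \<xi>)
    have "inverse (cmod (1 - cnj \<xi> * l)) \<le> inverse (1 - cmod l)"
      using one_minus_bound[OF elim l] l by (intro le_imp_inverse_le) auto
    from mult_left_mono[OF this norm_ge_zero[of "f \<xi>"]] show ?case
      using l by (simp add: divide_inverse norm_mult norm_inverse del: of_real_inverse)
  qed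
  show "(\<lambda>\<xi>. f \<xi> / (1 - cnj \<xi> * l)) \<in> borel_measurable \<mu>" by measurable
qed

abbreviation "C1 \<equiv> cauchy \<mu> (\<lambda>_. 1)"

lemma C1_0: "C1 0 = 1"
  by (simp add: cauchy_def prob_space[unfolded space_mu])

lemma Re_C1: assumes l: "cmod l < 1" shows "1 / 2 \<le> Re (C1 l)"
proof -
  have i: "integrable \<mu> (\<lambda>\<xi>. 1 / (1 - cnj \<xi> * l))" using integrable_cauchy[of "\<lambda>_. 1", OF _ l] by simp
  have "(1 / 2 :: real) = (\<integral>\<xi>. 1 / 2 \<partial>\<mu>)" by (simp add: prob_space[unfolded space_mu])
  also have "\<dots> \<le> (\<integral>\<xi>. Re (1 / (1 - cnj \<xi> * l)) \<partial>\<mu>)"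
  proof (intro integral_mono_AE integrable_Re i)
    show "AE \<xi> in \<mu>. 1 / 2 \<le> Re (1 / (1 - cnj \<xi> * l))"
      using AE_norm by eventually_elim (rule Re_inverse_one_minus, simp add: norm_mult l)
  qed simp
  also have "\<dots> = Re (C1 l)" unfolding cauchy_def using i by (rule integral_Re)
  finally show ?thesis .
qed

lemma C1_nonzero: "cmod l < 1 \<Longrightarrow> C1 l \<noteq> 0"
  using Re_C1[of l] by auto

lemma holomorphic_C1: "C1 holomorphic_on ball 0 1"
proof (rule power_series_holomorphic)
  fix w :: complex assume "w \<in> ball 0 1"
  then have w: "cmod w < 1" by simp
  have "AE \<xi> in \<mu>. cmod (cnj \<xi>) \<le> 1" using AE_norm by eventually_elim simp
  then show "(\<lambda>n. (\<integral>\<xi>. 1 * cnj \<xi> ^ n \<partial>\<mu>) * (w - 0) ^ n) sums C1 w"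
    unfolding cauchy_def diff_zero by (intro cauchy_sums w) simp_all
qed

lemma measurable_C1 [measurable]: "C1 \<in> borel_measurable borel"
  unfolding cauchy_def by (rule borel_measurable_lebesgue_integral) measurable

lemma R2_eq_C1: assumes l: "cmod l < 1" shows "R2 \<mu> l = 2 * C1 l - 1"
proof -
  have i: "integrable \<mu> (\<lambda>\<xi>. 1 / (1 - cnj \<xi> * l))" using integrable_cauchy[of "\<lambda>_. 1", OF _ l] by simp
  have "R2 \<mu> l = (\<integral>\<xi>. 2 * (1 / (1 - cnj \<xi> * l)) - 1 \<partial>\<mu>)"
    unfolding R2_def
  proof (rule integral_cong_AE)
    show "AE \<xi> in \<mu>. (1 + cnj \<xi> * l) / (1 - cnj \<xi> * l) = 2 * (1 / (1 - cnj \<xi> * l)) - 1"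
      using AE_norm
    proof eventually_elim
      case (elim \<xi>)
      have "1 - cnj \<xi> * l \<noteq> 0" using one_minus_bound[OF elim l] l by auto
      then show ?case by (simp add: divide_simps)
    qed
  qed measurable
  also have "\<dots> = (\<integral>\<xi>. 2 * (1 / (1 - cnj \<xi> * l)) \<partial>\<mu>) - (\<integral>\<xi>. 1 \<partial>\<mu>)"
    by (rule Bochner_Integration.integral_diff[OF integrable_mult_right[OF i]]) simp
  also have "\<dots> = 2 * C1 l - 1"
    unfolding integral_mult_right_zero cauchy_def by (simp add: prob_space[unfolded space_mu])
  finally show ?thesis .
qed

text \<open>The functions \<open>1 / (\<epsilon> + 1 / C1)\<close> have non-negative real part and mean \<open>1 / (1 + \<epsilon>)\<close>, while
  they tend to \<open>1 / \<epsilon>\<close> wherever \<open>1 / C1\<close> tends to \<open>0\<close>.\<close>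

lemma inverse_C1_not_tendsto_0: "AE z in mTb. \<not> ((\<lambda>r. 1 / C1 (of_real r * z)) \<longlongrightarrow> 0) (at_left 1)"
proof -
  define \<epsilon> where "\<epsilon> n = 1 / real (Suc n)" for n
  \<comment> \<open>Fatou's lemma runs over a sequence, so the radial limit is tested along radii
    tending to 1; the shift by 2 keeps every radius positive.\<close>
  define \<rho> where "\<rho> n = 1 - 1 / real (n + 2)" for n
  have \<epsilon>: "0 < \<epsilon> n" for n by (simp add: \<epsilon>_def)
  have \<rho>: "0 < \<rho> n" "\<rho> n < 1" for n by (simp_all add: \<rho>_def)
  have "\<rho> \<longlonglongrightarrow> 1 - 0"
    unfolding \<rho>_def by (intro tendsto_intros LIMSEQ_ignore_initial_segment[OF lim_1_over_n])
  then have \<rho>lim: "filterlim \<rho> (at_left 1) sequentially"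
    using \<rho> by (auto simp: filterlim_at less_imp_neq intro!: always_eventually)
  define g where "g n l = 1 / (of_real (\<epsilon> n) + 1 / C1 l)" for n l
  have Re_inv: "0 \<le> Re (1 / C1 l)" if "cmod l < 1" for l
    using Re_C1[OF that] by (simp add: Re_divide)
  have den: "\<epsilon> n \<le> Re (of_real (\<epsilon> n) + 1 / C1 l)" if "cmod l < 1" for n l
    using Re_inv[OF that] by simp
  have den0: "of_real (\<epsilon> n) + 1 / C1 l \<noteq> 0" if "cmod l < 1" for n l
    using den[OF that, of n] \<epsilon>[of n] by (metis not_le zero_complex.sel(1))
  have g_pos: "0 \<le> Re (g n l)" if "cmod l < 1" for n l
    unfolding g_def using den[OF that, of n] \<epsilon>[of n] by (simp add: Re_divide)
  have g_bound: "cmod (g n l) \<le> 1 / \<epsilon> n" if "cmod l < 1" for n l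
  proof -
    have "\<epsilon> n \<le> cmod (of_real (\<epsilon> n) + 1 / C1 l)"
      using den[OF that, of n] complex_Re_le_cmod order_trans by blast
    then show ?thesis unfolding g_def norm_divide using \<epsilon>[of n] by (simp add: frac_le)
  qed
  have gm[measurable]: "g n \<in> borel_measurable borel" for n unfolding g_def by measurable
  have g_int: "(\<integral>z. g n (of_real r * z) \<partial>mTb) = 1 / (1 + of_real (\<epsilon> n))" if r: "0 < r" "r < 1" for n r
  proof -
    have hC: "C1 holomorphic_on cball 0 r"
      by (rule holomorphic_on_subset[OF holomorphic_C1]) (use r in auto)
    have "(\<integral>z. g n (of_real r * z) \<partial>mTb) = g n 0"
    proof (rule mTb_mean_value[OF _ r(1) gm])
      show "g n holomorphic_on cball 0 r"
        unfolding g_def by (intro holomorphic_intros hC) (use r C1_nonzero den0 in auto)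
    qed
    then show ?thesis by (simp add: g_def C1_0 add.commute)
  qed
  define \<phi> where "\<phi> n k z = ennreal (Re (g n (of_real (\<rho> k) * z)))" for n k z
  have \<phi>m[measurable]: "\<phi> n k \<in> borel_measurable borel" for n k unfolding \<phi>_def by measurable
  have \<phi>_int: "(\<integral>\<^sup>+z. \<phi> n k z \<partial>mTb) \<le> 1" for n k
  proof -
    have b: "AE z in mTb. cmod (of_real (\<rho> k) * z) < 1"
      using AE_mTb_norm by eventually_elim (use \<rho>[of k] in \<open>simp add: norm_mult\<close>)
    have i: "integrable mTb (\<lambda>z. g n (of_real (\<rho> k) * z))"
      by (rule mTb.integrable_const_bound[of _ "1 / \<epsilon> n"])
         (use b in eventually_elim, use g_bound in auto)
    have "(\<integral>\<^sup>+z. \<phi> n k z \<partial>mTb) = ennreal (\<integral>z. Re (g n (of_real (\<rho> k) * z)) \<partial>mTb)"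
      unfolding \<phi>_def using b g_pos by (intro nn_integral_eq_integral integrable_Re i) (auto elim!: eventually_mono)
    moreover have "(\<integral>z. Re (g n (of_real (\<rho> k) * z)) \<partial>mTb) = Re (1 / (1 + of_real (\<epsilon> n)))"
      using integral_Re[OF i] g_int[OF \<rho>] by simp
    moreover have "Re (1 / (1 + of_real (\<epsilon> n))) = Re (of_real (1 / (1 + \<epsilon> n)))" by simp
    moreover have "Re (of_real (1 / (1 + \<epsilon> n)) :: complex) \<le> 1"
      using \<epsilon>[of n] by (simp only: Re_complex_of_real) (simp add: divide_simps)
    ultimately show ?thesis by (metis ennreal_1 ennreal_leI)
  qed
  \<comment> \<open>Markov set at level 1/\<epsilon> of a function with integral at most 1, so its
    measure is at most \<epsilon>. Where 1 / C1 tends to 0, the limit inferior is exactly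
    1/\<epsilon>, and the point belongs to the set.\<close>
  define D where "D n = {z \<in> space mTb. 1 \<le> ennreal (\<epsilon> n) * liminf (\<lambda>k. \<phi> n k z)}" for n
  show ?thesis
  proof (rule AE_from_small_exceptional_sets[where B=D and b=\<epsilon>])
    show "D n \<in> sets mTb" for n unfolding D_def by measurable
    show "\<epsilon> \<longlonglongrightarrow> 0"
      unfolding \<epsilon>_def using LIMSEQ_Suc[OF lim_1_over_n[where 'a=real]] by simp
    show "emeasure mTb (D n) \<le> ennreal (\<epsilon> n)" for n
    proof -
      have "emeasure mTb (D n) \<le> ennreal (\<epsilon> n) * (\<integral>\<^sup>+z. liminf (\<lambda>k. \<phi> n k z) * indicator (space mTb) z \<partial>mTb)"
        unfolding D_def by (rule nn_integral_Markov_inequality) measurable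
      also have "(\<integral>\<^sup>+z. liminf (\<lambda>k. \<phi> n k z) * indicator (space mTb) z \<partial>mTb) = (\<integral>\<^sup>+z. liminf (\<lambda>k. \<phi> n k z) \<partial>mTb)"
        by simp
      also have "\<dots> \<le> liminf (\<lambda>k. \<integral>\<^sup>+z. \<phi> n k z \<partial>mTb)"
        by (rule nn_integral_liminf) measurable
      also have "\<dots> \<le> 1"
        by (rule order_trans[OF Liminf_le_Limsup Limsup_bounded]) (auto simp: \<phi>_int)
      finally show ?thesis using mult_left_mono by fastforce
    qed
    show "AE z in mTb. z \<notin> D n \<longrightarrow> \<not> ((\<lambda>r. 1 / C1 (of_real r * z)) \<longlongrightarrow> 0) (at_left 1)" for n
    proof (rule AE_I2, intro impI notI)
      fix z assume z: "z \<notin> D n" and lim: "((\<lambda>r. 1 / C1 (of_real r * z)) \<longlongrightarrow> 0) (at_left 1)"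
      have "(\<lambda>k. 1 / C1 (of_real (\<rho> k) * z)) \<longlonglongrightarrow> 0"
        using filterlim_compose[OF lim \<rho>lim] .
      then have "(\<lambda>k. g n (of_real (\<rho> k) * z)) \<longlonglongrightarrow> 1 / (of_real (\<epsilon> n) + 0)"
        unfolding g_def by (intro tendsto_intros) (use \<epsilon>[of n] in auto)
      then have "(\<lambda>k. Re (g n (of_real (\<rho> k) * z))) \<longlonglongrightarrow> Re (1 / (of_real (\<epsilon> n) + 0))"
        by (rule tendsto_Re)
      also have "Re (1 / (of_real (\<epsilon> n) + 0)) = 1 / \<epsilon> n" by (simp add: Re_divide_of_real)
      finally have "(\<lambda>k. \<phi> n k z) \<longlonglongrightarrow> ennreal (1 / \<epsilon> n)"
        unfolding \<phi>_def by (rule tendsto_ennrealI)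
      then have "liminf (\<lambda>k. \<phi> n k z) = ennreal (1 / \<epsilon> n)"
        by (rule lim_imp_Liminf[rotated]) simp
      then have "ennreal (\<epsilon> n) * liminf (\<lambda>k. \<phi> n k z) = 1"
        using \<epsilon>[of n] by (simp flip: ennreal_mult)
      then show False using z by (simp add: D_def)
    qed
  qed
qed

end

subsection \<open>Inner products, the Hardy space and the model space\<close>

lemma ip_integrable: "L2 M f \<Longrightarrow> L2 M g \<Longrightarrow> integrable M (\<lambda>x. f x * cnj (g x))"
  by (intro L2_mult_integrable L2_cnj)

lemma ip_lin_left:
  assumes "L2 M f" "L2 M g" "L2 M h"
  shows "ip M (\<lambda>x. a * f x + b * g x) h = a * ip M f h + b * ip M g h"
proof -
  note i = ip_integrable[OF assms(1,3)] ip_integrable[OF assms(2,3)]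
  have "ip M (\<lambda>x. a * f x + b * g x) h = (\<integral>x. a * (f x * cnj (h x)) + b * (g x * cnj (h x)) \<partial>M)"
    unfolding ip_def by (simp add: algebra_simps)
  also have "\<dots> = a * ip M f h + b * ip M g h"
    unfolding ip_def by (subst Bochner_Integration.integral_add) (auto intro!: integrable_mult_right i)
  finally show ?thesis .
qed

lemma ip2_eq:
  assumes "L2 mT (fst u)" "L2 mT (fst v)" "L2 mT (snd u)" "L2 mT (snd v)"
  shows "ip2 u v = ip mT (fst u) (fst v) + ip mT (snd u) (snd v)"
  unfolding ip2_def ip_def by (intro Bochner_Integration.integral_add ip_integrable assms)

lemma integral_mT_cong:
  fixes f g :: "complex \<Rightarrow> 'b::{banach, second_countable_topology}"
  assumes f: "f \<in> borel_measurable mT" and eq: "AE z in mT. f z = g z"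
  shows "integral\<^sup>L mT f = integral\<^sup>L mT g"
  by (rule integral_cong_AE[OF f measurable_mT_AE[OF f eq] eq])

lemma ip_self: "ip M f f = of_real (\<integral>x. (cmod (f x))\<^sup>2 \<partial>M)"
proof -
  have "ip M f f = (\<integral>x. complex_of_real ((cmod (f x))\<^sup>2) \<partial>M)"
    unfolding ip_def by (intro Bochner_Integration.integral_cong) (simp_all only: complex_norm_square)
  then show ?thesis by (simp only: integral_complex_of_real)
qed

lemma nrm_power2: "(nrm M f)\<^sup>2 = (\<integral>x. (cmod (f x))\<^sup>2 \<partial>M)"
  unfolding nrm_def by simp

lemma nrm_nonneg: "0 \<le> nrm M f"
  unfolding nrm_def by simp

lemma nrm_cmult: "nrm M (\<lambda>x. a * f x) = cmod a * nrm M f"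
  unfolding nrm_def by (simp add: norm_mult power_mult_distrib real_sqrt_mult)

text \<open>The crude constant \<open>2\<close> avoids Minkowski's inequality.\<close>

lemma nrm_add_le:
  assumes f: "L2 M f" and g: "L2 M g"
  shows "nrm M (\<lambda>x. f x + g x) \<le> 2 * (nrm M f + nrm M g)"
proof (rule power2_le_imp_le)
  have "(nrm M (\<lambda>x. f x + g x))\<^sup>2 \<le> (\<integral>x. 2 * (cmod (f x))\<^sup>2 + 2 * (cmod (g x))\<^sup>2 \<partial>M)"
    unfolding nrm_power2
  proof (rule integral_mono)
    show "integrable M (\<lambda>x. (cmod (f x + g x))\<^sup>2)" using L2_add[OF f g] by (simp add: L2_def)
    show "integrable M (\<lambda>x. 2 * (cmod (f x))\<^sup>2 + 2 * (cmod (g x))\<^sup>2)" using f g by (simp add: L2_def)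
    fix x
    have "(cmod (f x + g x))\<^sup>2 \<le> (cmod (f x) + cmod (g x))\<^sup>2"
      by (intro power_mono norm_triangle_ineq) simp
    also have "\<dots> \<le> 2 * (cmod (f x))\<^sup>2 + 2 * (cmod (g x))\<^sup>2"
      using sum_squares_bound[of "cmod (f x)" "cmod (g x)"] by (simp add: power2_sum)
    finally show "(cmod (f x + g x))\<^sup>2 \<le> 2 * (cmod (f x))\<^sup>2 + 2 * (cmod (g x))\<^sup>2" .
  qed
  also have "\<dots> = 2 * (nrm M f)\<^sup>2 + 2 * (nrm M g)\<^sup>2"
    unfolding nrm_power2 using f g by (simp add: L2_def)
  also have "\<dots> \<le> (2 * (nrm M f + nrm M g))\<^sup>2"
    using nrm_nonneg[of M f] nrm_nonneg[of M g] by (simp add: power2_eq_square algebra_simps)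
  finally show "(nrm M (\<lambda>x. f x + g x))\<^sup>2 \<le> (2 * (nrm M f + nrm M g))\<^sup>2" .
qed (simp add: nrm_nonneg)

lemma H2_L2: "f \<in> H2 \<Longrightarrow> L2 mT f"
  by (simp add: H2_def)

lemma integral_mT_power: "0 < n \<Longrightarrow> (\<integral>z. z ^ n \<partial>mT) = 0"
  unfolding mT_def by (subst integral_completion) (simp_all add: integral_mTb_power)

lemma L2_mT_const: "L2 mT (\<lambda>_. c)"
  by (rule mT.L2_bounded[of _ "cmod c"]) auto

lemma const_H2: "(\<lambda>_. c) \<in> H2"
  unfolding H2_def using L2_mT_const by (auto simp: integral_mT_power)

lemma L2_power_integrable: "L2 mT f \<Longrightarrow> integrable mT (\<lambda>z. f z * z ^ n)"
  using mT.L2_integrable[OF L2_mT_monom(3)] by (simp add: mult.commute)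

lemma H2_integral_mult_z: assumes "f \<in> H2" shows "(\<integral>z. z * f z \<partial>mT) = 0"
proof -
  have "\<forall>n::nat>0. (\<integral>z. f z * z ^ n \<partial>mT) = 0" using assms by (simp add: H2_def)
  from spec[OF this, of 1] show ?thesis by (simp add: mult.commute)
qed

lemma H2_lin:
  assumes f: "f \<in> H2" and g: "g \<in> H2" shows "(\<lambda>z. a * f z + b * g z) \<in> H2"
proof -
  have "(\<integral>z. (a * f z + b * g z) * z ^ n \<partial>mT) = 0" if "0 < n" for n
  proof -
    have "(\<integral>z. (a * f z + b * g z) * z ^ n \<partial>mT) = (\<integral>z. a * (f z * z ^ n) + b * (g z * z ^ n) \<partial>mT)"
      by (simp add: algebra_simps)
    also have "\<dots> = a * (\<integral>z. f z * z ^ n \<partial>mT) + b * (\<integral>z. g z * z ^ n \<partial>mT)"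
      using L2_power_integrable[OF H2_L2[OF f]] L2_power_integrable[OF H2_L2[OF g]] by simp
    finally show ?thesis using f g that by (simp add: H2_def)
  qed
  then show ?thesis using f g by (simp add: H2_def L2_lin)
qed

lemma H2_mult_z: assumes f: "f \<in> H2" shows "(\<lambda>z. z * f z) \<in> H2"
proof -
  have "(\<integral>z. z * f z * z ^ n \<partial>mT) = 0" for n
  proof -
    have "(\<integral>z. z * f z * z ^ n \<partial>mT) = (\<integral>z. f z * z ^ Suc n \<partial>mT)" by (simp add: mult_ac)
    also have "\<dots> = 0" using f unfolding H2_def by blast
    finally show ?thesis .
  qed
  then show ?thesis using f by (simp add: H2_def L2_mT_monom)
qed

lemma H2_AE: assumes f: "f \<in> H2" and eq: "AE z in mT. f z = g z" shows "g \<in> H2"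
proof -
  have "(\<integral>z. g z * z ^ n \<partial>mT) = (\<integral>z. f z * z ^ n \<partial>mT)" for n
    by (rule integral_mT_cong[symmetric])
       (use borel_measurable_integrable[OF L2_power_integrable[OF H2_L2[OF f]]] eq in auto)
  then show ?thesis using f L2_mT_AE[OF H2_L2[OF f] eq] by (simp add: H2_def)
qed

text \<open>Backward shift: the constant term is removed and the rest divided by z. The only new
  moment condition is n = 1, which is the vanishing mean of h - c.\<close>

lemma H2_shift:
  assumes h: "h \<in> H2" shows "(\<lambda>z. cnj z * (h z - (\<integral>z. h z \<partial>mT))) \<in> H2"
proof -
  let ?c = "\<integral>z. h z \<partial>mT"
  have L: "L2 mT (\<lambda>z. h z - ?c)" by (intro L2_diff H2_L2[OF h] L2_mT_const)
  have "(\<integral>z. cnj z * (h z - ?c) * z ^ n \<partial>mT) = 0" if n: "0 < n" for n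
  proof -
    obtain m where m: "n = Suc m" using n by (cases n) auto
    have "(\<integral>z. cnj z * (h z - ?c) * z ^ n \<partial>mT) = (\<integral>z. (h z - ?c) * z ^ m \<partial>mT)"
    proof (rule integral_mT_cong)
      show "(\<lambda>z. cnj z * (h z - ?c) * z ^ n) \<in> borel_measurable mT"
        by (rule borel_measurable_integrable[OF L2_power_integrable[OF L2_mT_monom(2)[OF L]]])
      show "AE z in mT. cnj z * (h z - ?c) * z ^ n = (h z - ?c) * z ^ m"
        using AE_mT_norm
        by eventually_elim (use m unit_cnj(2) in \<open>simp add: mult_ac\<close>)
    qed
    also have "\<dots> = (\<integral>z. h z * z ^ m - ?c * z ^ m \<partial>mT)" by (simp add: algebra_simps)
    also have "\<dots> = (\<integral>z. h z * z ^ m \<partial>mT) - (\<integral>z. ?c * z ^ m \<partial>mT)"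
      using L2_power_integrable[OF H2_L2[OF h]] L2_power_integrable[OF L2_mT_const]
      by (intro Bochner_Integration.integral_diff)
    also have "\<dots> = 0"
    proof (cases "m = 0")
      case True then show ?thesis by (simp add: mT.prob_space[unfolded space_mT])
    next
      case False
      moreover have "(\<integral>z. h z * z ^ m \<partial>mT) = 0" using h False by (simp add: H2_def)
      ultimately show ?thesis by (simp add: integral_mT_power)
    qed
    finally show ?thesis .
  qed
  then show ?thesis using L2_mT_monom(2)[OF L] by (simp add: H2_def)
qed

lemma closDL2_L2: "g \<in> closDL2 D \<Longrightarrow> L2 mT g"
  by (simp add: closDL2_def)

lemma closDL2_lin:
  assumes f: "f \<in> closDL2 D" and g: "g \<in> closDL2 D" and D: "D \<in> borel_measurable mT" "AE z in mT. cmod (D z) \<le> 1"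
  shows "(\<lambda>z. a * f z + b * g z) \<in> closDL2 D"
proof -
  have "\<exists>h. L2 mT h \<and> nrm mT (\<lambda>z. a * f z + b * g z - D z * h z) < e" if e: "0 < e" for e
  proof -
    \<comment> \<open>The factor 2 is that of \<open>nrm_add_le\<close>; the summand 1 keeps
      \<open>c\<close> positive for a = b = 0 and makes the final estimate strict.\<close>
    define c where "c = 2 * (cmod a + cmod b) + 1"
    have c: "0 < c" unfolding c_def by (intro add_nonneg_pos mult_nonneg_nonneg add_nonneg_nonneg) auto
    have ec: "0 < e / c" using e c by simp
    obtain h where h: "L2 mT h" "nrm mT (\<lambda>z. f z - D z * h z) < e / c"
      using f ec unfolding closDL2_def by blast
    obtain k where k: "L2 mT k" "nrm mT (\<lambda>z. g z - D z * k z) < e / c"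
      using g ec unfolding closDL2_def by blast
    let ?u = "\<lambda>z. f z - D z * h z" and ?v = "\<lambda>z. g z - D z * k z"
    have L: "L2 mT ?u" "L2 mT ?v"
      by (rule L2_diff[OF closDL2_L2[OF f] L2_scale_bounded[OF h(1) D]],
          rule L2_diff[OF closDL2_L2[OF g] L2_scale_bounded[OF k(1) D]])
    have "nrm mT (\<lambda>z. a * ?u z + b * ?v z) \<le> 2 * (nrm mT (\<lambda>z. a * ?u z) + nrm mT (\<lambda>z. b * ?v z))"
      by (intro nrm_add_le L2_cmult L)
    also have "\<dots> = 2 * (cmod a * nrm mT ?u + cmod b * nrm mT ?v)" by (simp only: nrm_cmult)
    also have "\<dots> \<le> 2 * (cmod a * (e / c) + cmod b * (e / c))"
      using h(2) k(2) by (intro mult_left_mono add_mono) auto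
    also have "\<dots> = (e / c) * (2 * (cmod a + cmod b))" by (simp add: algebra_simps)
    also have "\<dots> < (e / c) * c" using e c by (intro mult_strict_left_mono) (auto simp: c_def)
    also have "\<dots> = e" using c by simp
    finally have "nrm mT (\<lambda>z. a * ?u z + b * ?v z) < e" .
    moreover have "(\<lambda>z. a * ?u z + b * ?v z) = (\<lambda>z. a * f z + b * g z - D z * (a * h z + b * k z))"
      by (auto simp: algebra_simps)
    ultimately show ?thesis using L2_lin[OF h(1) k(1), of a b] by (auto intro!: exI[of _ "\<lambda>z. a * h z + b * k z"])
  qed
  then show ?thesis using f g by (simp add: closDL2_def L2_lin)
qed

lemma nrm_mT_mult_z:
  assumes "L2 mT f" shows "nrm mT (\<lambda>z. z * f z) = nrm mT f"
proof -
  have "(\<integral>z. (cmod (z * f z))\<^sup>2 \<partial>mT) = (\<integral>z. (cmod (f z))\<^sup>2 \<partial>mT)"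
  proof (rule integral_mT_cong)
    show "(\<lambda>z. (cmod (z * f z))\<^sup>2) \<in> borel_measurable mT"
      using L2_mT_monom(1)[OF assms] unfolding L2_def by (blast intro: borel_measurable_integrable)
    show "AE z in mT. (cmod (z * f z))\<^sup>2 = (cmod (f z))\<^sup>2"
      using AE_mT_norm by eventually_elim (simp add: norm_mult)
  qed
  then show ?thesis by (simp add: nrm_def)
qed

lemma closDL2_mult_z:
  assumes f: "f \<in> closDL2 D" and D: "D \<in> borel_measurable mT" "AE z in mT. cmod (D z) \<le> 1"
  shows "(\<lambda>z. z * f z) \<in> closDL2 D"
proof -
  have "\<exists>h. L2 mT h \<and> nrm mT (\<lambda>z. z * f z - D z * h z) < e" if e: "0 < e" for e
  proof -
    obtain h where h: "L2 mT h" "nrm mT (\<lambda>z. f z - D z * h z) < e"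
      using f e unfolding closDL2_def by blast
    have "L2 mT (\<lambda>z. f z - D z * h z)"
      by (rule L2_diff[OF closDL2_L2[OF f] L2_scale_bounded[OF h(1) D]])
    from nrm_mT_mult_z[OF this] have "nrm mT (\<lambda>z. z * f z - D z * (z * h z)) < e"
      using h(2) by (simp add: algebra_simps)
    then show ?thesis using L2_mT_monom(1)[OF h(1)] by blast
  qed
  then show ?thesis using f by (simp add: closDL2_def L2_mT_monom)
qed

lemma closDL2_self:
  assumes "L2 mT D" shows "D \<in> closDL2 D"
  unfolding closDL2_def using assms L2_mT_const[of 1]
  by (auto intro!: exI[of _ "\<lambda>_. 1"] simp: nrm_def)

lemma ip2_self_eq_0:
  assumes u: "L2 mT (fst u)" "L2 mT (snd u)" and 0: "ip2 u u = 0"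
  shows "AE z in mT. fst u z = 0 \<and> snd u z = 0"
proof -
  have i: "integrable mT (\<lambda>z. (cmod (fst u z))\<^sup>2 + (cmod (snd u z))\<^sup>2)" using u by (simp add: L2_def)
  have "ip2 u u = of_real ((\<integral>z. (cmod (fst u z))\<^sup>2 \<partial>mT) + (\<integral>z. (cmod (snd u z))\<^sup>2 \<partial>mT))"
    by (simp add: ip2_eq u ip_self)
  also have "(\<integral>z. (cmod (fst u z))\<^sup>2 \<partial>mT) + (\<integral>z. (cmod (snd u z))\<^sup>2 \<partial>mT)
      = (\<integral>z. (cmod (fst u z))\<^sup>2 + (cmod (snd u z))\<^sup>2 \<partial>mT)"
    using u by (intro Bochner_Integration.integral_add[symmetric]) (simp_all add: L2_def)
  finally have "(\<integral>z. (cmod (fst u z))\<^sup>2 + (cmod (snd u z))\<^sup>2 \<partial>mT) = 0" using 0 by simp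
  then have "AE z in mT. (cmod (fst u z))\<^sup>2 + (cmod (snd u z))\<^sup>2 = 0"
    using integral_nonneg_eq_0_iff_AE[OF i] by simp
  then show ?thesis by eventually_elim (simp add: add_nonneg_eq_0_iff)
qed

subsection \<open>The intertwining relation\<close>

locale clark = circle_prob +
  fixes \<gamma> :: complex and Phi :: "(complex \<Rightarrow> complex) \<Rightarrow> vfun"
  assumes gamma: "cmod \<gamma> < 1" and Phi: "is_Phi_star \<gamma> \<mu> Phi"
begin

abbreviation "th \<equiv> theta_b \<gamma> \<mu>"
abbreviation "D \<equiv> Delta \<gamma> \<mu>"
abbreviation "K \<equiv> model_space th D"

definition s :: complex where "s = complex_of_real (sqrt (1 - (cmod \<gamma>)\<^sup>2))"

lemma gamma_pos: "0 < 1 - (cmod \<gamma>)\<^sup>2"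
  using gamma by (simp add: power_less_one_iff abs_square_less_1)

lemma s_nonzero: "s \<noteq> 0"
  using gamma_pos by (simp add: s_def)

lemma cnj_s [simp]: "cnj s = s"
  by (simp add: s_def)

lemma s_s: "s * s = 1 - \<gamma> * cnj \<gamma>"
proof -
  have "s * s = complex_of_real (1 - (cmod \<gamma>)\<^sup>2)"
    unfolding s_def of_real_mult[symmetric] using gamma_pos by simp
  then show ?thesis by (simp only: of_real_diff of_real_1 complex_norm_square)
qed

lemma theta_0: "theta \<gamma> \<mu> 0 = - \<gamma>"
proof -
  have "R2 \<mu> 0 = 1" using R2_eq_C1[of 0] C1_0 by simp
  then show ?thesis by (simp add: theta_def)
qed

lemma PhiK: "L2 \<mu> f \<Longrightarrow> Phi f \<in> K"
  using Phi unfolding is_Phi_star_def Let_def by blast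

lemma Phi_ip: "L2 \<mu> f \<Longrightarrow> L2 \<mu> g \<Longrightarrow> ip2 (Phi f) (Phi g) = ip \<mu> f g"
  using Phi unfolding is_Phi_star_def Let_def by blast

lemma Phi_lin:
  assumes "L2 \<mu> f" "L2 \<mu> g"
  shows "AE z in mT. fst (Phi (\<lambda>\<xi>. a * f \<xi> + b * g \<xi>)) z = a * fst (Phi f) z + b * fst (Phi g) z
    \<and> snd (Phi (\<lambda>\<xi>. a * f \<xi> + b * g \<xi>)) z = a * snd (Phi f) z + b * snd (Phi g) z"
proof -
  have "vae_eq (Phi (\<lambda>\<xi>. a * f \<xi> + b * g \<xi>)) (vlin a (Phi f) b (Phi g))"
    using Phi assms unfolding is_Phi_star_def Let_def by blast
  then show ?thesis by (simp add: vae_eq_def vlin_def)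
qed

lemma Phi_model: "L2 \<mu> f \<Longrightarrow> model_op th D (Phi f) (Phi (U_gamma \<gamma> \<mu> f))"
  using Phi unfolding is_Phi_star_def Let_def by blast

lemma Phi_H2: "L2 \<mu> f \<Longrightarrow> fst (Phi f) \<in> H2"
  and Phi_clos: "L2 \<mu> f \<Longrightarrow> snd (Phi f) \<in> closDL2 D"
  using PhiK by (auto simp: model_space_def)

lemma Phi_L2: "L2 \<mu> f \<Longrightarrow> L2 mT (fst (Phi f))" "L2 \<mu> f \<Longrightarrow> L2 mT (snd (Phi f))"
  using Phi_H2 H2_L2 Phi_clos closDL2_L2 by blast+

text \<open>The defect vectors are normalized by 1 / s, because \<theta>(0) = -\<gamma>; multiplying
  by s clears this factor everywhere below.\<close>

lemma s_k: "s * complex_of_real (1 / sqrt (1 - (cmod (theta \<gamma> \<mu> 0))\<^sup>2)) = 1"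
  using gamma_pos unfolding s_def theta_0 by (simp flip: of_real_mult)

lemma Phi_one: "AE z in mT. s * fst (Phi (\<lambda>_. 1)) z = 1 + cnj \<gamma> * th z \<and> s * snd (Phi (\<lambda>_. 1)) z = cnj \<gamma> * D z"
proof -
  have "vae_eq (Phi (\<lambda>_. 1)) (c_vec \<gamma> \<mu>)"
    using Phi unfolding is_Phi_star_def Let_def by blast
  then show ?thesis
    unfolding vae_eq_def c_vec_def Let_def fst_conv snd_conv
  proof eventually_elim
    case (elim z)
    then show ?case
      using s_k unfolding theta_0
      by (simp only: mult.assoc[symmetric]) (simp add: theta_0)
  qed
qed

lemma Phi_cnj: "AE z in mT. s * fst (Phi cnj) z = cnj z * (th z + \<gamma>) \<and> s * snd (Phi cnj) z = cnj z * D z"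
proof -
  have "vae_eq (Phi cnj) (c1_vec \<gamma> \<mu>)"
    using Phi unfolding is_Phi_star_def Let_def by blast
  then show ?thesis
    using AE_mT_norm
    unfolding vae_eq_def c1_vec_def Let_def fst_conv snd_conv
  proof eventually_elim
    case (elim z)
    have "inverse z = cnj z" using unit_cnj(1)[OF elim(2)] by (rule inverse_unique)
    with elim(1) show ?case
      using s_k unfolding theta_0
      by (simp only: mult.assoc[symmetric]) (simp add: theta_0)
  qed
qed

section \<open>The boundary function of \<theta>, recovered from the defect vectors\<close>

lemma L2_one: "L2 \<mu> (\<lambda>_. 1)"
  by (rule L2_bounded[of _ 1]) auto

lemma L2_scale:
  assumes f: "L2 \<mu> f" and g: "g \<in> borel_measurable borel" "\<And>\<xi>. cmod \<xi> = 1 \<Longrightarrow> cmod (g \<xi>) \<le> C"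
  shows "L2 \<mu> (\<lambda>\<xi>. g \<xi> * f \<xi>)"
proof (rule L2_scale_bounded[OF f])
  show "g \<in> borel_measurable \<mu>" using g(1) by (simp cong: measurable_cong_sets)
  show "AE \<xi> in \<mu>. cmod (g \<xi>) \<le> C" using AE_norm by eventually_elim (rule g(2))
qed

lemma L2_xi: "L2 \<mu> f \<Longrightarrow> L2 \<mu> (\<lambda>\<xi>. \<xi> * f \<xi>)"
  by (rule L2_scale[where C=1]) auto

lemma L2_cnj_xi: "L2 \<mu> f \<Longrightarrow> L2 \<mu> (\<lambda>\<xi>. cnj \<xi> * f \<xi>)"
  by (rule L2_scale[where C=1]) auto

lemma L2_mu_cnj: "L2 \<mu> cnj"
  using L2_cnj_xi[OF L2_one] by simp

text \<open>The boundary function \<open>th\<close> is defined by a limit that may a priori fail to exist, but \<open>Phi cnj\<close>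
  lies in the model space; so \<open>th\<close> is in \<open>H2\<close> and has the mean of \<open>theta\<close>.\<close>

lemma th_eq: "AE z in mT. s * (z * fst (Phi cnj) z) + - \<gamma> * 1 = th z"
  using Phi_cnj AE_mT_norm
proof eventually_elim
  case (elim z)
  have "s * (z * fst (Phi cnj) z) = z * (s * fst (Phi cnj) z)" by simp
  also have "\<dots> = z * cnj z * (th z + \<gamma>)" using elim by simp
  finally show ?case using unit_cnj(1)[OF elim(2)] by simp
qed

lemma th_H2: "th \<in> H2"
  by (rule H2_AE[OF H2_lin[OF H2_mult_z[OF Phi_H2[OF L2_mu_cnj]] const_H2] th_eq])

lemma th_L2: "L2 mT th"
  by (rule H2_L2[OF th_H2])

lemma D_L2: "L2 mT D"
proof (rule L2_mT_AE)
  show "L2 mT (\<lambda>z. s * (z * snd (Phi cnj) z))"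
    by (intro L2_cmult L2_mT_monom Phi_L2 L2_mu_cnj)
  show "AE z in mT. s * (z * snd (Phi cnj) z) = D z"
    using Phi_cnj AE_mT_norm
  proof eventually_elim
    case (elim z)
    have "s * (z * snd (Phi cnj) z) = z * (s * snd (Phi cnj) z)" by simp
    also have "\<dots> = z * cnj z * D z" using elim by simp
    finally show ?case using unit_cnj(1)[OF elim(2)] by simp
  qed
qed

lemma integral_th: "(\<integral>z. th z \<partial>mT) = - \<gamma>"
proof -
  have L: "L2 mT (fst (Phi cnj))" by (intro Phi_L2 L2_mu_cnj)
  have 0: "(\<integral>z. z * fst (Phi cnj) z \<partial>mT) = 0"
    by (rule H2_integral_mult_z[OF Phi_H2[OF L2_mu_cnj]])
  have i: "integrable mT (\<lambda>z. z * fst (Phi cnj) z)"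
    by (rule mT.L2_integrable[OF L2_mT_monom(1)[OF L]])
  have "(\<integral>z. th z \<partial>mT) = (\<integral>z. s * (z * fst (Phi cnj) z) + - \<gamma> * 1 \<partial>mT)"
    by (rule integral_mT_cong[symmetric, OF _ th_eq])
       (use borel_measurable_integrable[OF i] in measurable)
  also have "\<dots> = (\<integral>z. s * (z * fst (Phi cnj) z) \<partial>mT) + (\<integral>z. - \<gamma> * 1 \<partial>mT)"
    by (rule Bochner_Integration.integral_add[OF integrable_mult_right[OF i]]) simp
  also have "\<dots> = - \<gamma>"
    using 0 by (simp add: mT.prob_space[unfolded space_mT])
  finally show ?thesis .
qed

lemma norm_D: "(cmod (D z))\<^sup>2 = \<bar>1 - (cmod (th z))\<^sup>2\<bar>"
  unfolding Delta_def norm_of_real power2_abs by (simp add: real_sqrt_abs2 power2_eq_square flip: real_sqrt_mult)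

text \<open>Since \<open>sqrt\<close> is odd in Isabelle, \<open>\<bar>D\<bar>\<^sup>2 = \<bar>1 - \<bar>th\<bar>\<^sup>2\<bar>\<close> holds unconditionally; the norm of
  \<open>Phi cnj\<close> then forces \<open>\<bar>th\<bar> \<le> 1\<close>.\<close>

lemma th_bounded: "AE z in mT. cmod (th z) \<le> 1"
proof -
  let ?I = "\<integral>z. (cmod (th z))\<^sup>2 + (cmod (D z))\<^sup>2 \<partial>mT"
  have i: "integrable mT (\<lambda>z. (cmod (th z))\<^sup>2 + (cmod (D z))\<^sup>2)"
    using th_L2 D_L2 by (simp add: L2_def)
  note Lc = Phi_L2[OF L2_mu_cnj]
  have "ip \<mu> cnj cnj = (\<integral>\<xi>. 1 \<partial>\<mu>)"
    unfolding ip_def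
    by (rule integral_cong_AE) (use AE_norm in \<open>auto elim!: eventually_mono simp: unit_cnj\<close>)
  \<comment> \<open>\<open>cnj\<close> is a unit vector of L2(\<mu>), hence so is its image; the
    expansion of that norm produces the integral of |th|^2 + |D|^2.\<close>
  then have "1 = ip2 (Phi cnj) (Phi cnj)"
    by (simp add: Phi_ip L2_mu_cnj prob_space[unfolded space_mu])
  then have "s * s * 1 = s * s * ip2 (Phi cnj) (Phi cnj)" by simp
  also have "\<dots> = (\<integral>z. (s * fst (Phi cnj) z) * cnj (s * fst (Phi cnj) z)
      + (s * snd (Phi cnj) z) * cnj (s * snd (Phi cnj) z) \<partial>mT)"
    unfolding ip2_def integral_mult_right_zero[symmetric] by (simp add: algebra_simps)
  also have "\<dots> = (\<integral>z. of_real ((cmod (th z))\<^sup>2 + (cmod (D z))\<^sup>2) + (\<gamma> * cnj (th z) + (cnj \<gamma> * th z + \<gamma> * cnj \<gamma>)) \<partial>mT)"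
  proof (rule integral_mT_cong)
    note [measurable] = L2_measurable[OF Lc(1)] L2_measurable[OF Lc(2)]
    have [measurable]: "(\<lambda>z. cnj (s * fst (Phi cnj) z)) \<in> borel_measurable mT"
      "(\<lambda>z. cnj (s * snd (Phi cnj) z)) \<in> borel_measurable mT"
      by (rule measurable_compose[OF _ cnj_measurable]; measurable)+
    show "(\<lambda>z. (s * fst (Phi cnj) z) * cnj (s * fst (Phi cnj) z)
      + (s * snd (Phi cnj) z) * cnj (s * snd (Phi cnj) z)) \<in> borel_measurable mT" by measurable
    show "AE z in mT. (s * fst (Phi cnj) z) * cnj (s * fst (Phi cnj) z)
        + (s * snd (Phi cnj) z) * cnj (s * snd (Phi cnj) z)
      = of_real ((cmod (th z))\<^sup>2 + (cmod (D z))\<^sup>2) + (\<gamma> * cnj (th z) + (cnj \<gamma> * th z + \<gamma> * cnj \<gamma>))"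
      using Phi_cnj AE_mT_norm
    proof eventually_elim
      case (elim z)
      have "(cnj z * (th z + \<gamma>)) * cnj (cnj z * (th z + \<gamma>)) + (cnj z * D z) * cnj (cnj z * D z)
        = (z * cnj z) * ((th z + \<gamma>) * cnj (th z + \<gamma>) + D z * cnj (D z))"
        by (simp add: algebra_simps)
      also have "\<dots> = (th z + \<gamma>) * cnj (th z + \<gamma>) + D z * cnj (D z)"
        using unit_cnj(1)[OF elim(2)] by simp
      also have "\<dots> = of_real ((cmod (th z))\<^sup>2 + (cmod (D z))\<^sup>2) + (\<gamma> * cnj (th z) + (cnj \<gamma> * th z + \<gamma> * cnj \<gamma>))"
        unfolding of_real_add complex_norm_square by (simp add: algebra_simps)
      finally show ?case using elim(1) by simp
    qed
  qed
  \<comment> \<open>As th has mean -\<gamma>, the cross terms and |\<gamma>|^2 add up to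
    -|\<gamma>|^2, which matches s^2 = 1 - |\<gamma>|^2.\<close>
  also have "\<dots> = of_real ?I + (\<gamma> * cnj (- \<gamma>) + (cnj \<gamma> * (- \<gamma>) + \<gamma> * cnj \<gamma>))"
  proof -
    have t: "integrable mT th" "integrable mT (\<lambda>z. cnj (th z))"
      by (intro mT.L2_integrable L2_cnj th_L2)+
    have ct: "(\<integral>z. cnj (th z) \<partial>mT) = cnj (- \<gamma>)"
      using integral_th by (metis Bochner_Integration.integral_cnj)
    show ?thesis
      using i t by (simp add: ct integral_th mT.prob_space[unfolded space_mT] del: of_real_add complex_cnj_minus)
  qed
  finally have "of_real ?I = s * s + \<gamma> * cnj \<gamma>" by (simp add: algebra_simps)
  then have "of_real ?I = (1 :: complex)" unfolding s_s by simp
  then have I1: "?I = 1" by (simp only: of_real_eq_1_iff)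
  \<comment> \<open>A pointwise nonnegative integrand of mean 0 vanishes almost everywhere.\<close>
  have "(\<integral>z. (cmod (th z))\<^sup>2 + (cmod (D z))\<^sup>2 - 1 \<partial>mT) = 0"
    using I1 i by (simp add: mT.prob_space[unfolded space_mT])
  moreover have "0 \<le> (cmod (th z))\<^sup>2 + (cmod (D z))\<^sup>2 - 1" for z
    unfolding norm_D by simp
  ultimately have "AE z in mT. (cmod (th z))\<^sup>2 + (cmod (D z))\<^sup>2 - 1 = 0"
    using integral_nonneg_eq_0_iff_AE[of mT "\<lambda>z. (cmod (th z))\<^sup>2 + (cmod (D z))\<^sup>2 - 1"] i by simp
  then show ?thesis
  proof eventually_elim
    case (elim z)
    then have "(cmod (th z))\<^sup>2 \<le> 1" by (metis diff_eq_eq add_0 le_add_same_cancel1 zero_le_power2)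
    then show ?case by (simp add: abs_square_le_1)
  qed
qed

lemma D_bounded: "AE z in mT. cmod (D z) \<le> 1"
  using th_bounded
proof eventually_elim
  case (elim z)
  then have "(cmod (th z))\<^sup>2 \<le> 1" by (simp add: abs_square_le_1)
  then have "(cmod (D z))\<^sup>2 \<le> 1" unfolding norm_D by simp
  then show ?case by (simp add: abs_square_le_1)
qed

text \<open>Makes h \<mapsto> (th h, D h) an isometry of L2, so the subspace removed in the model
  space is a copy of H2.\<close>

lemma th_D_unit: "AE z in mT. th z * cnj (th z) + D z * cnj (D z) = 1"
  using th_bounded
proof eventually_elim
  case (elim z)
  then have "(cmod (th z))\<^sup>2 \<le> 1" by (simp add: abs_square_le_1)
  then have "(cmod (th z))\<^sup>2 + (cmod (D z))\<^sup>2 = 1" unfolding norm_D by simp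
  then show ?case unfolding complex_norm_square[symmetric] of_real_add[symmetric] by simp
qed

section \<open>Rank-one form of the intertwining relation\<close>

definition W :: "complex \<Rightarrow> complex" where "W z = 1 - \<gamma> - (1 - cnj \<gamma>) * th z"

lemma D_measurable: "D \<in> borel_measurable mT"
  by (rule L2_measurable[OF D_L2])

lemma th_measurable: "th \<in> borel_measurable mT"
  by (rule L2_measurable[OF th_L2])

lemma L2_th_mult: "L2 mT h \<Longrightarrow> L2 mT (\<lambda>z. th z * h z)"
  by (rule L2_scale_bounded[OF _ th_measurable th_bounded])

lemma L2_D_mult: "L2 mT h \<Longrightarrow> L2 mT (\<lambda>z. D z * h z)"
  by (rule L2_scale_bounded[OF _ D_measurable D_bounded])

text \<open>(th, D) is the image of the constant 1 under the isometry h \<mapsto> (th h, D h), so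
  this is the inner product of 1 with h.\<close>

lemma ip2_th_D:
  assumes h: "h \<in> H2"
  shows "ip2 (th, D) ((\<lambda>z. th z * h z), (\<lambda>z. D z * h z)) = cnj (\<integral>z. h z \<partial>mT)"
proof -
  have "ip2 (th, D) ((\<lambda>z. th z * h z), (\<lambda>z. D z * h z)) = (\<integral>z. cnj (h z) \<partial>mT)"
    unfolding ip2_def
  proof (rule integral_mT_cong)
    show "(\<lambda>z. fst (th, D) z * cnj (fst ((\<lambda>z. th z * h z), (\<lambda>z. D z * h z)) z)
        + snd (th, D) z * cnj (snd ((\<lambda>z. th z * h z), (\<lambda>z. D z * h z)) z)) \<in> borel_measurable mT"
      unfolding fst_conv snd_conv
      by (intro borel_measurable_add borel_measurable_integrable ip_integrable th_L2 D_L2 L2_th_mult L2_D_mult H2_L2[OF h])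
    show "AE z in mT. fst (th, D) z * cnj (fst ((\<lambda>z. th z * h z), (\<lambda>z. D z * h z)) z)
        + snd (th, D) z * cnj (snd ((\<lambda>z. th z * h z), (\<lambda>z. D z * h z)) z) = cnj (h z)"
      using th_D_unit
    proof eventually_elim
      case (elim z)
      have "th z * cnj (th z * h z) + D z * cnj (D z * h z) = (th z * cnj (th z) + D z * cnj (D z)) * cnj (h z)"
        by (simp add: algebra_simps)
      then show ?case using elim by simp
    qed
  qed
  also have "\<dots> = cnj (\<integral>z. h z \<partial>mT)" by (rule Bochner_Integration.integral_cnj)
  finally show ?thesis .
qed

text \<open>Write h = z h' + c with h' in H2. The part z h' pairs to 0, since multiplication by z is
  unitary and \<open>Phi f\<close> is orthogonal to (th h', D h'). For the constant part, (th, D)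
  equals z s \<open>Phi cnj\<close> minus (\<gamma>, 0), and this correction disappears because z
  times the first component of \<open>Phi f\<close> has mean 0.\<close>

lemma ip2_mult_z_th_D:
  assumes f: "L2 \<mu> f" and h: "h \<in> H2"
  shows "ip2 (mult_z (Phi f)) ((\<lambda>z. th z * h z), (\<lambda>z. D z * h z)) = s * ip \<mu> f cnj * cnj (\<integral>z. h z \<partial>mT)"
proof -
  let ?u1 = "fst (Phi f)" and ?u2 = "snd (Phi f)" and ?c = "\<integral>z. h z \<partial>mT"
  define h' where "h' z = cnj z * (h z - ?c)" for z
  have h': "h' \<in> H2" unfolding h'_def by (rule H2_shift[OF h])
  note u = Phi_L2[OF f] and hL = H2_L2[OF h] and hL' = H2_L2[OF h'] and c = Phi_L2[OF L2_mu_cnj]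
  have 0: "ip2 (Phi f) ((\<lambda>z. th z * h' z), (\<lambda>z. D z * h' z)) = 0"
    using PhiK[OF f] h' by (simp add: model_space_def)
  have zu0: "(\<integral>z. z * ?u1 z \<partial>mT) = 0"
    by (rule H2_integral_mult_z[OF Phi_H2[OF f]])
  define A where "A z = ?u1 z * cnj (th z * h' z) + ?u2 z * cnj (D z * h' z)" for z
  define B where "B z = ?u1 z * cnj (fst (Phi cnj) z) + ?u2 z * cnj (snd (Phi cnj) z)" for z
  have iA: "integrable mT A" unfolding A_def
    by (intro Bochner_Integration.integrable_add ip_integrable u L2_th_mult L2_D_mult hL')
  have iB: "integrable mT B" unfolding B_def
    by (intro Bochner_Integration.integrable_add ip_integrable u c)
  have iz: "integrable mT (\<lambda>z. z * ?u1 z)"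
    by (rule mT.L2_integrable[OF L2_mT_monom(1)[OF u(1)]])
  have "ip2 (mult_z (Phi f)) ((\<lambda>z. th z * h z), (\<lambda>z. D z * h z))
      = (\<integral>z. A z + cnj ?c * (s * B z - cnj \<gamma> * (z * ?u1 z)) \<partial>mT)"
    unfolding ip2_def mult_z_def fst_conv snd_conv
  proof (rule integral_mT_cong)
    show "(\<lambda>z. z * ?u1 z * cnj (th z * h z) + z * ?u2 z * cnj (D z * h z)) \<in> borel_measurable mT"
      by (intro borel_measurable_add borel_measurable_integrable ip_integrable L2_mT_monom u L2_th_mult L2_D_mult hL)
    show "AE z in mT. z * ?u1 z * cnj (th z * h z) + z * ?u2 z * cnj (D z * h z)
        = A z + cnj ?c * (s * B z - cnj \<gamma> * (z * ?u1 z))"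
      using AE_mT_norm Phi_cnj
    proof eventually_elim
      case (elim z)
      have zz: "z * cnj z = 1" by (rule unit_cnj[OF elim(1)])
      have h: "cnj (h z) = cnj z * cnj (h' z) + cnj ?c"
      proof -
        have "z * h' z = z * cnj z * (h z - ?c)" by (simp add: h'_def)
        then have "h z = z * h' z + ?c" using zz by simp
        then have "cnj (h z) = cnj (z * h' z + ?c)" by (rule arg_cong)
        then show ?thesis by (simp only: complex_cnj_add complex_cnj_mult)
      qed
      have c1: "cnj (s * fst (Phi cnj) z) = cnj (cnj z * (th z + \<gamma>))" "cnj (s * snd (Phi cnj) z) = cnj (cnj z * D z)"
        using elim(2) by simp_all
      have "s * B z = ?u1 z * cnj (s * fst (Phi cnj) z) + ?u2 z * cnj (s * snd (Phi cnj) z)"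
        unfolding B_def complex_cnj_mult cnj_s by (simp add: algebra_simps)
      also have "\<dots> = z * (?u1 z * (cnj (th z) + cnj \<gamma>) + ?u2 z * cnj (D z))"
        unfolding c1 by (simp add: algebra_simps)
      finally have sB: "s * B z = z * (?u1 z * (cnj (th z) + cnj \<gamma>) + ?u2 z * cnj (D z))" .
      have "z * ?u1 z * cnj (th z * h z) + z * ?u2 z * cnj (D z * h z)
        = z * (?u1 z * cnj (th z) + ?u2 z * cnj (D z)) * cnj (h z)"
        by (simp add: algebra_simps)
      also have "\<dots> = (z * cnj z) * (?u1 z * cnj (th z) + ?u2 z * cnj (D z)) * cnj (h' z)
          + z * (?u1 z * cnj (th z) + ?u2 z * cnj (D z)) * cnj ?c"
        unfolding h by (simp add: algebra_simps)
      also have "\<dots> = A z + cnj ?c * (s * B z - cnj \<gamma> * (z * ?u1 z))"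
        unfolding zz sB A_def by (simp add: algebra_simps)
      finally show ?case .
    qed
  qed
  also have "\<dots> = (\<integral>z. A z \<partial>mT) + cnj ?c * (s * (\<integral>z. B z \<partial>mT) - cnj \<gamma> * (\<integral>z. z * ?u1 z \<partial>mT))"
    using iA iB iz by simp
  also have "\<dots> = ip2 (Phi f) ((\<lambda>z. th z * h' z), (\<lambda>z. D z * h' z)) + cnj ?c * (s * ip2 (Phi f) (Phi cnj))"
    unfolding zu0 by (simp add: A_def B_def ip2_def)
  also have "\<dots> = s * ip \<mu> f cnj * cnj ?c"
    using 0 by (simp add: Phi_ip f L2_mu_cnj)
  finally show ?thesis .
qed

text \<open>The vector \<open>e\<close> is the claimed image minus the actual one. The two preceding
  inner products cancel, so \<open>e\<close> lies in the model space; and it is orthogonal to that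
  space, because both the projection error and (th, D) are. Hence its norm is 0.\<close>

lemma Phi_U:
  assumes f: "L2 \<mu> f"
  shows "AE z in mT. fst (Phi (U_gamma \<gamma> \<mu> f)) z = z * fst (Phi f) z - s * ip \<mu> f cnj * th z
    \<and> snd (Phi (U_gamma \<gamma> \<mu> f)) z = z * snd (Phi f) z - s * ip \<mu> f cnj * D z"
proof -
  let ?k = "s * ip \<mu> f cnj" and ?w = "Phi (U_gamma \<gamma> \<mu> f)" and ?u = "mult_z (Phi f)"
  have proj: "?w \<in> K" "\<And>v. v \<in> K \<Longrightarrow> ip2 (vdiff ?u ?w) v = 0"
    using Phi_model[OF f] unfolding model_op_def is_proj_def by auto
  \<comment> \<open>The factors 1 and -1 fit the two-coefficient shape of \<open>H2_lin\<close> and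
    \<open>closDL2_lin\<close>.\<close>
  define e where "e = ((\<lambda>z. 1 * (1 * (z * fst (Phi f) z) + (- ?k) * th z) + (- 1) * fst ?w z),
      (\<lambda>z. 1 * (1 * (z * snd (Phi f) z) + (- ?k) * D z) + (- 1) * snd ?w z))"
  have u: "fst ?u \<in> H2" "snd ?u \<in> closDL2 D"
    unfolding mult_z_def fst_conv snd_conv
    by (intro H2_mult_z Phi_H2 closDL2_mult_z Phi_clos f D_measurable D_bounded)+
  have w: "fst ?w \<in> H2" "snd ?w \<in> closDL2 D"
    using proj(1) by (auto simp: model_space_def)
  have e1: "fst e \<in> H2" unfolding e_def fst_conv
    by (intro H2_lin H2_mult_z Phi_H2 f th_H2 w)
  have e2: "snd e \<in> closDL2 D" unfolding e_def snd_conv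
    by (intro closDL2_lin closDL2_mult_z Phi_clos f closDL2_self D_L2 w D_measurable D_bounded)
  note L = H2_L2[OF u(1)] closDL2_L2[OF u(2)] H2_L2[OF w(1)] closDL2_L2[OF w(2)]
  have expand: "ip2 e v = ip2 (vdiff ?u ?w) v - ?k * ip2 (th, D) v"
    if v: "L2 mT (fst v)" "L2 mT (snd v)" for v
  proof -
    have "ip2 e v = ip mT (fst e) (fst v) + ip mT (snd e) (snd v)"
      by (intro ip2_eq H2_L2[OF e1] closDL2_L2[OF e2] v)
    moreover have "fst e = (\<lambda>z. 1 * (fst (vdiff ?u ?w)) z + (- ?k) * th z)"
      "snd e = (\<lambda>z. 1 * (snd (vdiff ?u ?w)) z + (- ?k) * D z)"
      unfolding e_def vdiff_def mult_z_def by (auto simp: algebra_simps)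
    moreover have Ld: "L2 mT (fst (vdiff ?u ?w))" "L2 mT (snd (vdiff ?u ?w))"
      unfolding vdiff_def fst_conv snd_conv by (intro L2_diff L)+
    moreover have "ip2 (vdiff ?u ?w) v = ip mT (fst (vdiff ?u ?w)) (fst v) + ip mT (snd (vdiff ?u ?w)) (snd v)"
      by (intro ip2_eq Ld v)
    moreover have "ip2 (th, D) v = ip mT th (fst v) + ip mT D (snd v)"
      by (subst ip2_eq) (simp_all add: th_L2 D_L2 v)
    ultimately show ?thesis
      by (simp only: ip_lin_left th_L2 D_L2 v) (simp add: algebra_simps)
  qed
  have "e \<in> K"
    unfolding model_space_def
  proof (intro CollectI conjI e1 e2 ballI)
    fix h assume h: "h \<in> H2"
    let ?Y = "((\<lambda>z. th z * h z), (\<lambda>z. D z * h z))"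
    have Y: "L2 mT (fst ?Y)" "L2 mT (snd ?Y)"
      unfolding fst_conv snd_conv by (intro L2_th_mult L2_D_mult H2_L2[OF h])+
    have "ip2 (vdiff ?u ?w) ?Y = ip2 ?u ?Y - ip2 ?w ?Y"
    proof -
      have d: "fst (vdiff ?u ?w) = (\<lambda>z. 1 * fst ?u z + (- 1) * fst ?w z)"
        "snd (vdiff ?u ?w) = (\<lambda>z. 1 * snd ?u z + (- 1) * snd ?w z)"
        unfolding vdiff_def by auto
      have Ld: "L2 mT (fst (vdiff ?u ?w))" "L2 mT (snd (vdiff ?u ?w))"
        unfolding vdiff_def fst_conv snd_conv by (intro L2_diff L)+
      show ?thesis
        unfolding ip2_eq[OF Ld(1) Y(1) Ld(2) Y(2)] ip2_eq[OF L(1) Y(1) L(2) Y(2)] ip2_eq[OF L(3) Y(1) L(4) Y(2)] d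
        unfolding ip_lin_left[OF L(1) L(3) Y(1)] ip_lin_left[OF L(2) L(4) Y(2)] by (simp add: algebra_simps)
    qed
    moreover have "ip2 ?w ?Y = 0" using proj(1) h by (simp add: model_space_def)
    ultimately show "ip2 e ?Y = 0"
      unfolding expand[OF Y] using ip2_mult_z_th_D[OF f h] ip2_th_D[OF h] by simp
  qed
  \<comment> \<open>The orthogonality condition of the model space at h = 1, conjugated.\<close>
  moreover have "ip2 (th, D) v = 0" if "v \<in> K" for v
  proof -
    have v: "L2 mT (fst v)" "L2 mT (snd v)"
      using that by (auto simp: model_space_def intro: H2_L2 closDL2_L2)
    have "\<forall>h\<in>H2. ip2 v ((\<lambda>z. th z * h z), (\<lambda>z. D z * h z)) = 0"
      using that by (simp add: model_space_def)
    from bspec[OF this const_H2[of 1]] have "cnj (ip2 v (th, D)) = 0" by simp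
    moreover have "cnj (ip2 v (th, D)) = ip2 (th, D) v"
      unfolding ip2_def Bochner_Integration.integral_cnj[symmetric] by (simp add: mult.commute)
    ultimately show ?thesis by simp
  qed
  ultimately have "ip2 e e = 0"
    using expand[OF H2_L2[OF e1] closDL2_L2[OF e2]] proj(2) by simp
  from ip2_self_eq_0[OF H2_L2[OF e1] closDL2_L2[OF e2] this]
  show ?thesis
    by eventually_elim (simp add: e_def algebra_simps)
qed

text \<open>Undoes the rank-one perturbation in \<open>U_gamma\<close>, the image of 1 being known:
  -s^2 th and (1 - \<gamma>)(1 + cnj \<gamma> th) add up to W, and the D terms combine
  likewise.\<close>

lemma Phi_shift:
  assumes f: "L2 \<mu> f"
  shows "AE z in mT. s * fst (Phi (\<lambda>\<xi>. \<xi> * f \<xi>)) z = z * (s * fst (Phi f) z) + ip \<mu> f cnj * W z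
    \<and> s * snd (Phi (\<lambda>\<xi>. \<xi> * f \<xi>)) z = z * (s * snd (Phi f) z) - ip \<mu> f cnj * ((1 - cnj \<gamma>) * D z)"
proof -
  let ?m = "ip \<mu> f cnj"
  have U: "U_gamma \<gamma> \<mu> f = (\<lambda>\<xi>. 1 * (\<xi> * f \<xi>) + ((\<gamma> - 1) * ?m) * 1)"
    unfolding U_gamma_def by simp
  show ?thesis
    using Phi_U[OF f] Phi_lin[OF L2_xi[OF f] L2_one, of 1 "(\<gamma> - 1) * ?m", folded U] Phi_one
  proof eventually_elim
    case (elim z)
    have 1: "fst (Phi (\<lambda>\<xi>. \<xi> * f \<xi>)) z = z * fst (Phi f) z - s * ?m * th z - (\<gamma> - 1) * ?m * fst (Phi (\<lambda>_. 1)) z"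
      "snd (Phi (\<lambda>\<xi>. \<xi> * f \<xi>)) z = z * snd (Phi f) z - s * ?m * D z - (\<gamma> - 1) * ?m * snd (Phi (\<lambda>_. 1)) z"
      using elim(1,2) by (auto simp: algebra_simps)
    have "s * fst (Phi (\<lambda>\<xi>. \<xi> * f \<xi>)) z
        = z * (s * fst (Phi f) z) - (s * s) * ?m * th z - (\<gamma> - 1) * ?m * (s * fst (Phi (\<lambda>_. 1)) z)"
      "s * snd (Phi (\<lambda>\<xi>. \<xi> * f \<xi>)) z
        = z * (s * snd (Phi f) z) - (s * s) * ?m * D z - (\<gamma> - 1) * ?m * (s * snd (Phi (\<lambda>_. 1)) z)"
      unfolding 1 by (simp_all add: algebra_simps)
    then show ?case
      unfolding s_s conjunct1[OF elim(3)] conjunct2[OF elim(3)] W_def by (simp add: algebra_simps)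
  qed
qed

subsection \<open>The second component\<close>

text \<open>The determinant with rows (W, -(1 - cnj \<gamma>) D) and \<open>Phi f\<close>; hence it
  vanishes on multiples of the rank-one vector.\<close>

definition Psi :: "(complex \<Rightarrow> complex) \<Rightarrow> complex \<Rightarrow> complex" where
  "Psi f z = W z * snd (Phi f) z + (1 - cnj \<gamma>) * D z * fst (Phi f) z"

lemma Psi_lin:
  assumes "L2 \<mu> f" "L2 \<mu> g"
  shows "AE z in mT. Psi (\<lambda>\<xi>. a * f \<xi> + b * g \<xi>) z = a * Psi f z + b * Psi g z"
  using Phi_lin[OF assms, of a b] by eventually_elim (simp add: Psi_def algebra_simps)

lemma Phi_diff_norm:
  assumes "L2 \<mu> f" "L2 \<mu> g"
  shows "integrable mT (\<lambda>z. (cmod (fst (Phi f) z - fst (Phi g) z))\<^sup>2 + (cmod (snd (Phi f) z - snd (Phi g) z))\<^sup>2)"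
    and "(\<integral>z. (cmod (fst (Phi f) z - fst (Phi g) z))\<^sup>2 + (cmod (snd (Phi f) z - snd (Phi g) z))\<^sup>2 \<partial>mT)
      = (\<integral>\<xi>. (cmod (f \<xi> - g \<xi>))\<^sup>2 \<partial>\<mu>)"
proof -
  let ?d = "\<lambda>\<xi>. 1 * f \<xi> + (- 1) * g \<xi>"
  have d: "L2 \<mu> ?d" by (rule L2_lin[OF assms])
  note Ld = Phi_L2[OF d]
  have L: "L2 mT (\<lambda>z. fst (Phi f) z - fst (Phi g) z)" "L2 mT (\<lambda>z. snd (Phi f) z - snd (Phi g) z)"
    by (intro L2_diff Phi_L2 assms)+
  show i: "integrable mT (\<lambda>z. (cmod (fst (Phi f) z - fst (Phi g) z))\<^sup>2 + (cmod (snd (Phi f) z - snd (Phi g) z))\<^sup>2)"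
    using L by (simp add: L2_def)
  have "complex_of_real (\<integral>\<xi>. (cmod (?d \<xi>))\<^sup>2 \<partial>\<mu>) = ip2 (Phi ?d) (Phi ?d)"
    by (simp only: Phi_ip d ip_self)
  also have "\<dots> = of_real ((\<integral>z. (cmod (fst (Phi ?d) z))\<^sup>2 \<partial>mT) + (\<integral>z. (cmod (snd (Phi ?d) z))\<^sup>2 \<partial>mT))"
    by (simp only: ip2_eq Ld ip_self of_real_add)
  finally have "(\<integral>\<xi>. (cmod (?d \<xi>))\<^sup>2 \<partial>\<mu>) = (\<integral>z. (cmod (fst (Phi ?d) z))\<^sup>2 \<partial>mT) + (\<integral>z. (cmod (snd (Phi ?d) z))\<^sup>2 \<partial>mT)"
    by (simp only: of_real_eq_iff)
  also have "\<dots> = (\<integral>z. (cmod (fst (Phi ?d) z))\<^sup>2 + (cmod (snd (Phi ?d) z))\<^sup>2 \<partial>mT)"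
    using Ld by (intro Bochner_Integration.integral_add[symmetric]) (simp_all add: L2_def)
  also have "\<dots> = (\<integral>z. (cmod (fst (Phi f) z - fst (Phi g) z))\<^sup>2 + (cmod (snd (Phi f) z - snd (Phi g) z))\<^sup>2 \<partial>mT)"
  proof (rule integral_mT_cong)
    show "(\<lambda>z. (cmod (fst (Phi ?d) z))\<^sup>2 + (cmod (snd (Phi ?d) z))\<^sup>2) \<in> borel_measurable mT"
      using Ld unfolding L2_def by (intro borel_measurable_add) (blast intro: borel_measurable_integrable)+
    show "AE z in mT. (cmod (fst (Phi ?d) z))\<^sup>2 + (cmod (snd (Phi ?d) z))\<^sup>2
        = (cmod (fst (Phi f) z - fst (Phi g) z))\<^sup>2 + (cmod (snd (Phi f) z - snd (Phi g) z))\<^sup>2"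
      using Phi_lin[OF assms, of 1 "-1"] by eventually_elim simp
  qed
  finally show "(\<integral>z. (cmod (fst (Phi f) z - fst (Phi g) z))\<^sup>2 + (cmod (snd (Phi f) z - snd (Phi g) z))\<^sup>2 \<partial>mT)
      = (\<integral>\<xi>. (cmod (f \<xi> - g \<xi>))\<^sup>2 \<partial>\<mu>)" by simp
qed

text \<open>The isometry transports L2(\<mu>) convergence to both components; a subsequence then
  converges almost everywhere, which is enough to identify limits.\<close>

lemma Phi_limit:
  assumes f: "\<And>n::nat. L2 \<mu> (f n)" and g: "L2 \<mu> g"
    and lim: "(\<lambda>n. \<integral>\<xi>. (cmod (f n \<xi> - g \<xi>))\<^sup>2 \<partial>\<mu>) \<longlonglongrightarrow> 0"
  obtains r :: "nat \<Rightarrow> nat" where "strict_mono r"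
    "AE z in mT. (\<lambda>n. fst (Phi (f (r n))) z) \<longlonglongrightarrow> fst (Phi g) z \<and> (\<lambda>n. snd (Phi (f (r n))) z) \<longlonglongrightarrow> snd (Phi g) z"
proof -
  let ?q = "\<lambda>n z. (cmod (fst (Phi (f n)) z - fst (Phi g) z))\<^sup>2 + (cmod (snd (Phi (f n)) z - snd (Phi g) z))\<^sup>2"
  have "(\<lambda>n. \<integral>z. norm (?q n z) \<partial>mT) \<longlonglongrightarrow> 0"
    using lim by (simp add: Phi_diff_norm(2)[OF f g])
  from tendsto_L1_AE_subseq[of mT ?q, OF Phi_diff_norm(1)[OF f g] this]
  obtain r where r: "strict_mono r" "AE z in mT. (\<lambda>n. ?q (r n) z) \<longlonglongrightarrow> 0" by blast
  have sq: "x \<longlonglongrightarrow> a" if "(\<lambda>n. (cmod (x n - a))\<^sup>2 + b n) \<longlonglongrightarrow> 0" "\<And>n. 0 \<le> b n" for x :: "nat \<Rightarrow> complex" and a b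
  proof -
    have "(\<lambda>n. (cmod (x n - a))\<^sup>2) \<longlonglongrightarrow> 0"
      by (rule tendsto_sandwich[OF _ _ tendsto_const that(1)]) (auto simp: that(2))
    then have "(\<lambda>n. sqrt ((cmod (x n - a))\<^sup>2)) \<longlonglongrightarrow> sqrt 0" by (rule tendsto_real_sqrt)
    then show ?thesis by (simp add: tendsto_norm_zero_iff LIM_zero_iff)
  qed
  from r(2) have "AE z in mT. (\<lambda>n. fst (Phi (f (r n))) z) \<longlonglongrightarrow> fst (Phi g) z \<and> (\<lambda>n. snd (Phi (f (r n))) z) \<longlonglongrightarrow> snd (Phi g) z"
  proof eventually_elim
    case (elim z)
    from elim have "(\<lambda>n. (cmod (snd (Phi (f (r n))) z - snd (Phi g) z))\<^sup>2 + (cmod (fst (Phi (f (r n))) z - fst (Phi g) z))\<^sup>2) \<longlonglongrightarrow> 0"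
      by (simp add: add.commute)
    from sq[OF this] sq[OF elim] show ?case by simp
  qed
  with r(1) show ?thesis by (rule that)
qed

lemma Psi_limit:
  assumes f: "\<And>n::nat. L2 \<mu> (f n)" and g: "L2 \<mu> g"
    and lim: "(\<lambda>n. \<integral>\<xi>. (cmod (f n \<xi> - g \<xi>))\<^sup>2 \<partial>\<mu>) \<longlonglongrightarrow> 0"
  obtains r :: "nat \<Rightarrow> nat" where "strict_mono r" "AE z in mT. (\<lambda>n. Psi (f (r n)) z) \<longlonglongrightarrow> Psi g z"
proof (rule Phi_limit[OF assms])
  fix r :: "nat \<Rightarrow> nat"
  assume r: "strict_mono r" and
    "AE z in mT. (\<lambda>n. fst (Phi (f (r n))) z) \<longlonglongrightarrow> fst (Phi g) z \<and> (\<lambda>n. snd (Phi (f (r n))) z) \<longlonglongrightarrow> snd (Phi g) z"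
  from this(2) have "AE z in mT. (\<lambda>n. Psi (f (r n)) z) \<longlonglongrightarrow> Psi g z"
    by eventually_elim (auto simp: Psi_def intro!: tendsto_intros)
  with r show ?thesis by (rule that)
qed

text \<open>\<open>Phi\<close> is a map on functions, not on classes. That it respects \<mu>-a.e.
  equality follows from the isometry, applied to a constant sequence.\<close>

lemma Phi_AE:
  assumes f: "L2 \<mu> f" and g: "L2 \<mu> g" and eq: "AE \<xi> in \<mu>. f \<xi> = g \<xi>"
  shows "AE z in mT. fst (Phi f) z = fst (Phi g) z \<and> snd (Phi f) z = snd (Phi g) z"
proof -
  have "(\<integral>\<xi>. (cmod (f \<xi> - g \<xi>))\<^sup>2 \<partial>\<mu>) = 0"
    by (rule integral_eq_zero_AE) (use eq in eventually_elim, simp)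
  then have "(\<lambda>n::nat. \<integral>\<xi>. (cmod (f \<xi> - g \<xi>))\<^sup>2 \<partial>\<mu>) \<longlonglongrightarrow> 0" by simp
  from Phi_limit[of "\<lambda>_. f", OF f g this]
  have "AE z in mT. (\<lambda>n::nat. fst (Phi f) z) \<longlonglongrightarrow> fst (Phi g) z \<and> (\<lambda>n::nat. snd (Phi f) z) \<longlonglongrightarrow> snd (Phi g) z"
    by blast
  then show ?thesis by eventually_elim (simp add: LIMSEQ_const_iff)
qed

lemma Psi_AE:
  assumes "L2 \<mu> f" "L2 \<mu> g" "AE \<xi> in \<mu>. f \<xi> = g \<xi>"
  shows "AE z in mT. Psi f z = Psi g z"
  using Phi_AE[OF assms] by eventually_elim (simp add: Psi_def)

lemma Psi_shift:
  assumes f: "L2 \<mu> f"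
  shows "AE z in mT. Psi (\<lambda>\<xi>. \<xi> * f \<xi>) z = z * Psi f z"
  using Phi_shift[OF f]
proof eventually_elim
  case (elim z)
  have "s * Psi (\<lambda>\<xi>. \<xi> * f \<xi>) z
      = W z * (s * snd (Phi (\<lambda>\<xi>. \<xi> * f \<xi>)) z) + (1 - cnj \<gamma>) * D z * (s * fst (Phi (\<lambda>\<xi>. \<xi> * f \<xi>)) z)"
    by (simp add: Psi_def algebra_simps)
  also have "\<dots> = s * (z * Psi f z)"
    unfolding conjunct1[OF elim] conjunct2[OF elim] by (simp add: Psi_def algebra_simps)
  finally show ?case using s_nonzero by simp
qed

lemma Psi_cnj_shift:
  assumes f: "L2 \<mu> f"
  shows "AE z in mT. Psi (\<lambda>\<xi>. cnj \<xi> * f \<xi>) z = cnj z * Psi f z"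
proof -
  have "AE \<xi> in \<mu>. \<xi> * (cnj \<xi> * f \<xi>) = f \<xi>"
    using AE_norm by eventually_elim (simp add: unit_cnj flip: mult.assoc)
  from Psi_AE[OF L2_xi[OF L2_cnj_xi[OF f]] f this] Psi_shift[OF L2_cnj_xi[OF f]] AE_mT_norm
  show ?thesis
  proof eventually_elim
    case (elim z)
    have "cnj z * Psi f z = (cnj z * z) * Psi (\<lambda>\<xi>. cnj \<xi> * f \<xi>) z"
      using elim(1,2) by (simp add: mult.assoc)
    then show ?case using unit_cnj(2)[OF elim(3)] by simp
  qed
qed

text \<open>In W cnj \<gamma> + (1 - cnj \<gamma>)(1 + cnj \<gamma> th) the terms with th cancel,
  and s^2 remains.\<close>

lemma Psi_one: "AE z in mT. Psi (\<lambda>_. 1) z = s * D z"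
  using Phi_one
proof eventually_elim
  case (elim z)
  have "s * Psi (\<lambda>_. 1) z = W z * (s * snd (Phi (\<lambda>_. 1)) z) + (1 - cnj \<gamma>) * D z * (s * fst (Phi (\<lambda>_. 1)) z)"
    by (simp add: Psi_def algebra_simps)
  also have "\<dots> = (s * s) * D z"
    unfolding conjunct1[OF elim] conjunct2[OF elim] s_s by (simp add: W_def algebra_simps)
  finally show ?case using s_nonzero by (simp add: mult.assoc)
qed

text \<open>The same g acts \<mu>-almost everywhere on the left and Lebesgue-almost everywhere on
  the right. Quantifying over all f gives closure under products; the bound is asked on the circle
  only, so that polynomials qualify.\<close>

definition Psi_multiplier :: "(complex \<Rightarrow> real) \<Rightarrow> bool" where
  "Psi_multiplier g \<longleftrightarrow> g \<in> borel_measurable borel \<and> bounded (g ` sphere 0 1) \<and>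
    (\<forall>f. L2 \<mu> f \<longrightarrow> (AE z in mT. Psi (\<lambda>\<xi>. of_real (g \<xi>) * f \<xi>) z = of_real (g z) * Psi f z))"

lemma bounded_sphere:
  fixes g :: "complex \<Rightarrow> real"
  assumes "bounded (g ` sphere 0 1)"
  shows "\<exists>C. \<forall>x. cmod x = 1 \<longrightarrow> \<bar>g x\<bar> \<le> C"
  using assms unfolding bounded_iff by fastforce

lemma Psi_multiplierD:
  assumes "Psi_multiplier g"
  shows "g \<in> borel_measurable borel" "bounded (g ` sphere 0 1)"
    "L2 \<mu> f \<Longrightarrow> AE z in mT. Psi (\<lambda>\<xi>. of_real (g \<xi>) * f \<xi>) z = of_real (g z) * Psi f z"
  using assms unfolding Psi_multiplier_def by blast+

lemma L2_multiplier:
  assumes f: "L2 \<mu> f" and g: "g \<in> borel_measurable borel" "bounded (g ` sphere 0 1)"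
  shows "L2 \<mu> (\<lambda>\<xi>. of_real (g \<xi>) * f \<xi>)"
proof -
  obtain C where "\<And>x. cmod x = 1 \<Longrightarrow> \<bar>g x\<bar> \<le> C"
    using bounded_sphere[OF g(2)] by blast
  then show ?thesis using g(1) by (intro L2_scale[OF f, where C=C]) auto
qed

lemma Psi_multiplier_lin:
  assumes p: "Psi_multiplier p" and q: "Psi_multiplier q"
  shows "Psi_multiplier (\<lambda>x. a * p x + b * q x)"
  unfolding Psi_multiplier_def
proof (intro conjI allI impI)
  obtain A where A: "\<And>x. cmod x = 1 \<Longrightarrow> \<bar>p x\<bar> \<le> A"
    using bounded_sphere[OF Psi_multiplierD(2)[OF p]] by blast
  obtain B where B: "\<And>x. cmod x = 1 \<Longrightarrow> \<bar>q x\<bar> \<le> B"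
    using bounded_sphere[OF Psi_multiplierD(2)[OF q]] by blast
  have "\<bar>a * p x + b * q x\<bar> \<le> \<bar>a\<bar> * A + \<bar>b\<bar> * B" if "cmod x = 1" for x
    using mult_left_mono[OF A[OF that], of "\<bar>a\<bar>"] mult_left_mono[OF B[OF that], of "\<bar>b\<bar>"]
      abs_triangle_ineq[of "a * p x" "b * q x"] by (simp add: abs_mult)
  then show "bounded ((\<lambda>x. a * p x + b * q x) ` sphere 0 1)"
    by (intro boundedI[of _ "\<bar>a\<bar> * A + \<bar>b\<bar> * B"]) auto
  show "(\<lambda>x. a * p x + b * q x) \<in> borel_measurable borel"
    by (intro borel_measurable_add borel_measurable_times borel_measurable_const Psi_multiplierD(1) p q)
  fix f assume f: "L2 \<mu> f"
  have eq: "(\<lambda>\<xi>. of_real (a * p \<xi> + b * q \<xi>) * f \<xi>)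
      = (\<lambda>\<xi>. of_real a * (of_real (p \<xi>) * f \<xi>) + of_real b * (of_real (q \<xi>) * f \<xi>))"
    by (auto simp: algebra_simps)
  have L: "L2 \<mu> (\<lambda>\<xi>. of_real (p \<xi>) * f \<xi>)" "L2 \<mu> (\<lambda>\<xi>. of_real (q \<xi>) * f \<xi>)"
    by (intro L2_multiplier[OF f] Psi_multiplierD(1,2) p q)+
  show "AE z in mT. Psi (\<lambda>\<xi>. of_real (a * p \<xi> + b * q \<xi>) * f \<xi>) z = of_real (a * p z + b * q z) * Psi f z"
    unfolding eq
    using Psi_lin[OF L, of "of_real a" "of_real b"] Psi_multiplierD(3)[OF p f] Psi_multiplierD(3)[OF q f]
    by eventually_elim (simp add: algebra_simps)
qed

lemma Psi_multiplier_polynomial: "real_polynomial_function p \<Longrightarrow> Psi_multiplier p"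
proof (induction p rule: real_polynomial_function.induct)
  case (linear g)
  \<comment> \<open>A real-linear g on the plane is x \<mapsto> 2 Re (a x) for this a, hence a
    combination of x and \<open>cnj x\<close>.\<close>
  let ?a = "Complex (g 1 / 2) (- g \<i> / 2)"
  have g: "of_real (g x) = ?a * x + cnj ?a * cnj x" for x
  proof -
    have lin: "linear g" using linear by (rule bounded_linear.linear)
    have "x = Re x *\<^sub>R 1 + Im x *\<^sub>R \<i>" by (simp add: complex_eq_iff)
    then have "g x = g (Re x *\<^sub>R 1 + Im x *\<^sub>R \<i>)" by (rule arg_cong)
    also have "\<dots> = Re x * g 1 + Im x * g \<i>"
      by (simp only: linear_add[OF lin] linear_scale[OF lin] real_scaleR_def)
    finally have "g x = Re x * g 1 + Im x * g \<i>" .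
    then show ?thesis by (simp add: complex_eq_iff)
  qed
  have cont: "continuous_on UNIV g"
    using linear by (rule linear_continuous_on)
  show ?case
    unfolding Psi_multiplier_def
  proof (intro conjI allI impI)
    show "g \<in> borel_measurable borel" by (rule borel_measurable_continuous_onI[OF cont])
    show "bounded (g ` sphere 0 1)"
      by (intro compact_imp_bounded compact_continuous_image continuous_on_subset[OF cont]) auto
    fix f assume f: "L2 \<mu> f"
    have eq: "(\<lambda>\<xi>. of_real (g \<xi>) * f \<xi>) = (\<lambda>\<xi>. ?a * (\<xi> * f \<xi>) + cnj ?a * (cnj \<xi> * f \<xi>))"
      unfolding g by (auto simp: algebra_simps)
    show "AE z in mT. Psi (\<lambda>\<xi>. of_real (g \<xi>) * f \<xi>) z = of_real (g z) * Psi f z"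
      unfolding eq unfolding g
      using Psi_lin[OF L2_xi[OF f] L2_cnj_xi[OF f], of ?a "cnj ?a"] Psi_shift[OF f] Psi_cnj_shift[OF f]
      by eventually_elim (simp add: algebra_simps)
  qed
next
  case (const c)
  show ?case
    unfolding Psi_multiplier_def
  proof (intro conjI allI impI)
    show "bounded ((\<lambda>x. c) ` sphere 0 1)" by (rule boundedI[of _ "\<bar>c\<bar>"]) auto
    fix f assume f: "L2 \<mu> f"
    show "AE z in mT. Psi (\<lambda>\<xi>. of_real c * f \<xi>) z = of_real c * Psi f z"
      using Psi_lin[OF f f, of "of_real c" 0] by simp
  qed simp
next
  case (add p q)
  from Psi_multiplier_lin[OF add.IH, of 1 1] show ?case by simp
next
  case (mult p q)
  show ?case
    unfolding Psi_multiplier_def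
  proof (intro conjI allI impI)
    obtain A where A: "\<And>x. cmod x = 1 \<Longrightarrow> \<bar>p x\<bar> \<le> A"
      using bounded_sphere[OF Psi_multiplierD(2)[OF mult.IH(1)]] by blast
    obtain B where B: "\<And>x. cmod x = 1 \<Longrightarrow> \<bar>q x\<bar> \<le> B"
      using bounded_sphere[OF Psi_multiplierD(2)[OF mult.IH(2)]] by blast
    have "\<bar>p x * q x\<bar> \<le> A * B" if "cmod x = 1" for x
      unfolding abs_mult using A[OF that] B[OF that] by (intro mult_mono) auto
    then show "bounded ((\<lambda>x. p x * q x) ` sphere 0 1)"
      by (intro boundedI[of _ "A * B"]) auto
    show "(\<lambda>x. p x * q x) \<in> borel_measurable borel"
      by (intro borel_measurable_times Psi_multiplierD(1) mult.IH)
    fix f assume f: "L2 \<mu> f"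
    \<comment> \<open>The multiplier \<open>p\<close> is applied to q f, which is again square
      integrable.\<close>
    have Lq: "L2 \<mu> (\<lambda>\<xi>. of_real (q \<xi>) * f \<xi>)"
      by (intro L2_multiplier[OF f] Psi_multiplierD(1,2) mult.IH)
    show "AE z in mT. Psi (\<lambda>\<xi>. of_real (p \<xi> * q \<xi>) * f \<xi>) z = of_real (p z * q z) * Psi f z"
      using Psi_multiplierD(3)[OF mult.IH(1) Lq] Psi_multiplierD(3)[OF mult.IH(2) f]
      unfolding of_real_mult mult.assoc
      by eventually_elim simp
  qed
qed

text \<open>Convergence at every point of the circle is used twice: \<mu>-almost everywhere, for
  dominated convergence in L2(\<mu>), and Lebesgue-almost everywhere, for the factors p n outside
  \<open>Psi\<close>.\<close>

lemma Psi_multiplier_limit: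
  assumes p: "\<And>n::nat. Psi_multiplier (p n)" and C: "\<And>n x. cmod x = 1 \<Longrightarrow> \<bar>p n x\<bar> \<le> C"
    and lim: "\<And>x. cmod x = 1 \<Longrightarrow> (\<lambda>n. p n x) \<longlonglongrightarrow> g x" and g[measurable]: "g \<in> borel_measurable borel"
  shows "Psi_multiplier g"
proof -
  have gC: "\<bar>g x\<bar> \<le> C" if "cmod x = 1" for x
    by (rule LIMSEQ_le_const2[OF tendsto_rabs[OF lim[OF that]]]) (use C that in auto)
  have bd: "bounded (g ` sphere 0 1)" by (rule boundedI[of _ C]) (auto simp: gC)
  have pm[measurable]: "p n \<in> borel_measurable borel" for n using p by (simp add: Psi_multiplier_def)
  have "AE z in mT. Psi (\<lambda>\<xi>. of_real (g \<xi>) * f \<xi>) z = of_real (g z) * Psi f z" if f: "L2 \<mu> f" for f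
  proof -
    let ?f = "\<lambda>n \<xi>. of_real (p n \<xi>) * f \<xi>" and ?g = "\<lambda>\<xi>. of_real (g \<xi>) * f \<xi>"
    have [measurable]: "f \<in> borel_measurable borel"
      using L2_measurable[OF f] by (simp cong: measurable_cong_sets)
    have Lf: "L2 \<mu> (?f n)" for n
      using p by (intro L2_multiplier[OF f]) (auto simp: Psi_multiplier_def)
    have Lg: "L2 \<mu> ?g" by (intro L2_multiplier[OF f] g bd)
    have "(\<lambda>n. \<integral>\<xi>. (cmod (?f n \<xi> - ?g \<xi>))\<^sup>2 \<partial>\<mu>) \<longlonglongrightarrow> (\<integral>\<xi>. 0 \<partial>\<mu>)"
    proof (rule integral_dominated_convergence[where w="\<lambda>\<xi>. (2 * C)\<^sup>2 * (cmod (f \<xi>))\<^sup>2"])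
      show "integrable \<mu> (\<lambda>\<xi>. (2 * C)\<^sup>2 * (cmod (f \<xi>))\<^sup>2)" using f by (simp add: L2_def)
      have eq: "cmod (?f n \<xi> - ?g \<xi>) = \<bar>p n \<xi> - g \<xi>\<bar> * cmod (f \<xi>)" for n \<xi>
      proof -
        have "?f n \<xi> - ?g \<xi> = of_real (p n \<xi> - g \<xi>) * f \<xi>" by (simp add: algebra_simps)
        then show ?thesis by (simp only: norm_mult norm_of_real)
      qed
      show "AE \<xi> in \<mu>. (\<lambda>n. (cmod (?f n \<xi> - ?g \<xi>))\<^sup>2) \<longlonglongrightarrow> 0"
        using AE_norm
      proof eventually_elim
        case (elim \<xi>)
        have "(\<lambda>n. (\<bar>p n \<xi> - g \<xi>\<bar> * cmod (f \<xi>))\<^sup>2) \<longlonglongrightarrow> (\<bar>g \<xi> - g \<xi>\<bar> * cmod (f \<xi>))\<^sup>2"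
          by (intro tendsto_intros lim elim)
        then show ?case unfolding eq by simp
      qed
      show "AE \<xi> in \<mu>. norm ((cmod (?f n \<xi> - ?g \<xi>))\<^sup>2) \<le> (2 * C)\<^sup>2 * (cmod (f \<xi>))\<^sup>2" for n
        using AE_norm
      proof eventually_elim
        case (elim \<xi>)
        have "\<bar>p n \<xi> - g \<xi>\<bar> \<le> 2 * C" using C[OF elim, of n] gC[OF elim] by linarith
        then have "(\<bar>p n \<xi> - g \<xi>\<bar> * cmod (f \<xi>))\<^sup>2 \<le> (2 * C * cmod (f \<xi>))\<^sup>2"
          by (intro power_mono mult_right_mono) auto
        then show ?case unfolding eq by (simp add: power_mult_distrib)
      qed
    qed measurable
    then have "(\<lambda>n. \<integral>\<xi>. (cmod (?f n \<xi> - ?g \<xi>))\<^sup>2 \<partial>\<mu>) \<longlonglongrightarrow> 0" by simp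
    then obtain r :: "nat \<Rightarrow> nat" where r: "strict_mono r" "AE z in mT. (\<lambda>n. Psi (?f (r n)) z) \<longlonglongrightarrow> Psi ?g z"
      by (rule Psi_limit[of ?f ?g, OF Lf Lg])
    have "AE z in mT. \<forall>n. Psi (?f n) z = of_real (p n z) * Psi f z"
      using p f by (subst AE_all_countable) (simp add: Psi_multiplier_def)
    then show ?thesis
      using r(2) AE_mT_norm
    proof eventually_elim
      case (elim z)
      have "(\<lambda>n. of_real (p (r n) z) * Psi f z) \<longlonglongrightarrow> of_real (g z) * Psi f z"
        using LIMSEQ_subseq_LIMSEQ[OF lim[OF elim(3)] r(1)]
        by (intro tendsto_intros) (simp add: o_def)
      moreover have "(\<lambda>n. of_real (p (r n) z) * Psi f z) \<longlonglongrightarrow> Psi ?g z"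
        using elim(1,2) by simp
      ultimately show ?case by (rule LIMSEQ_unique[symmetric])
    qed
  qed
  then show ?thesis using bd g by (simp add: Psi_multiplier_def)
qed

text \<open>Stone-Weierstrass gives polynomials within 1 / (n + 1) of a continuous g on the circle,
  hence bounded there by C + 1; the monotone class theorem does the rest.\<close>

lemma Psi_multiplier_bounded:
  assumes g: "g \<in> borel_measurable borel" "bounded (range g)"
  shows "Psi_multiplier g"
proof (rule functional_monotone_class[of Psi_multiplier, OF _ Psi_multiplier_lin _ g])
  fix g :: "complex \<Rightarrow> real" assume g: "continuous_on UNIV g" "bounded (range g)"
  obtain C where C: "\<And>x. \<bar>g x\<bar> \<le> C" using g(2) by (auto simp: bounded_iff)
  have cont: "continuous_on (sphere 0 1) g" by (rule continuous_on_subset[OF g(1)]) simp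
  have "\<forall>n::nat. \<exists>p. real_polynomial_function p \<and> (\<forall>x\<in>sphere 0 1. \<bar>g x - p x\<bar> < 1 / real (Suc n))"
  proof
    fix n :: nat
    have "0 < 1 / real (Suc n)" by simp
    from Stone_Weierstrass_real_polynomial_function[OF compact_sphere cont this]
    show "\<exists>p. real_polynomial_function p \<and> (\<forall>x\<in>sphere 0 1. \<bar>g x - p x\<bar> < 1 / real (Suc n))"
      by metis
  qed
  from choice[OF this] obtain p where p: "\<And>n. real_polynomial_function (p n)"
    and pg: "\<And>n x. x \<in> sphere 0 1 \<Longrightarrow> \<bar>g x - p n x\<bar> < 1 / real (Suc n)"
    by blast
  show "Psi_multiplier g"
  proof (rule Psi_multiplier_limit)
    show "Psi_multiplier (p n)" for n by (rule Psi_multiplier_polynomial[OF p])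
    show "\<bar>p n x\<bar> \<le> C + 1" if "cmod x = 1" for n x
    proof -
      have "1 / real (Suc n) \<le> 1" by simp
      moreover have "\<bar>g x - p n x\<bar> < 1 / real (Suc n)" using that by (intro pg) simp
      ultimately show ?thesis using C[of x] by linarith
    qed
    show "(\<lambda>n. p n x) \<longlonglongrightarrow> g x" if "cmod x = 1" for x
    proof -
      have "(\<lambda>n. p n x - g x) \<longlonglongrightarrow> 0"
      proof (rule tendsto_rabs_zero_cancel, rule tendsto_sandwich[where f="\<lambda>_. 0"])
        show "\<forall>\<^sub>F n in sequentially. \<bar>p n x - g x\<bar> \<le> 1 / real (Suc n)"
          using pg[of x] that by (auto intro!: always_eventually less_imp_le simp: abs_minus_commute)
        show "(\<lambda>n. 1 / real (Suc n)) \<longlonglongrightarrow> 0"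
          using LIMSEQ_Suc[OF lim_1_over_n[where 'a=real]] by simp
      qed auto
      then show ?thesis by (simp add: LIM_zero_iff)
    qed
    show "g \<in> borel_measurable borel" by (rule borel_measurable_continuous_onI[OF g(1)])
  qed
next
  fix f :: "nat \<Rightarrow> complex \<Rightarrow> real" and g C
  assume "\<And>n. Psi_multiplier (f n)" "\<And>n x. \<bar>f n x\<bar> \<le> C" "\<And>x. (\<lambda>n. f n x) \<longlonglongrightarrow> g x" "g \<in> borel_measurable borel"
  then show "Psi_multiplier g" by (rule Psi_multiplier_limit)
qed

text \<open>An unbounded f is tamed by g = 1 / (1 + |f|): g and the real and imaginary parts of g f
  are bounded multipliers, so g Psi f = Psi (g f) = g f Psi 1, and the positive factor g
  cancels.\<close>

lemma Psi_eq:
  assumes f: "L2 \<mu> f"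
  shows "AE z in mT. Psi f z = f z * (s * D z)"
proof -
  have fm[measurable]: "f \<in> borel_measurable borel"
    using L2_measurable[OF f] by (simp cong: measurable_cong_sets)
  define g where "g x = 1 / (1 + cmod (f x))" for x
  have g0: "0 < g x" "g x \<le> 1" for x
    unfolding g_def by (simp_all add: add_pos_nonneg)
  have [measurable]: "g \<in> borel_measurable borel" unfolding g_def by measurable
  have gb: "Psi_multiplier g"
    by (rule Psi_multiplier_bounded) (use g0 in \<open>auto intro!: boundedI[of _ 1] simp: abs_of_pos\<close>)
  have gf: "cmod (of_real (g x) * f x) \<le> 1" for x
  proof -
    have "g x * cmod (f x) \<le> 1" unfolding g_def by (simp add: divide_simps add_pos_nonneg)
    then show ?thesis using g0(1)[of x] by (simp add: norm_mult)
  qed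
  let ?a = "\<lambda>x. Re (of_real (g x) * f x)" and ?b = "\<lambda>x. Im (of_real (g x) * f x)"
  have le: "\<bar>?a x\<bar> \<le> 1" "\<bar>?b x\<bar> \<le> 1" for x
    using order_trans[OF abs_Re_le_cmod gf[of x]] order_trans[OF abs_Im_le_cmod gf[of x]] .
  have "bounded (range ?a)" "bounded (range ?b)"
    by (rule boundedI[of _ 1], use le in \<open>auto simp del: Re_complex_of_real\<close>)+
  moreover have "?a \<in> borel_measurable borel" "?b \<in> borel_measurable borel"
    by measurable
  ultimately have ab: "Psi_multiplier ?a" "Psi_multiplier ?b"
    by (auto intro: Psi_multiplier_bounded)
  have La: "L2 \<mu> (\<lambda>\<xi>. of_real (?a \<xi>) * 1)" "L2 \<mu> (\<lambda>\<xi>. of_real (?b \<xi>) * 1)"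
    by (intro L2_multiplier[OF L2_one] Psi_multiplierD(1,2) ab)+
  have eq: "(\<lambda>\<xi>. of_real (g \<xi>) * f \<xi>) = (\<lambda>\<xi>. 1 * (of_real (?a \<xi>) * 1) + \<i> * (of_real (?b \<xi>) * 1))"
    by (auto simp: complex_eq_iff)
  show ?thesis
    using Psi_multiplierD(3)[OF gb f] Psi_multiplierD(3)[OF ab(1) L2_one] Psi_multiplierD(3)[OF ab(2) L2_one]
      Psi_lin[OF La, of 1 \<i>, folded eq] Psi_one
  proof eventually_elim
    case (elim z)
    have "of_real (g z) * Psi f z = (of_real (?a z) + \<i> * of_real (?b z)) * Psi (\<lambda>_. 1) z"
      using elim(1-4) by (simp only:) (simp add: algebra_simps)
    also have "of_real (?a z) + \<i> * of_real (?b z) = of_real (g z) * f z"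
      by (simp add: complex_eq_iff)
    finally have "of_real (g z) * Psi f z = of_real (g z) * (f z * (s * D z))"
      unfolding elim(5) by (simp add: mult.assoc)
    then show ?case using g0(1)[of z] by simp
  qed
qed

end

subsection \<open>The first component\<close>

lemma cauchy_mT_lin:
  assumes f: "L2 mT f" and g: "L2 mT g" and l: "cmod l < 1"
  shows "cauchy mT (\<lambda>z. a * f z + b * g z) l = a * cauchy mT f l + b * cauchy mT g l"
    and "integrable mT (\<lambda>z. f z / (1 - cnj z * l))"
proof -
  have b: "AE z in mT. cmod (1 / (1 - cnj z * l)) \<le> 1 / (1 - cmod l)"
    using AE_mT_norm
  proof eventually_elim
    case (elim z)
    have "1 - cmod l \<le> cmod (1 - cnj z * l)"
      using norm_triangle_ineq2[of 1 "cnj z * l"] elim by (simp add: norm_mult)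
    then show ?case using l unfolding norm_divide norm_one by (intro frac_le) auto
  qed
  have "(\<lambda>z. 1 / (1 - cnj z * l)) \<in> borel_measurable mT" by (rule measurable_mT) measurable
  then have q: "L2 mT (\<lambda>z. 1 / (1 - cnj z * l))" using b by (rule mT.L2_bounded)
  have i: "integrable mT (\<lambda>z. f z / (1 - cnj z * l))" if "L2 mT f" for f
    using L2_mult_integrable[OF that q] by simp
  show "integrable mT (\<lambda>z. f z / (1 - cnj z * l))" by (rule i[OF f])
  have "cauchy mT (\<lambda>z. a * f z + b * g z) l = (\<integral>z. a * (f z / (1 - cnj z * l)) + b * (g z / (1 - cnj z * l)) \<partial>mT)"
    unfolding cauchy_def by (simp add: add_divide_distrib)
  also have "\<dots> = a * cauchy mT f l + b * cauchy mT g l"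
    unfolding cauchy_def
    by (subst Bochner_Integration.integral_add) (simp_all only: integrable_mult_right i f g integral_mult_right_zero)
  finally show "cauchy mT (\<lambda>z. a * f z + b * g z) l = a * cauchy mT f l + b * cauchy mT g l" .
qed

lemma cauchy_mT_cong:
  assumes f: "L2 mT f" and eq: "AE z in mT. f z = g z" and l: "cmod l < 1"
  shows "cauchy mT f l = cauchy mT g l"
  unfolding cauchy_def
  by (rule integral_mT_cong)
     (use borel_measurable_integrable[OF cauchy_mT_lin(2)[OF f f l]] eq in \<open>auto elim!: eventually_mono\<close>)

text \<open>Conjugation makes the integrand holomorphic in z, with value 1 at the origin.\<close>

lemma cauchy_mT_one: assumes l: "cmod l < 1" shows "cauchy mT (\<lambda>_. 1) l = 1"
proof -
  have ne: "1 - z * cnj l \<noteq> 0" if "cmod z \<le> 1" for z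
  proof
    assume "1 - z * cnj l = 0"
    then have "cmod (z * cnj l) = 1" by (metis eq_iff_diff_eq_0 norm_one)
    then show False using that l mult_left_le_one_le[of "cmod l" "cmod z"] by (simp add: norm_mult)
  qed
  have "cauchy mT (\<lambda>_. 1) l = (\<integral>z. cnj (1 / (1 - z * cnj l)) \<partial>mT)"
    unfolding cauchy_def by simp
  also have "\<dots> = cnj (\<integral>z. 1 / (1 - z * cnj l) \<partial>mT)"
    by (rule Bochner_Integration.integral_cnj)
  also have "(\<integral>z. 1 / (1 - z * cnj l) \<partial>mT) = (\<integral>z. 1 / (1 - of_real 1 * z * cnj l) \<partial>mTb)"
    unfolding mT_def by (subst integral_completion) simp_all
  also have "\<dots> = 1 / (1 - 0 * cnj l)"
    by (rule mTb_mean_value[of "\<lambda>z. 1 / (1 - z * cnj l)" 1])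
       (use ne in \<open>auto intro!: holomorphic_intros\<close>)
  finally show ?thesis by simp
qed

context clark
begin

lemma W_alt: "W = (\<lambda>z. (1 - \<gamma>) * 1 + (cnj \<gamma> - 1) * th z)"
  by (auto simp: W_def algebra_simps)

lemma W_H2: "W \<in> H2"
  unfolding W_alt by (intro H2_lin const_H2 th_H2)

lemma one_plus_nonzero: assumes w: "cmod w \<le> 1" shows "1 + cnj \<gamma> * w \<noteq> 0"
proof
  assume "1 + cnj \<gamma> * w = 0"
  then have "cnj \<gamma> * w = - 1" by (simp add: eq_neg_iff_add_eq_0 add.commute)
  then have "cmod \<gamma> * cmod w = 1" by (metis complex_mod_cnj norm_minus_cancel norm_mult norm_one)
  then show False
    using gamma w mult_left_le[of "cmod w" "cmod \<gamma>"] by simp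
qed

text \<open>For h = f / (\<xi> - l) one has \<xi> h = f + l h and m(h) = C[f \<mu>](l), so the first
  component of s \<open>Phi f\<close> is (z - l) times that of s \<open>Phi h\<close>, plus
  C[f \<mu>](l) W. On the circle (z - l) / (1 - cnj z l) = z, so the first summand contributes the
  mean of z times an H2 function, which is 0.\<close>

lemma cauchy_Phi:
  assumes f: "L2 \<mu> f" and l: "cmod l < 1"
  shows "s * cauchy mT (fst (Phi f)) l = cauchy \<mu> f l * cauchy mT W l"
proof -
  define h where "h \<xi> = 1 / (\<xi> - l) * f \<xi>" for \<xi>
  have h: "L2 \<mu> h" unfolding h_def[abs_def]
  proof (rule L2_scale[OF f, where C="1 / (1 - cmod l)"])
    show "cmod (1 / (\<xi> - l)) \<le> 1 / (1 - cmod l)" if "cmod \<xi> = 1" for \<xi>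
      using norm_triangle_ineq2[of \<xi> l] that l unfolding norm_divide norm_one by (intro frac_le) auto
  qed measurable
  have nz: "\<xi> - l \<noteq> 0" "1 - cnj \<xi> * l \<noteq> 0" if "cmod \<xi> = 1" for \<xi>
    using that l one_minus_bound[OF that l] by auto
  have ratio: "\<xi> / (\<xi> - l) = 1 / (1 - cnj \<xi> * l)" if "cmod \<xi> = 1" for \<xi>
  proof -
    have "\<xi> * (1 - cnj \<xi> * l) = \<xi> - l" using unit_cnj(1)[OF that] by (simp add: algebra_simps)
    then show ?thesis using nz[OF that] by (metis frac_eq_eq mult.commute mult_1)
  qed
  have "AE \<xi> in \<mu>. \<xi> * h \<xi> = 1 * f \<xi> + l * h \<xi>"
    using AE_norm
  proof eventually_elim
    case (elim \<xi>)
    have "(\<xi> - l) * h \<xi> = f \<xi>" using nz(1)[OF elim] by (simp add: h_def)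
    then show ?case by (simp add: algebra_simps)
  qed
  note eqs = Phi_AE[OF L2_xi[OF h] L2_lin[OF f h] this] Phi_lin[OF f h, of 1 l] Phi_shift[OF h]
  have m: "ip \<mu> h cnj = cauchy \<mu> f l"
    unfolding ip_def cauchy_def
  proof (rule integral_cong_AE)
    have [measurable]: "f \<in> borel_measurable borel"
      using L2_measurable[OF f] by (simp cong: measurable_cong_sets)
    show "(\<lambda>x. h x * cnj (cnj x)) \<in> borel_measurable \<mu>" "(\<lambda>x. f x / (1 - cnj x * l)) \<in> borel_measurable \<mu>"
      unfolding h_def by measurable
    show "AE \<xi> in \<mu>. h \<xi> * cnj (cnj \<xi>) = f \<xi> / (1 - cnj \<xi> * l)"
      using AE_norm
    proof eventually_elim
      case (elim \<xi>)
      have "h \<xi> * cnj (cnj \<xi>) = f \<xi> * (\<xi> / (\<xi> - l))" by (simp add: h_def)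
      then show ?case unfolding ratio[OF elim] by simp
    qed
  qed
  let ?u = "fst (Phi f)" and ?v = "fst (Phi h)"
  note Lu = Phi_L2(1)[OF f] and Lv = Phi_L2(1)[OF h] and LW = H2_L2[OF W_H2]
  have zv0: "(\<integral>z. z * ?v z \<partial>mT) = 0"
    by (rule H2_integral_mult_z[OF Phi_H2[OF h]])
  have i: "integrable mT (\<lambda>z. z * ?v z)" "integrable mT (\<lambda>z. W z / (1 - cnj z * l))"
    by (rule mT.L2_integrable[OF L2_mT_monom(1)[OF Lv]]) (rule cauchy_mT_lin(2)[OF LW LW l])
  have "s * cauchy mT ?u l = (\<integral>z. s * (?u z / (1 - cnj z * l)) \<partial>mT)"
    unfolding cauchy_def by (rule integral_mult_right_zero[symmetric])
  also have "\<dots> = (\<integral>z. s * (z * ?v z) + cauchy \<mu> f l * (W z / (1 - cnj z * l)) \<partial>mT)"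
  proof (rule integral_mT_cong)
    show "(\<lambda>z. s * (?u z / (1 - cnj z * l))) \<in> borel_measurable mT"
      by (rule borel_measurable_integrable[OF integrable_mult_right[OF cauchy_mT_lin(2)[OF Lu Lu l]]])
    show "AE z in mT. s * (?u z / (1 - cnj z * l)) = s * (z * ?v z) + cauchy \<mu> f l * (W z / (1 - cnj z * l))"
      using eqs AE_mT_norm
    proof eventually_elim
      case (elim z)
      have "s * (?u z + l * ?v z) = z * (s * ?v z) + cauchy \<mu> f l * W z"
        using elim(1,2,3) m by simp
      then have "s * ?u z = (z - l) * (s * ?v z) + cauchy \<mu> f l * W z"
        by (simp add: algebra_simps)
      also have "z - l = z * (1 - cnj z * l)"
        using unit_cnj(1)[OF elim(4)] by (simp add: algebra_simps)
      finally have "s * ?u z = (z * s * ?v z) * (1 - cnj z * l) + cauchy \<mu> f l * W z"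
        by (simp add: mult_ac)
      then show ?case using nz(2)[OF elim(4)] by (simp add: divide_simps mult_ac)
    qed
  qed
  also have "\<dots> = s * (\<integral>z. z * ?v z \<partial>mT) + cauchy \<mu> f l * cauchy mT W l"
    unfolding cauchy_def[of mT]
    by (subst Bochner_Integration.integral_add) (simp_all only: integrable_mult_right i integral_mult_right_zero)
  finally show ?thesis unfolding zv0 by simp
qed

text \<open>The case f = 1 of \<open>cauchy_Phi\<close>, where the image is known in terms of
  th.\<close>

lemma cauchy_th:
  assumes l: "cmod l < 1"
  shows "1 + cnj \<gamma> * cauchy mT th l = C1 l * cauchy mT W l"
proof -
  have "s * cauchy mT (fst (Phi (\<lambda>_. 1))) l = cauchy mT (\<lambda>z. s * fst (Phi (\<lambda>_. 1)) z + 0 * fst (Phi (\<lambda>_. 1)) z) l"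
    using cauchy_mT_lin(1)[OF Phi_L2(1)[OF L2_one] Phi_L2(1)[OF L2_one] l, of s 0] by simp
  also have "\<dots> = cauchy mT (\<lambda>z. 1 * 1 + cnj \<gamma> * th z) l"
    by (rule cauchy_mT_cong[OF _ _ l])
       (use Phi_one Phi_L2(1)[OF L2_one] in \<open>auto elim!: eventually_mono intro: L2_cmult\<close>)
  also have "\<dots> = 1 + cnj \<gamma> * cauchy mT th l"
    using cauchy_mT_lin(1)[OF L2_mT_const[of 1] th_L2 l, of 1 "cnj \<gamma>"] cauchy_mT_one[OF l] by simp
  finally show ?thesis using cauchy_Phi[OF L2_one l] by simp
qed

text \<open>By \<open>cauchy_th\<close>, 1 / C1 is C[W] / (1 + cnj \<gamma> C[th]), with radial
  limit W / (1 + cnj \<gamma> th) almost everywhere; the denominator is nonzero as |\<gamma> th| <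
  1. A zero of W would thus force 1 / C1 to tend to 0, which happens only on a null set.\<close>

lemma AE_boundary_W:
  "AE z in mT. ((\<lambda>r. cauchy mT W (of_real r * z)) \<longlongrightarrow> W z) (at_left 1) \<and> W z \<noteq> 0"
proof -
  have "AE z in mT. \<not> ((\<lambda>r. 1 / C1 (of_real r * z)) \<longlongrightarrow> 0) (at_left 1)"
    unfolding AE_mT_iff by (rule inverse_C1_not_tendsto_0)
  then show ?thesis
    using AE_mT_norm th_bounded fatou_H2[OF th_H2] fatou_H2[OF W_H2]
  proof eventually_elim
    case (elim z)
    let ?T = "\<lambda>r. cauchy mT th (of_real r * z)" and ?W = "\<lambda>r. cauchy mT W (of_real r * z)"
    have nz: "1 + cnj \<gamma> * th z \<noteq> 0" by (rule one_plus_nonzero[OF elim(3)])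
    have "((\<lambda>r. ?W r / (1 + cnj \<gamma> * ?T r)) \<longlongrightarrow> W z / (1 + cnj \<gamma> * th z)) (at_left 1)"
      using elim(4,5) nz by (intro tendsto_intros)
    then have "((\<lambda>r. 1 / C1 (of_real r * z)) \<longlongrightarrow> W z / (1 + cnj \<gamma> * th z)) (at_left 1)"
    proof (rule Lim_transform_eventually)
      have ev: "\<forall>\<^sub>F r in at_left 1. 1 + cnj \<gamma> * ?T r \<noteq> 0"
        using elim(4) nz by (intro tendsto_imp_eventually_ne[where c="1 + cnj \<gamma> * th z"] tendsto_intros)
      show "\<forall>\<^sub>F r in at_left 1. ?W r / (1 + cnj \<gamma> * ?T r) = 1 / C1 (of_real r * z)"
        using at_left_1_bounds ev
      proof eventually_elim
        case (elim r)
        have l: "cmod (of_real r * z) < 1" using elim(1) \<open>cmod z = 1\<close> by (simp add: norm_mult)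
        show ?case using elim(2) cauchy_th[OF l] by auto
      qed
    qed
    then have "W z / (1 + cnj \<gamma> * th z) \<noteq> 0" using elim(1) by metis
    then show ?case using elim(5) by auto
  qed
qed

lemma Tplus_eq:
  assumes f: "L2 \<mu> f"
  shows "AE z in mT. Tplus \<mu> f z = s * fst (Phi f) z / W z"
  using AE_boundary_W fatou_H2[OF Phi_H2[OF f]] AE_mT_norm
proof eventually_elim
  case (elim z)
  let ?u = "\<lambda>r. cauchy mT (fst (Phi f)) (of_real r * z)" and ?W = "\<lambda>r. cauchy mT W (of_real r * z)"
  have "((\<lambda>r. s * ?u r / ?W r) \<longlongrightarrow> s * fst (Phi f) z / W z) (at_left 1)"
    using elim by (intro tendsto_intros) auto
  moreover have "\<forall>\<^sub>F r in at_left 1. ?W r \<noteq> 0"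
    using elim(1) by (intro tendsto_imp_eventually_ne[where c="W z"]) auto
  then have "\<forall>\<^sub>F r in at_left 1. s * ?u r / ?W r = Tr \<mu> r f z"
    using at_left_1_bounds
  proof eventually_elim
    case (elim r)
    have l: "cmod (of_real r * z) < 1" using elim(2) \<open>cmod z = 1\<close> by (simp add: norm_mult)
    show ?case using elim(1) cauchy_Phi[OF f l] by (simp add: Tr_eq_cauchy)
  qed
  ultimately have "((\<lambda>r. Tr \<mu> r f z) \<longlongrightarrow> s * fst (Phi f) z / W z) (at_left 1)"
    by (rule Lim_transform_eventually)
  \<comment> \<open>\<open>Lim\<close> returns this value because the limit has been shown to
    exist.\<close>
  then show ?case unfolding Tplus_def by (intro tendsto_Lim) simp_all
qed

lemma Psi_eq_ac_version:
  assumes f: "L2 \<mu> f" and ac: "ac_version \<mu> f fa"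
  shows "AE z in mT. Psi f z = fa z * (s * D z)"
proof -
  obtain N where fa[measurable]: "fa \<in> borel_measurable borel" and N[measurable]: "N \<in> sets borel"
    and N0: "emeasure mTb N = 0" and eq: "AE \<xi> in \<mu>. \<xi> \<notin> N \<longrightarrow> fa \<xi> = f \<xi>"
    using ac unfolding ac_version_def by blast
  \<comment> \<open>f on the Lebesgue-null carrier of the singular part, \<open>fa\<close>
    elsewhere: \<mu>-a.e. equal to f, Lebesgue-a.e. equal to \<open>fa\<close>.\<close>
  define g where "g \<xi> = (if \<xi> \<in> N then f \<xi> else fa \<xi>)" for \<xi>
  have [measurable]: "f \<in> borel_measurable borel"
    using L2_measurable[OF f] by (simp cong: measurable_cong_sets)
  have gm[measurable]: "g \<in> borel_measurable borel" unfolding g_def[abs_def] by measurable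
  have fg: "AE \<xi> in \<mu>. f \<xi> = g \<xi>"
    using eq by eventually_elim (simp add: g_def)
  have g: "L2 \<mu> g"
  proof -
    have "integrable \<mu> (\<lambda>\<xi>. (cmod (f \<xi>))\<^sup>2) \<longleftrightarrow> integrable \<mu> (\<lambda>\<xi>. (cmod (g \<xi>))\<^sup>2)"
    proof (rule integrable_cong_AE)
      show "AE \<xi> in \<mu>. (cmod (f \<xi>))\<^sup>2 = (cmod (g \<xi>))\<^sup>2" using fg by eventually_elim simp
    qed measurable
    then show ?thesis using f gm by (simp add: L2_def cong: measurable_cong_sets)
  qed
  have "AE z in mTb. z \<notin> N" using N0 by (intro AE_not_in null_setsI) auto
  then have "AE z in mT. z \<notin> N" unfolding AE_mT_iff .
  then show ?thesis
    using Psi_AE[OF f g fg] Psi_eq[OF g]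
  proof eventually_elim
    case (elim z)
    have "g z = fa z" using elim(1) by (simp add: g_def)
    then show ?case using elim(2,3) by simp
  qed
qed

text \<open>The first component is \<open>Tplus_eq\<close> with W eliminated through T_+ 1 = (1 +
  cnj \<gamma> th) / W. For the second, both sides are multiplied by W and the definition of
  \<open>Psi\<close> is solved for the second component of \<open>Phi f\<close>.\<close>

theorem Phi_representation:
  assumes f: "L2 \<mu> f" and ac: "ac_version \<mu> f fa"
  shows "AE z in mT. s * fst (Phi f) z = (1 + cnj \<gamma> * th z) / Tplus \<mu> (\<lambda>_. 1) z * Tplus \<mu> f z
    \<and> s * snd (Phi f) z = (cnj \<gamma> - (cnj \<gamma> - 1) * Tplus \<mu> (\<lambda>_. 1) z) * D z * fa z
        + (cnj \<gamma> - 1) * D z * Tplus \<mu> f z"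
  using AE_boundary_W Tplus_eq[OF f] Tplus_eq[OF L2_one] Phi_one th_bounded Psi_eq_ac_version[OF f ac]
proof eventually_elim
  case (elim z)
  have W: "W z \<noteq> 0" using elim(1) by simp
  \<comment> \<open>T_+ 1 stands in a denominator of the claim, so its numerator must not
    vanish.\<close>
  have nz: "1 + cnj \<gamma> * th z \<noteq> 0" by (rule one_plus_nonzero[OF elim(5)])
  have T1: "Tplus \<mu> (\<lambda>_. 1) z = (1 + cnj \<gamma> * th z) / W z"
    using elim(3,4) by simp
  have Tf: "W z * Tplus \<mu> f z = s * fst (Phi f) z"
    using elim(2) W by simp
  have 1: "(1 + cnj \<gamma> * th z) / Tplus \<mu> (\<lambda>_. 1) z * Tplus \<mu> f z = s * fst (Phi f) z"
    unfolding T1 using nz W Tf by simp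
  \<comment> \<open>Times W, the coefficient of \<open>fa\<close> collapses to s^2: one factor s
    belongs to \<open>Psi f\<close> = \<open>fa\<close> s D, the other to the left-hand
    side.\<close>
  have c: "W z * (cnj \<gamma> - (cnj \<gamma> - 1) * Tplus \<mu> (\<lambda>_. 1) z) = s * s"
  proof -
    have "W z * (cnj \<gamma> - (cnj \<gamma> - 1) * Tplus \<mu> (\<lambda>_. 1) z)
        = W z * cnj \<gamma> - (cnj \<gamma> - 1) * (W z * Tplus \<mu> (\<lambda>_. 1) z)"
      by (simp add: algebra_simps)
    also have "W z * Tplus \<mu> (\<lambda>_. 1) z = 1 + cnj \<gamma> * th z" unfolding T1 using W by simp
    finally show ?thesis unfolding s_s W_def by (simp add: algebra_simps)
  qed
  have "W z * ((cnj \<gamma> - (cnj \<gamma> - 1) * Tplus \<mu> (\<lambda>_. 1) z) * D z * fa z + (cnj \<gamma> - 1) * D z * Tplus \<mu> f z)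
      = (W z * (cnj \<gamma> - (cnj \<gamma> - 1) * Tplus \<mu> (\<lambda>_. 1) z)) * D z * fa z
        + (cnj \<gamma> - 1) * D z * (W z * Tplus \<mu> f z)"
    by (simp add: algebra_simps)
  also have "\<dots> = s * (fa z * (s * D z)) + (cnj \<gamma> - 1) * D z * (s * fst (Phi f) z)"
    unfolding c Tf by (simp add: algebra_simps)
  also have "\<dots> = s * Psi f z + (cnj \<gamma> - 1) * D z * (s * fst (Phi f) z)"
    using elim(6) by simp
  also have "\<dots> = W z * (s * snd (Phi f) z)"
    by (simp add: Psi_def algebra_simps)
  finally show ?case using 1 W by simp
qed

end

theorem theorem4p2:
  fixes \<mu> :: "complex measure" and \<gamma> :: complex
    and Phi :: "(complex \<Rightarrow> complex) \<Rightarrow> (complex \<Rightarrow> complex) \<times> (complex \<Rightarrow> complex)"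
  assumes "prob_space \<mu>" and "sets \<mu> = sets borel"
    and "emeasure \<mu> (- sphere 0 1) = 0"
    and "cmod \<gamma> < 1"
    and "\<gamma> \<noteq> 0 \<or> \<mu> \<noteq> mTb"
    and "is_Phi_star \<gamma> \<mu> Phi"
    and "L2 \<mu> f"
    and "ac_version \<mu> f fa"
  shows "AE z in mT.
     complex_of_real (sqrt (1 - (cmod \<gamma>)\<^sup>2)) * fst (Phi f) z
       = (1 + cnj \<gamma> * theta_b \<gamma> \<mu> z) / Tplus \<mu> (\<lambda>_. 1) z * Tplus \<mu> f z
   \<and> complex_of_real (sqrt (1 - (cmod \<gamma>)\<^sup>2)) * snd (Phi f) z
       = (cnj \<gamma> - (cnj \<gamma> - 1) * Tplus \<mu> (\<lambda>_. 1) z) * Delta \<gamma> \<mu> z * fa z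
         + (cnj \<gamma> - 1) * Delta \<gamma> \<mu> z * Tplus \<mu> f z"
proof -
  interpret prob_space \<mu> by fact
  interpret clark \<mu> \<gamma> Phi
    by unfold_locales (use assms in auto)
  show ?thesis
    using Phi_representation[OF assms(7,8)] unfolding s_def .
qed

end
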